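(* Let $\lambda\supseteq\mu$ be partitions with $\mathrm{rank}(\lambda/\mu)=r$. Then $$\hat{s}_{\lambda/\mu}=(-1)^{z(\lambda/\mu)}\sum_{\mathcal{I}=\{(u_1,v_1),\dots,(u_r,v_r)\}}(-1)^{c(\mathcal{I})}\prod_{i=1}^r\tilde{p}_{v_i-u_i},$$ where $\mathcal{I}$ ranges over all interval sets of $\lambda/\mu$.
   Context: Skew diagram $\lambda/\mu=\{(i,j):\mu_i<j\le\lambda_i\}$; square $(i,j)$ drawn as $[j-1,j]\times[-i,-i+1]$. $\mathrm{rank}(\lambda/\mu)$: an outside top corner is $(i,j)\in\lambda/\mu$ with $(i-1,j),(i,j-1)\notin\lambda/\mu$; an inside top corner is $(i,j)\in\lambda/\mu$ with $(i-1,j),(i,j-1)\in\lambda/\mu$, $(i-1,j-1)\notin\lambda/\mu$; the diagonal of corner $(i,j)$ is $\{(i+p,j+p)\in\lambda/\mu:p\ge0\}$; rank = number of squares on outside diagonals minus number on inside diagonals. Write $s_{\lambda/\mu}=\sum_\nu z_\nu^{-1}\chi^{\lambda/\mu}(\nu)p_\nu$ (power sums $p_\nu$, $z_\nu=\prod_i i^{m_i(\nu)}m_i(\nu)!$ with $m_i(\nu)$ the number of parts of $\nu$ equal to $i$), and let $\hat{s}_{\lambda/\mu}=\sum_{\nu:\ell(\nu)=r}z_\nu^{-1}\chi^{\lambda/\mu}(\nu)p_\nu$. Let $\tilde{p}_i=p_i/i$. Code: for a partition $\alpha$, its boundary path goes up $x=0$ from $y=-\infty$ to $(0,-\ell(\alpha))$,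 follows the lower-right boundary of $\alpha$ to $(\alpha_1,0)$, then right along $y=0$; the step starting at $(x,y)$ has index $x+y$; $c_k=1$ if step $k$ of the path of $\lambda$ is horizontal and $c_k=0$ if vertical. Snakes: for $k\in\mathbb{Z}$ let $e_k$ be step $k$ of the path of $\lambda$. If $e_k$ is also a step of the path of $\mu$, $S_k=\emptyset$. Otherwise, if $e_k$ is horizontal it is the lower edge of $(i,j)\in\lambda/\mu$ and $S_k=(\lambda/\mu)\cap\{(i,j),(i,j-1),(i-1,j-1),(i-1,j-2),\dots\}$; if vertical it is the right edge of $(i,j)\in\lambda/\mu$ and $S_k=(\lambda/\mu)\cap\{(i,j),(i-1,j),(i-1,j-1),(i-2,j-1),\dots\}$. $\ell(S_k)=|S_k|-1$. $S_k$ is a left snake if $e_k$ horizontal and $\ell(S_k)\ge0$ even; a right snake if $e_k$ vertical and $\ell(S_k)\ge0$ even. An interval set is a set $\{(u_1,v_1),\dots,(u_r,v_r)\}$ of pairs of integers, the $2r$ integers distinct, $u_i<v_i$, each $S_{u_i}$ a left snake and each $S_{v_i}$ a right snake. Its crossing number $c(\mathcal{I})$ is the number of pairs $(i,j)$ with $u_i<u_j<v_i<v_j$. There is exactly one interval set with $c=0$; call it $\mathcal{P}=\{(u_1,v_1),\dots,(u_r,v_r)\}$ and set $z(\lambda/\mu)=\sum_{i=1}^r\#\{j: u_i<j<v_i,\ c_j=0\}$. *)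

theory Defs
  imports Complex_Main "HOL-Library.Multiset" "HOL-Library.FuncSet"
begin

section \<open>Formal power series in the variables \<open>x\<^sub>0, x\<^sub>1, x\<^sub>2, \<dots>\<close>\<close>

text \<open>
  A monomial is a multiset of variable indices; a power series is an arbitrary family of
  coefficients.  The ring of symmetric functions is a subring of this ring.
\<close>

typedef 'a mpser = "UNIV :: (nat multiset \<Rightarrow> 'a) set"
  morphisms mcoeff Abs_mpser
  by simp

lemma mcoeff_Abs [simp]: "mcoeff (Abs_mpser f) = f"
  by (simp add: Abs_mpser_inverse)

lemma mpser_eqI: "(\<And>M. mcoeff f M = mcoeff g M) \<Longrightarrow> f = g"
  by (metis ext mcoeff_inject)

lemma finite_subset_mset: "finite {A. A \<subseteq># M}"
proof (induction M)
  case empty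
  then show ?case by simp
next
  case (add x M)
  have "{A. A \<subseteq># add_mset x M} \<subseteq> {A. A \<subseteq># M} \<union> add_mset x ` {A. A \<subseteq># M}"
  proof
    fix A assume A: "A \<in> {A. A \<subseteq># add_mset x M}"
    show "A \<in> {A. A \<subseteq># M} \<union> add_mset x ` {A. A \<subseteq># M}"
    proof (cases "x \<in># A")
      case True
      then obtain B where "A = add_mset x B" by (meson mset_add)
      then show ?thesis using A by auto
    next
      case False
      have "count A y \<le> count M y" for y
        using A False mset_subset_eq_count[of A "add_mset x M" y]
        by (cases "y = x") (auto simp: not_in_iff)
      then show ?thesis by (simp add: subseteq_mset_def)
    qed
  qed
  then show ?case using add finite_subset by blast
qed

definition msplits :: "nat multiset \<Rightarrow> (nat multiset \<times> nat multiset) set" where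
  "msplits M = {(A, B). A + B = M}"

lemma finite_msplits [simp]: "finite (msplits M)"
proof (rule finite_subset)
  show "msplits M \<subseteq> {A. A \<subseteq># M} \<times> {A. A \<subseteq># M}" by (auto simp: msplits_def)
  show "finite ({A. A \<subseteq># M} \<times> {A. A \<subseteq># M})" using finite_subset_mset by blast
qed

instantiation mpser :: (comm_ring_1) comm_ring_1
begin

definition "0 = Abs_mpser (\<lambda>_. 0)"
definition "1 = Abs_mpser (\<lambda>M. if M = {#} then 1 else 0)"
definition "f + g = Abs_mpser (\<lambda>M. mcoeff f M + mcoeff g M)"
definition "- f = Abs_mpser (\<lambda>M. - mcoeff f M)"
definition "f - g = Abs_mpser (\<lambda>M. mcoeff f M - mcoeff g M)"
definition "f * g = Abs_mpser (\<lambda>M. \<Sum>(A, B)\<in>msplits M. mcoeff f A * mcoeff g B)"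

instance
proof
  fix f g h :: "'a mpser"
  show "f + g + h = f + (g + h)" "f + g = g + f" "0 + f = f" "- f + f = 0" "f - g = f + - g"
    by (simp_all add: plus_mpser_def zero_mpser_def uminus_mpser_def minus_mpser_def
        mcoeff_inverse algebra_simps)
  show "f * g = g * f"
  proof (rule mpser_eqI)
    fix M
    show "mcoeff (f * g) M = mcoeff (g * f) M"
      unfolding times_mpser_def mcoeff_Abs
      by (rule sum.reindex_bij_witness[of _ prod.swap prod.swap])
        (auto simp: msplits_def algebra_simps)
  qed
  show "(f + g) * h = f * h + g * h"
    by (rule mpser_eqI)
      (simp add: times_mpser_def plus_mpser_def distrib_right sum.distrib case_prod_beta)
  show "1 * f = f"
  proof (rule mpser_eqI)
    fix M
    have "mcoeff (1 * f) M = (\<Sum>p\<in>msplits M. if p = ({#}, M) then mcoeff f M else 0)"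
      unfolding times_mpser_def mcoeff_Abs one_mpser_def
      by (rule sum.cong) (auto simp: msplits_def split: if_splits)
    also have "\<dots> = mcoeff f M" by (simp add: sum.delta[OF finite_msplits]) (simp add: msplits_def)
    finally show "mcoeff (1 * f) M = mcoeff f M" .
  qed
  show "f * g * h = f * (g * h)"
  proof (rule mpser_eqI)
    fix M
    have "mcoeff (f * g * h) M =
        (\<Sum>p\<in>msplits M. \<Sum>q\<in>msplits (fst p). mcoeff f (fst q) * mcoeff g (snd q) * mcoeff h (snd p))"
      by (simp add: times_mpser_def case_prod_beta sum_distrib_right)
    also have "\<dots> = (\<Sum>(p, q)\<in>Sigma (msplits M) (\<lambda>p. msplits (fst p)).
        mcoeff f (fst q) * mcoeff g (snd q) * mcoeff h (snd p))"
      by (rule sum.Sigma) simp_all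
    also have "\<dots> = (\<Sum>(p, q)\<in>Sigma (msplits M) (\<lambda>p. msplits (snd p)).
        mcoeff f (fst p) * (mcoeff g (fst q) * mcoeff h (snd q)))"
      by (rule sum.reindex_bij_witness[of _
            "\<lambda>((A, R), (B, C)). ((A + B, C), (A, B))"
            "\<lambda>((L, C), (A, B)). ((A, B + C), (B, C))"])
        (auto simp: msplits_def ac_simps)
    also have "\<dots> =
        (\<Sum>p\<in>msplits M. \<Sum>q\<in>msplits (snd p). mcoeff f (fst p) * (mcoeff g (fst q) * mcoeff h (snd q)))"
      by (rule sum.Sigma[symmetric]) simp_all
    also have "\<dots> = mcoeff (f * (g * h)) M"
      by (simp add: times_mpser_def case_prod_beta sum_distrib_left)
    finally show "mcoeff (f * g * h) M = mcoeff (f * (g * h)) M" .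
  qed
  show "(0 :: 'a mpser) \<noteq> 1"
  proof
    assume "(0 :: 'a mpser) = 1"
    then have "mcoeff (0 :: 'a mpser) {#} = mcoeff 1 {#}" by simp
    then show False by (simp add: zero_mpser_def one_mpser_def)
  qed
qed

end

definition mconst :: "'a::comm_ring_1 \<Rightarrow> 'a mpser" where
  "mconst c = Abs_mpser (\<lambda>M. if M = {#} then c else 0)"

text \<open>The power sum \<open>p\<^sub>n = x\<^sub>0\<^sup>n + x\<^sub>1\<^sup>n + \<dots>\<close>, meaningful for \<open>n \<ge> 1\<close>.\<close>

definition power_sum :: "nat \<Rightarrow> rat mpser" where
  "power_sum n = Abs_mpser (\<lambda>M. if \<exists>i. M = replicate_mset n i then 1 else 0)"

definition power_sum_tilde :: "nat \<Rightarrow> rat mpser" where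
  "power_sum_tilde n = mconst (1 / of_nat n) * power_sum n"


section \<open>Partitions and skew diagrams\<close>

definition is_partition :: "nat list \<Rightarrow> bool" where
  "is_partition \<alpha> \<longleftrightarrow> sorted_wrt (\<ge>) \<alpha> \<and> 0 \<notin> set \<alpha>"

definition partitions_of :: "nat \<Rightarrow> nat list set" where
  "partitions_of n = {\<nu>. is_partition \<nu> \<and> sum_list \<nu> = n}"

text \<open>
  \<open>part \<alpha> i\<close> is \<open>\<alpha>\<^sub>i\<close> with \<open>i\<close> counted from 1, continued by 0.  Row and column indices are integers
  since squares, lattice points and steps are shifted freely in both directions.
\<close>

definition part :: "nat list \<Rightarrow> int \<Rightarrow> int" where
  "part \<alpha> i = (if 1 \<le> i \<and> i \<le> int (length \<alpha>) then int (\<alpha> ! nat (i - 1)) else 0)"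

definition part_subset :: "nat list \<Rightarrow> nat list \<Rightarrow> bool" where
  "part_subset \<mu> \<alpha> \<longleftrightarrow> (\<forall>i. part \<mu> i \<le> part \<alpha> i)"

type_synonym square = "int \<times> int"

definition skew :: "nat list \<Rightarrow> nat list \<Rightarrow> square set" where
  "skew \<alpha> \<mu> = {(i, j). 1 \<le> i \<and> part \<mu> i < j \<and> j \<le> part \<alpha> i}"


section \<open>Skew Schur functions and their power sum expansion\<close>

text \<open>
  Semistandard fillings, taken undefined outside the diagram so that each tableau is represented by
  exactly one function.  The entry \<open>a\<close> contributes the variable \<open>x\<^sub>a\<close>.
\<close>

definition ssyt :: "nat list \<Rightarrow> nat list \<Rightarrow> (square \<Rightarrow> nat) set" where
  "ssyt \<alpha> \<mu> = {T \<in> extensional (skew \<alpha> \<mu>).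
     (\<forall>i j. (i, j) \<in> skew \<alpha> \<mu> \<and> (i, j + 1) \<in> skew \<alpha> \<mu> \<longrightarrow> T (i, j) \<le> T (i, j + 1)) \<and>
     (\<forall>i j. (i, j) \<in> skew \<alpha> \<mu> \<and> (i + 1, j) \<in> skew \<alpha> \<mu> \<longrightarrow> T (i, j) < T (i + 1, j))}"

definition skew_schur :: "nat list \<Rightarrow> nat list \<Rightarrow> rat mpser" where
  "skew_schur \<alpha> \<mu> =
     Abs_mpser (\<lambda>M. of_nat (card {T \<in> ssyt \<alpha> \<mu>. image_mset T (mset_set (skew \<alpha> \<mu>)) = M}))"

definition power_sum_part :: "nat list \<Rightarrow> rat mpser" where
  "power_sum_part \<nu> = prod_list (map power_sum \<nu>)"

definition zee :: "nat list \<Rightarrow> nat" where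
  "zee \<nu> = (\<Prod>i\<in>set \<nu>. i ^ count_list \<nu> i * fact (count_list \<nu> i))"

text \<open>
  The skew character values, defined by the expansion
  \<open>s = \<Sum>\<^sub>\<nu> z\<^sub>\<nu>\<^sup>-\<^sup>1 \<chi>(\<nu>) p\<^sub>\<nu>\<close>.  The skew Schur function is homogeneous of degree \<open>|\<alpha>/\<mu>|\<close>, so only
  partitions of that number occur; \<open>\<chi>\<close> is set to 0 elsewhere to make it unique.
\<close>

definition skew_char :: "nat list \<Rightarrow> nat list \<Rightarrow> nat list \<Rightarrow> rat" where
  "skew_char \<alpha> \<mu> = (THE \<chi>.
     skew_schur \<alpha> \<mu> =
       (\<Sum>\<nu>\<in>partitions_of (card (skew \<alpha> \<mu>)). mconst (\<chi> \<nu> / of_nat (zee \<nu>)) * power_sum_part \<nu>) \<and>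
     (\<forall>\<nu>. \<nu> \<notin> partitions_of (card (skew \<alpha> \<mu>)) \<longrightarrow> \<chi> \<nu> = 0))"


section \<open>Rank\<close>

definition outside_top_corners :: "nat list \<Rightarrow> nat list \<Rightarrow> square set" where
  "outside_top_corners \<alpha> \<mu> = {(i, j). (i, j) \<in> skew \<alpha> \<mu> \<and>
     (i - 1, j) \<notin> skew \<alpha> \<mu> \<and> (i, j - 1) \<notin> skew \<alpha> \<mu>}"

definition inside_top_corners :: "nat list \<Rightarrow> nat list \<Rightarrow> square set" where
  "inside_top_corners \<alpha> \<mu> = {(i, j). (i, j) \<in> skew \<alpha> \<mu> \<and>
     (i - 1, j) \<in> skew \<alpha> \<mu> \<and> (i, j - 1) \<in> skew \<alpha> \<mu> \<and> (i - 1, j - 1) \<notin> skew \<alpha> \<mu>}"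

fun diagonal :: "nat list \<Rightarrow> nat list \<Rightarrow> square \<Rightarrow> square set" where
  "diagonal \<alpha> \<mu> (i, j) = {(i + p, j + p) | p. 0 \<le> p \<and> (i + p, j + p) \<in> skew \<alpha> \<mu>}"

definition skew_rank :: "nat list \<Rightarrow> nat list \<Rightarrow> int" where
  "skew_rank \<alpha> \<mu> =
     int (card (\<Union>s\<in>outside_top_corners \<alpha> \<mu>. diagonal \<alpha> \<mu> s)) -
     int (card (\<Union>s\<in>inside_top_corners \<alpha> \<mu>. diagonal \<alpha> \<mu> s))"

definition skew_schur_hat :: "nat list \<Rightarrow> nat list \<Rightarrow> nat \<Rightarrow> rat mpser" where
  "skew_schur_hat \<alpha> \<mu> r =
     (\<Sum>\<nu> | \<nu> \<in> partitions_of (card (skew \<alpha> \<mu>)) \<and> length \<nu> = r.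
        mconst (skew_char \<alpha> \<mu> \<nu> / of_nat (zee \<nu>)) * power_sum_part \<nu>)"


section \<open>Boundary paths and codes\<close>

text \<open>A step is given by its initial and its final lattice point \<open>(x, y)\<close>.\<close>

type_synonym step = "(int \<times> int) \<times> (int \<times> int)"

text \<open>The square \<open>(i, j)\<close> is drawn as \<open>[j - 1, j] \<times> [-i, -i + 1]\<close>.\<close>

fun lower_edge :: "square \<Rightarrow> step" where
  "lower_edge (i, j) = ((j - 1, - i), (j, - i))"

fun right_edge :: "square \<Rightarrow> step" where
  "right_edge (i, j) = ((j, - i), (j, - i + 1))"

definition conj_part :: "nat list \<Rightarrow> int \<Rightarrow> int" where
  "conj_part \<alpha> j = int (card {i. 1 \<le> i \<and> j \<le> part \<alpha> i})"

text \<open>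
  The boundary path runs along the right end of each row \<open>i \<ge> 1\<close> and along the lower end of each
  column \<open>j \<ge> 1\<close>; the empty rows give the ray on \<open>x = 0\<close> and the empty columns the ray on \<open>y = 0\<close>.
\<close>

definition boundary_path :: "nat list \<Rightarrow> step set" where
  "boundary_path \<alpha> =
     {right_edge (i, part \<alpha> i) | i. 1 \<le> i} \<union> {lower_edge (conj_part \<alpha> j, j) | j. 1 \<le> j}"

fun step_index :: "step \<Rightarrow> int" where
  "step_index ((x, y), _) = x + y"

fun horizontal :: "step \<Rightarrow> bool" where
  "horizontal ((x, y), (x', y')) \<longleftrightarrow> y = y'"

definition path_step :: "nat list \<Rightarrow> int \<Rightarrow> step" where
  "path_step \<alpha> k = (THE e. e \<in> boundary_path \<alpha> \<and> step_index e = k)"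

definition code :: "nat list \<Rightarrow> int \<Rightarrow> nat" where
  "code \<alpha> k = (if horizontal (path_step \<alpha> k) then 1 else 0)"


section \<open>Snakes and interval sets\<close>

definition snake :: "nat list \<Rightarrow> nat list \<Rightarrow> int \<Rightarrow> square set" where
  "snake \<alpha> \<mu> k =
     (if path_step \<alpha> k \<in> boundary_path \<mu> then {}
      else {s \<in> skew \<alpha> \<mu>. \<exists>i j p. 0 \<le> p \<and>
        (path_step \<alpha> k = lower_edge (i, j) \<and> (s = (i - p, j - p) \<or> s = (i - p, j - p - 1)) \<or>
         path_step \<alpha> k = right_edge (i, j) \<and> (s = (i - p, j - p) \<or> s = (i - p - 1, j - p)))})"

text \<open>The empty snake has length \<open>-1\<close>.\<close>

definition snake_length :: "nat list \<Rightarrow> nat list \<Rightarrow> int \<Rightarrow> int" where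
  "snake_length \<alpha> \<mu> k = int (card (snake \<alpha> \<mu> k)) - 1"

definition left_snake :: "nat list \<Rightarrow> nat list \<Rightarrow> int \<Rightarrow> bool" where
  "left_snake \<alpha> \<mu> k \<longleftrightarrow> horizontal (path_step \<alpha> k) \<and>
     0 \<le> snake_length \<alpha> \<mu> k \<and> even (snake_length \<alpha> \<mu> k)"

definition right_snake :: "nat list \<Rightarrow> nat list \<Rightarrow> int \<Rightarrow> bool" where
  "right_snake \<alpha> \<mu> k \<longleftrightarrow> \<not> horizontal (path_step \<alpha> k) \<and>
     0 \<le> snake_length \<alpha> \<mu> k \<and> even (snake_length \<alpha> \<mu> k)"

text \<open>
  An interval set has as many elements as the rank.  The \<open>2r\<close> endpoints are distinct iff no two pairs
  share a left endpoint, no two share a right endpoint, and no left endpoint is a right endpoint.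
\<close>

definition interval_sets :: "nat list \<Rightarrow> nat list \<Rightarrow> (int \<times> int) set set" where
  "interval_sets \<alpha> \<mu> = {I. finite I \<and> int (card I) = skew_rank \<alpha> \<mu> \<and>
     inj_on fst I \<and> inj_on snd I \<and> fst ` I \<inter> snd ` I = {} \<and>
     (\<forall>(u, v)\<in>I. u < v \<and> left_snake \<alpha> \<mu> u \<and> right_snake \<alpha> \<mu> v)}"

definition crossing_number :: "(int \<times> int) set \<Rightarrow> nat" where
  "crossing_number I =
     card {((u, v), (u', v')). (u, v) \<in> I \<and> (u', v') \<in> I \<and> u < u' \<and> u' < v \<and> v < v'}"

definition noncrossing_interval_set :: "nat list \<Rightarrow> nat list \<Rightarrow> (int \<times> int) set" where
  "noncrossing_interval_set \<alpha> \<mu> = (THE I. I \<in> interval_sets \<alpha> \<mu> \<and> crossing_number I = 0)"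

definition skew_z :: "nat list \<Rightarrow> nat list \<Rightarrow> nat" where
  "skew_z \<alpha> \<mu> =
     (\<Sum>(u, v)\<in>noncrossing_interval_set \<alpha> \<mu>. card {j. u < j \<and> j < v \<and> code \<alpha> j = 0})"


section \<open>Well-definedness\<close>

lemma finite_partitions_of: "finite (partitions_of n)"
proof (rule finite_subset)
  show "partitions_of n \<subseteq> {xs. set xs \<subseteq> {..n} \<and> length xs \<le> n}"
  proof
    fix \<nu> assume \<nu>: "\<nu> \<in> partitions_of n"
    have "length xs \<le> sum_list xs" if "0 \<notin> set xs" for xs :: "nat list"
      using that by (induction xs) auto
    then show "\<nu> \<in> {xs. set xs \<subseteq> {..n} \<and> length xs \<le> n}"
      using \<nu> member_le_sum_list by (auto simp: partitions_of_def is_partition_def)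
  qed
  show "finite {xs. set xs \<subseteq> {..n} \<and> length xs \<le> n}"
    by (rule finite_lists_length_le) simp
qed

lemma part_nonneg: "0 \<le> part \<alpha> i"
  by (simp add: part_def)

lemma finite_skew: "finite (skew \<alpha> \<mu>)"
proof (rule finite_subset)
  show "skew \<alpha> \<mu> \<subseteq> Sigma {1..int (length \<alpha>)} (\<lambda>i. {1..part \<alpha> i})"
  proof
    fix s assume "s \<in> skew \<alpha> \<mu>"
    then obtain i j where s: "s = (i, j)" "1 \<le> i" "part \<mu> i < j" "j \<le> part \<alpha> i"
      by (auto simp: skew_def)
    have "1 \<le> j" using s(3) part_nonneg[of \<mu> i] by linarith
    moreover have "i \<le> int (length \<alpha>)"
      using \<open>1 \<le> j\<close> s(4) by (auto simp: part_def split: if_splits)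
    ultimately show "s \<in> Sigma {1..int (length \<alpha>)} (\<lambda>i. {1..part \<alpha> i})" using s by auto
  qed
qed auto

lemma finite_ssyt_content:
  "finite {T \<in> ssyt \<alpha> \<mu>. image_mset T (mset_set (skew \<alpha> \<mu>)) = M}"
proof (rule finite_subset)
  show "{T \<in> ssyt \<alpha> \<mu>. image_mset T (mset_set (skew \<alpha> \<mu>)) = M} \<subseteq> skew \<alpha> \<mu> \<rightarrow>\<^sub>E set_mset M"
    by (auto simp: ssyt_def PiE_def finite_skew)
  show "finite (skew \<alpha> \<mu> \<rightarrow>\<^sub>E set_mset M)" by (intro finite_PiE finite_skew) auto
qed

lemma part_antimono:
  assumes "is_partition \<alpha>" "1 \<le> i" "i \<le> i'"
  shows "part \<alpha> i' \<le> part \<alpha> i"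
proof (cases "i' \<le> int (length \<alpha>) \<and> i \<noteq> i'")
  case True
  then have "nat (i - 1) < nat (i' - 1)" "nat (i' - 1) < length \<alpha>" using assms by linarith+
  then have "\<alpha> ! nat (i' - 1) \<le> \<alpha> ! nat (i - 1)"
    using assms(1) by (auto simp: is_partition_def sorted_wrt_iff_nth_less)
  then show ?thesis using True assms by (simp add: part_def)
next
  case False
  then show ?thesis by (auto simp: part_def)
qed

lemma conj_part_iff:
  assumes "is_partition \<alpha>" "1 \<le> i" "1 \<le> j"
  shows "i \<le> conj_part \<alpha> j \<longleftrightarrow> j \<le> part \<alpha> i"
proof -
  let ?S = "{i. 1 \<le> i \<and> j \<le> part \<alpha> i}"
  have fin: "finite ?S"
    by (rule finite_subset[of _ "{1..int (length \<alpha>)}"])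
      (use assms(3) in \<open>auto simp: part_def split: if_splits\<close>)
  show ?thesis
  proof
    assume *: "j \<le> part \<alpha> i"
    have "{1..i} \<subseteq> ?S" using part_antimono[OF assms(1)] * by fastforce
    then have "card {1..i} \<le> card ?S" using fin card_mono by blast
    then show "i \<le> conj_part \<alpha> j" by (simp add: conj_part_def)
  next
    assume *: "i \<le> conj_part \<alpha> j"
    show "j \<le> part \<alpha> i"
    proof (rule ccontr)
      assume n: "\<not> j \<le> part \<alpha> i"
      have "?S \<subseteq> {1..i - 1}"
      proof
        fix x assume x: "x \<in> ?S"
        have "\<not> i \<le> x" using part_antimono[OF assms(1,2), of x] x n by auto
        then show "x \<in> {1..i - 1}" using x by auto
      qed
      then have "card ?S \<le> card {1..i - 1}" using card_mono by blast
      then show False using * assms(2) by (simp add: conj_part_def)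
    qed
  qed
qed

lemma conj_part_nonneg: "0 \<le> conj_part \<alpha> j"
  by (simp add: conj_part_def)

lemma boundary_path_unique_step:
  assumes "is_partition \<alpha>"
  shows "\<exists>!e. e \<in> boundary_path \<alpha> \<and> step_index e = k"
proof -
  have "\<exists>e. e \<in> boundary_path \<alpha> \<and> step_index e = k"
  proof -
    define Q where "Q = (\<lambda>n. part \<alpha> (int n + 1) - (int n + 1) \<le> k)"
    have "part \<alpha> (int (length \<alpha> + nat \<bar>k\<bar>) + 1) = 0" by (auto simp: part_def)
    then have "Q (length \<alpha> + nat \<bar>k\<bar>)" unfolding Q_def by linarith
    then obtain n where n: "Q n" "\<And>m. m < n \<Longrightarrow> \<not> Q m" by (metis exists_least_iff)
    define i where "i = int n + 1"
    have i: "1 \<le> i" "part \<alpha> i - i \<le> k" using n(1) by (auto simp: i_def Q_def)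
    show ?thesis
    proof (cases "part \<alpha> i - i = k")
      case True
      then have "step_index (right_edge (i, part \<alpha> i)) = k" by simp
      then show ?thesis using i(1) unfolding boundary_path_def by blast
    next
      case False
      define j where "j = k + i"
      have j: "1 \<le> j" "part \<alpha> i < j" using False i part_nonneg[of \<alpha> i] by (auto simp: j_def)
      have lt: "conj_part \<alpha> j < i" using conj_part_iff[OF assms i(1) j(1)] j(2) by linarith
      have "i - 1 \<le> conj_part \<alpha> j"
      proof (cases "n = 0")
        case True
        then show ?thesis using conj_part_nonneg by (simp add: i_def)
      next
        case False
        then have "\<not> Q (n - 1)" using n(2) by simp
        then have "k < part \<alpha> (i - 1) - (i - 1)" using False by (simp add: Q_def i_def of_nat_diff)
        then have "j \<le> part \<alpha> (i - 1)" by (simp add: j_def)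
        moreover have "1 \<le> i - 1" using False by (simp add: i_def)
        ultimately show ?thesis using conj_part_iff[OF assms _ j(1)] by blast
      qed
      then have "step_index (lower_edge (conj_part \<alpha> j, j)) = k" using lt by (simp add: j_def)
      then show ?thesis using j(1) unfolding boundary_path_def by blast
    qed
  qed
  moreover have "e = e'"
    if e: "e \<in> boundary_path \<alpha>" "step_index e = k" and e': "e' \<in> boundary_path \<alpha>" "step_index e' = k"
    for e e'
  proof -
    have RR: "i = i'" if "1 \<le> i" "1 \<le> i'" "part \<alpha> i - i = part \<alpha> i' - i'" for i i'
      using part_antimono[OF assms that(1), of i'] part_antimono[OF assms that(2), of i] that(3)
      by linarith
    have anti: "conj_part \<alpha> j' \<le> conj_part \<alpha> j" if "1 \<le> j" "j \<le> j'" for j j'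
    proof (cases "1 \<le> conj_part \<alpha> j'")
      case True
      then have "j' \<le> part \<alpha> (conj_part \<alpha> j')" using conj_part_iff[OF assms True, of j'] that by simp
      then show ?thesis using conj_part_iff[OF assms True that(1)] that by simp
    next
      case False
      then show ?thesis using conj_part_nonneg[of \<alpha> j] by linarith
    qed
    have LL: "j = j'" if "1 \<le> j" "1 \<le> j'" "j - conj_part \<alpha> j = j' - conj_part \<alpha> j'" for j j'
      using anti[OF that(1), of j'] anti[OF that(2), of j] that(3) by linarith
    have RL: False if "1 \<le> i" "1 \<le> j" "part \<alpha> i - i = j - 1 - conj_part \<alpha> j" for i j
      using conj_part_iff[OF assms that(1,2)] that(3) by linarith
    have shape: "(\<exists>i. 1 \<le> i \<and> s = right_edge (i, part \<alpha> i) \<and> part \<alpha> i - i = k) \<or>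
        (\<exists>j. 1 \<le> j \<and> s = lower_edge (conj_part \<alpha> j, j) \<and> j - 1 - conj_part \<alpha> j = k)"
      if "s \<in> boundary_path \<alpha>" "step_index s = k" for s
      using that unfolding boundary_path_def by fastforce
    from shape[OF e] show ?thesis
    proof (elim disjE exE conjE)
      fix i assume i: "1 \<le> i" "e = right_edge (i, part \<alpha> i)" "part \<alpha> i - i = k"
      from shape[OF e'] show ?thesis
      proof (elim disjE exE conjE)
        fix i' assume i': "1 \<le> i'" "e' = right_edge (i', part \<alpha> i')" "part \<alpha> i' - i' = k"
        have "i = i'" by (rule RR) (use i i' in simp_all)
        then show ?thesis using i i' by simp
      next
        fix j assume "1 \<le> j" "j - 1 - conj_part \<alpha> j = k"
        then show ?thesis using RL[of i j] i by simp
      qed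
    next
      fix j assume j: "1 \<le> j" "e = lower_edge (conj_part \<alpha> j, j)" "j - 1 - conj_part \<alpha> j = k"
      from shape[OF e'] show ?thesis
      proof (elim disjE exE conjE)
        fix i assume "1 \<le> i" "part \<alpha> i - i = k"
        then show ?thesis using RL[of i j] j by simp
      next
        fix j' assume j': "1 \<le> j'" "e' = lower_edge (conj_part \<alpha> j', j')" "j' - 1 - conj_part \<alpha> j' = k"
        have "j = j'" by (rule LL) (use j j' in simp_all)
        then show ?thesis using j j' by simp
      qed
    qed
  qed
  ultimately show ?thesis by blast
qed

lemma path_step:
  assumes "is_partition \<alpha>"
  shows "path_step \<alpha> k \<in> boundary_path \<alpha>" "step_index (path_step \<alpha> k) = k"
  using theI'[OF boundary_path_unique_step[OF assms, of k]] by (simp_all add: path_step_def)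

lemma finite_interval_sets:
  assumes "is_partition \<alpha>"
  shows "finite (interval_sets \<alpha> \<mu>)"
proof -
  let ?K = "(\<lambda>(a, b). b - a) ` skew \<alpha> \<mu> \<union> (\<lambda>(a, b). b - a - 1) ` skew \<alpha> \<mu>"
  have K: "k \<in> ?K" if "0 \<le> snake_length \<alpha> \<mu> k" for k
  proof -
    have "snake \<alpha> \<mu> k \<noteq> {}" using that by (auto simp: snake_length_def)
    then obtain s where s: "s \<in> snake \<alpha> \<mu> k" by blast
    then have sk: "s \<in> skew \<alpha> \<mu>" by (simp add: snake_def split: if_splits)
    from s obtain i j p where
      "path_step \<alpha> k = lower_edge (i, j) \<and> (s = (i - p, j - p) \<or> s = (i - p, j - p - 1)) \<or>
       path_step \<alpha> k = right_edge (i, j) \<and> (s = (i - p, j - p) \<or> s = (i - p - 1, j - p))"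
      unfolding snake_def by (simp split: if_splits) blast
    then have "k = snd s - fst s \<or> k = snd s - fst s - 1"
      using path_step(2)[OF assms, of k] by (elim disjE conjE) simp_all
    then show ?thesis using sk by (auto simp: case_prod_beta)
  qed
  have "interval_sets \<alpha> \<mu> \<subseteq> Pow (?K \<times> ?K)"
  proof (intro subsetI PowI)
    fix I x assume I: "I \<in> interval_sets \<alpha> \<mu>" and x: "x \<in> I"
    obtain u v where uv: "x = (u, v)" by (cases x)
    have "left_snake \<alpha> \<mu> u" "right_snake \<alpha> \<mu> v"
      using I x unfolding interval_sets_def uv by auto
    then have "u \<in> ?K" "v \<in> ?K" using K[of u] K[of v] by (simp_all add: left_snake_def right_snake_def)
    then show "x \<in> ?K \<times> ?K" unfolding uv by (rule SigmaI)
  qed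
  moreover have "finite (Pow (?K \<times> ?K))" by (simp add: finite_skew)
  ultimately show ?thesis by (rule finite_subset)
qed

end

theory Submission
  imports Defs "HOL-Combinatorics.Permutations" "HOL-Computational_Algebra.Polynomial"
begin

text \<open>
  Encode \<open>\<lambda>\<close> and \<open>\<mu>\<close> by their bead sets \<open>A\<close> and \<open>B\<close>, the indices \<open>\<lambda>\<^sub>i - i\<close> and \<open>\<mu>\<^sub>i - i\<close> of
  the vertical steps.  By Jacobi--Trudi, \<open>s\<close> is the determinant of the \<open>h\<^sub>a\<^sub>-\<^sub>b\<close> with \<open>a \<in> A\<close>, \<open>b \<in> B\<close>.
  As a polynomial in the power sums, \<open>h\<^sub>0 = 1\<close> and \<open>h\<^sub>m\<close> has no constant term and linear part
  \<open>p\<^sub>m / m\<close>.  A bijection from \<open>A\<close> to \<open>B\<close> therefore contributes in degree at least the number of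
  beads it moves, which is at least \<open>|A - B| = rank\<close>, and it contributes in degree exactly the
  rank iff it fixes \<open>A \<inter> B\<close>; such bijections are the interval sets, the left snakes being at
  \<open>B - A\<close> and the right snakes at \<open>A - B\<close>.  The inversions of the bijection and the crossings of the
  interval set add up to the number of pairs of an interval and a bead of \<open>\<lambda>\<close> inside it.
  That number is the same for all interval sets, so it equals \<open>z\<close>.
\<close>


section \<open>A determinant over permutations of an integer interval\<close>

text \<open>Several obstacles shape the route. The statement uses \<open>skew_char\<close>, a
  definite description, so reading off the terms with \<open>r\<close> factors needs the linear
  independence of the products \<open>power_sum_part\<close>; and since the number of power sum
  factors is invisible in a power series, the determinant is lifted to polynomials in a marker
  variable. Jacobi-Trudi is obtained without lattice paths: in finitely many variables one variable
  can be split off, which on tableaux removes the squares with the largest entry and on determinants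
  is a subtraction of neighbouring rows; infinitely many variables are recovered by truncation. The
  sign of a permutation is kept as its number of inversions because the number itself, not only its
  parity, enters the identity with the crossings. Finally, \<open>skew_z\<close> refers to the
  noncrossing interval set, so that set must be shown to exist and to be unique: existence rests on
  a ballot condition that containment of the partitions imposes on the beads, uniqueness on the
  balance of left and right endpoints inside an interval.\<close>

definition inversions :: "int \<Rightarrow> (int \<Rightarrow> int) \<Rightarrow> (int \<times> int) set" where
  "inversions n p = {(i, j). 1 \<le> i \<and> i < j \<and> j \<le> n \<and> p j < p i}"

definition perm_det :: "int \<Rightarrow> (int \<Rightarrow> int \<Rightarrow> 'a::comm_ring_1) \<Rightarrow> 'a" where
  "perm_det n f = (\<Sum>p | p permutes {1..n}.
     (- 1) ^ card (inversions n p) * (\<Prod>i\<in>{1..n}. f i (p i)))"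

lemma finite_inversions [simp]: "finite (inversions n p)"
  by (rule finite_subset[of _ "{1..n} \<times> {1..n}"]) (auto simp: inversions_def)

text \<open>Swapping two neighbouring positions keeps the order of every other pair of positions. So
  the swap carries the inversions of \<open>p\<close> bijectively to those of the composed
  permutation apart from \<open>(i, i + 1)\<close>, which is the new one.\<close>

lemma card_inversions_adjacent:
  assumes p: "p permutes {1..n}" and i: "1 \<le> i" "i < n" and lt: "p i < p (i + 1)"
  shows "card (inversions n (p \<circ> transpose i (i + 1))) = Suc (card (inversions n p))"
proof -
  let ?t = "transpose i (i + 1)"
  let ?J = "inversions n (p \<circ> ?t)"
  have mem: "(i, i + 1) \<in> ?J" using i lt by (auto simp: inversions_def)
  have mono: "?t x < ?t y" if "x < y" "(x, y) \<noteq> (i, i + 1)" for x y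
    using that by (auto simp: transpose_def)
  have range: "1 \<le> ?t x \<longleftrightarrow> 1 \<le> x" "?t x \<le> n \<longleftrightarrow> x \<le> n" for x
    using i by (auto simp: transpose_def)
  have fwd: "(?t x, ?t y) \<in> ?J - {(i, i + 1)}" if xy: "(x, y) \<in> inversions n p" for x y
  proof -
    have xy': "1 \<le> x" "x < y" "y \<le> n" "p y < p x" using xy by (simp_all add: inversions_def)
    then have "(x, y) \<noteq> (i, i + 1)" using lt by force
    then have "?t x < ?t y" using mono xy' by blast
    moreover have "(?t x, ?t y) \<noteq> (i, i + 1)"
    proof
      assume "(?t x, ?t y) = (i, i + 1)"
      then have "x = i + 1" "y = i" by (auto simp: transpose_eq_iff)
      then show False using xy' by simp
    qed
    ultimately show ?thesis using xy' range by (simp add: inversions_def)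
  qed
  have bwd: "(?t x, ?t y) \<in> inversions n p" if "(x, y) \<in> ?J - {(i, i + 1)}" for x y
    using mono[of x y] range[of x] range[of y] that by (simp add: inversions_def)
  have "bij_betw (map_prod ?t ?t) (inversions n p) (?J - {(i, i + 1)})"
  proof (rule bij_betw_byWitness[where f' = "map_prod ?t ?t"])
    show "map_prod ?t ?t ` inversions n p \<subseteq> ?J - {(i, i + 1)}"
      using fwd by (intro image_subsetI) (simp add: split_paired_all)
    show "map_prod ?t ?t ` (?J - {(i, i + 1)}) \<subseteq> inversions n p"
      using bwd by (intro image_subsetI) (simp add: split_paired_all)
  qed (simp_all add: split_paired_all)
  then have "card (inversions n p) = card (?J - {(i, i + 1)})" by (rule bij_betw_same_card)
  then show ?thesis by (simp add: card.remove[OF finite_inversions mem])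
qed

text \<open>Composition with the swap pairs permutations of opposite sign and equal product. The
  condition \<open>p i < p (i + 1)\<close> selects one member of each pair, which avoids halving and
  works in every commutative ring.\<close>

lemma perm_det_adjacent_rows_eq:
  assumes i: "1 \<le> i" "i < n" and eq: "\<And>j. f i j = f (i + 1) j"
  shows "perm_det n f = 0"
proof -
  let ?t = "transpose i (i + 1)"
  let ?g = "\<lambda>p. (- 1) ^ card (inversions n p) * (\<Prod>k\<in>{1..n}. f k (p k))"
  let ?P = "{p. p permutes {1..n} \<and> p i < p (i + 1)}"
  let ?Q = "{p. p permutes {1..n} \<and> p (i + 1) < p i}"
  have t: "?t permutes {1..n}" using i by (intro permutes_swap_id) auto
  have fin: "finite {p. p permutes {1..n}}" by (simp add: finite_permutations)
  have split: "{p. p permutes {1..n}} = ?P \<union> ?Q"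
  proof -
    have "p i \<noteq> p (i + 1)" if "p permutes {1..n}" for p
      using permutes_inj[OF that] by (simp add: inj_eq)
    then show ?thesis by (auto simp: neq_iff)
  qed
  have "sum ?g ?Q = (\<Sum>p\<in>?P. ?g (p \<circ> ?t))"
    by (rule sum.reindex_bij_witness[of _ "\<lambda>p. p \<circ> ?t" "\<lambda>p. p \<circ> ?t"])
      (use permutes_compose[OF t] in \<open>simp_all add: comp_assoc\<close>)
  also have "\<dots> = (\<Sum>p\<in>?P. - ?g p)"
  proof (rule sum.cong[OF refl])
    fix p assume p: "p \<in> ?P"
    have "(\<Prod>k\<in>{1..n}. f k ((p \<circ> ?t) k)) = (\<Prod>k\<in>{1..n}. f (?t k) (p (?t k)))"
      by (rule prod.cong) (auto simp: transpose_def eq)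
    also have "\<dots> = (\<Prod>k\<in>{1..n}. f k (p k))"
      using prod.permute[OF t, of "\<lambda>k. f k (p k)"] by (simp add: comp_def)
    finally show "?g (p \<circ> ?t) = - ?g p" using card_inversions_adjacent[of p n i] p i by simp
  qed
  finally have "sum ?g ?Q = - sum ?g ?P" by (simp add: sum_negf)
  moreover have "perm_det n f = sum ?g ?P + sum ?g ?Q"
    unfolding perm_det_def split
    by (rule sum.union_disjoint) (use fin in \<open>auto intro: finite_subset[OF _ fin]\<close>)
  ultimately show ?thesis by simp
qed

lemma perm_det_cong:
  assumes "\<And>i j. i \<in> {1..n} \<Longrightarrow> j \<in> {1..n} \<Longrightarrow> f i j = g i j"
  shows "perm_det n f = perm_det n g"
proof -
  have "(\<Prod>i\<in>{1..n}. f i (p i)) = (\<Prod>i\<in>{1..n}. g i (p i))" if "p permutes {1..n}" for p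
    using assms permutes_in_image[OF that] by (intro prod.cong refl) blast
  then show ?thesis unfolding perm_det_def by (intro sum.cong refl) simp
qed

lemma perm_det_add_row:
  assumes "i \<in> {1..n}"
  shows "perm_det n (f(i := \<lambda>j. g j + c * h j)) = perm_det n (f(i := g)) + c * perm_det n (f(i := h))"
proof -
  have *: "(\<Prod>k\<in>{1..n}. (f(i := r)) k (p k)) = r (p i) * (\<Prod>k\<in>{1..n} - {i}. f k (p k))" for r p
    using assms by (subst prod.remove[of _ i]) (auto intro!: prod.cong)
  show ?thesis unfolding perm_det_def *
    by (simp add: algebra_simps sum.distrib sum_distrib_left)
qed

text \<open>Rows are changed from the top down: when row \<open>k\<close> is treated, row
  \<open>k + 1\<close> is still the original one, so the correction term is a determinant with two
  equal adjacent rows. In \<open>F k\<close> the rows above \<open>k\<close> are already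
  changed.\<close>

lemma perm_det_subtract_next_rows:
  "perm_det n (\<lambda>i j. if i < n then f i j - y i * f (i + 1) j else f i j) = perm_det n f"
proof -
  define F where "F = (\<lambda>k i j. if i < k \<and> i < n then f i j - y i * f (i + 1) j else f i j)"
  have step: "perm_det n (F (k + 1)) = perm_det n (F k)" if k: "1 \<le> k" for k
  proof (cases "k < n")
    case True
    have "F (k + 1) = (F k)(k := \<lambda>j. f k j + (- y k) * f (k + 1) j)"
      using True by (auto simp: F_def fun_eq_iff)
    then have "perm_det n (F (k + 1)) =
        perm_det n ((F k)(k := f k)) + (- y k) * perm_det n ((F k)(k := f (k + 1)))"
      unfolding \<open>F (k + 1) = _\<close> using perm_det_add_row[of k n "F k" "f k" "- y k" "f (k + 1)"] k True by simp
    moreover have "(F k)(k := f k) = F k" by (auto simp: F_def fun_eq_iff)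
    moreover have "perm_det n ((F k)(k := f (k + 1))) = 0"
      by (rule perm_det_adjacent_rows_eq[of k]) (use k True in \<open>auto simp: F_def\<close>)
    ultimately show ?thesis by simp
  next
    case False
    then have "F (k + 1) = F k" by (auto simp: F_def fun_eq_iff)
    then show ?thesis by simp
  qed
  have "perm_det n (F (int k + 1)) = perm_det n (F 1)" for k
  proof (induction k)
    case (Suc k)
    then show ?case using step[of "int k + 1"] by (simp add: add_ac)
  qed simp
  from this[of "nat n"] have "perm_det n (F (int (nat n) + 1)) = perm_det n (F 1)" .
  moreover have "perm_det n (F (int (nat n) + 1)) =
      perm_det n (\<lambda>i j. if i < n then f i j - y i * f (i + 1) j else f i j)"
    by (rule perm_det_cong) (auto simp: F_def)
  moreover have "perm_det n (F 1) = perm_det n f"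
    by (rule perm_det_cong) (auto simp: F_def)
  ultimately show ?thesis by simp
qed

lemma perm_det_sum_rows:
  assumes "\<And>i. i \<in> {1..n} \<Longrightarrow> finite (C i)"
  shows "perm_det n (\<lambda>i j. \<Sum>c\<in>C i. g i c j) =
    (\<Sum>c\<in>Pi\<^sub>E {1..n} C. perm_det n (\<lambda>i. g i (c i)))"
proof -
  have "(\<Prod>i\<in>{1..n}. \<Sum>c\<in>C i. g i c (p i)) = (\<Sum>c\<in>Pi\<^sub>E {1..n} C. \<Prod>i\<in>{1..n}. g i (c i) (p i))" for p
    using assms by (intro prod_sum_PiE) auto
  then show ?thesis unfolding perm_det_def
    by (simp add: sum_distrib_left) (rule sum.swap)
qed

lemma perm_det_scale_rows:
  "perm_det n (\<lambda>i j. x i * f i j) = (\<Prod>i\<in>{1..n}. x i) * perm_det n f"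
  unfolding perm_det_def by (simp add: prod.distrib sum_distrib_left mult_ac)

text \<open>Pigeonhole: a permutation avoiding the block would map the \<open>n - k + 1\<close> rows
  from \<open>k\<close> on injectively into the \<open>n - k\<close> columns beyond
  \<open>k\<close>.\<close>

lemma perm_det_zero_block:
  assumes k: "k \<in> {1..n}" and z: "\<And>i j. \<lbrakk>k \<le> i; i \<le> n; 1 \<le> j; j \<le> k\<rbrakk> \<Longrightarrow> f i j = 0"
  shows "perm_det n f = 0"
  unfolding perm_det_def
proof (rule sum.neutral, rule ballI)
  fix p assume "p \<in> {p. p permutes {1..n}}"
  then have p: "p permutes {1..n}" by simp
  have "\<exists>i\<in>{k..n}. p i \<le> k"
  proof (rule ccontr)
    assume "\<not> ?thesis"
    then have "p i \<in> {k + 1..n}" if "i \<in> {k..n}" for i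
      using permutes_in_image[OF p, of i] k that by force
    then have "p ` {k..n} \<subseteq> {k + 1..n}" by blast
    then have "card (p ` {k..n}) \<le> card {k + 1..n}" by (intro card_mono) auto
    moreover have "card (p ` {k..n}) = card {k..n}"
      by (intro card_image inj_on_subset[OF permutes_inj[OF p]]) auto
    ultimately show False using k by simp linarith
  qed
  then obtain i where i: "k \<le> i" "i \<le> n" "p i \<le> k" by auto
  have "1 \<le> p i" using permutes_in_image[OF p, of i] i k by auto
  then have "f i (p i) = 0" using z i by blast
  then have "(\<Prod>i\<in>{1..n}. f i (p i)) = 0" using i k by (intro prod_zero) auto
  then show "(- 1) ^ card (inversions n p) * (\<Prod>i\<in>{1..n}. f i (p i)) = 0" by simp
qed

text \<open>The differences \<open>i - p i\<close> are nonnegative and sum to 0.\<close>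

lemma permutes_le_imp_id:
  assumes p: "p permutes {1..n::int}" and le: "\<And>i. i \<in> {1..n} \<Longrightarrow> p i \<le> i"
  shows "p = id"
proof -
  have sum: "(\<Sum>i\<in>{1..n}. i - p i) = 0"
    using sum.permute[OF p, of "\<lambda>i. i"] by (simp add: sum_subtractf comp_def)
  have "p i = i" if "i \<in> {1..n}" for i
    using sum_nonneg_eq_0_iff[of "{1..n}" "\<lambda>i. i - p i"] sum le that by auto
  then show ?thesis using permutes_not_in[OF p] by (auto simp: fun_eq_iff)
qed


section \<open>Tableaux in finitely many variables\<close>

definition monomial :: "nat multiset \<Rightarrow> 'a::comm_ring_1 mpser" where
  "monomial A = Abs_mpser (\<lambda>M. if M = A then 1 else 0)"

definition var :: "nat \<Rightarrow> 'a::comm_ring_1 mpser" where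
  "var i = monomial {#i#}"

lemma mcoeff_zero [simp]: "mcoeff 0 M = 0"
  by (simp add: zero_mpser_def)

lemma mcoeff_add [simp]: "mcoeff (f + g) M = mcoeff f M + mcoeff g M"
  by (simp add: plus_mpser_def)

lemma mcoeff_diff [simp]: "mcoeff (f - g) M = mcoeff f M - mcoeff g M"
  by (simp add: minus_mpser_def)

lemma mcoeff_sum: "mcoeff (sum f S) M = (\<Sum>x\<in>S. mcoeff (f x) M)"
  by (induction S rule: infinite_finite_induct) simp_all

lemma mcoeff_times: "mcoeff (f * g) M = (\<Sum>(A, B)\<in>msplits M. mcoeff f A * mcoeff g B)"
  by (simp add: times_mpser_def)

lemma mcoeff_monomial_times:
  "mcoeff (monomial A * f) M = (if A \<subseteq># M then mcoeff f (M - A) else 0)"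
proof -
  have "mcoeff (monomial A * f) M =
      (\<Sum>p\<in>msplits M. if p = (A, M - A) then mcoeff f (M - A) else 0)"
    unfolding mcoeff_times
    by (rule sum.cong) (auto simp: msplits_def monomial_def split: if_splits)
  moreover have "(A, M - A) \<in> msplits M \<longleftrightarrow> A \<subseteq># M"
    unfolding msplits_def by (auto simp: subset_mset.add_diff_inverse intro: mset_subset_eq_add_left) (metis mset_subset_eq_add_left)
  ultimately show ?thesis by (simp add: sum.delta[OF finite_msplits])
qed

lemma monomial_mult: "monomial A * monomial B = monomial (A + B)"
proof (rule mpser_eqI)
  fix M
  have "A \<subseteq># M \<and> M - A = B \<longleftrightarrow> M = A + B" by (auto simp: subset_mset.le_iff_add)
  then show "mcoeff (monomial A * monomial B) M = mcoeff (monomial (A + B)) M"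
    by (auto simp: mcoeff_monomial_times) (auto simp: monomial_def)
qed

lemma monomial_empty: "monomial {#} = 1"
  by (simp add: monomial_def one_mpser_def)

lemma var_power: "var i ^ k = monomial (replicate_mset k i)"
  by (induction k) (simp_all add: var_def monomial_mult monomial_empty)

text \<open>The index is an integer so that determinant entries of negative index vanish by
  definition.\<close>

definition complete_sym :: "nat \<Rightarrow> int \<Rightarrow> rat mpser" where
  "complete_sym N m = Abs_mpser (\<lambda>M. if int (size M) = m \<and> set_mset M \<subseteq> {..<N} then 1 else 0)"

lemma complete_sym_Suc:
  "complete_sym (Suc N) m = complete_sym N m + var N * complete_sym (Suc N) (m - 1)"
proof (rule mpser_eqI)
  fix M
  show "mcoeff (complete_sym (Suc N) m) M =
      mcoeff (complete_sym N m + var N * complete_sym (Suc N) (m - 1)) M"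
  proof (cases "N \<in># M")
    case True
    then obtain K where "M = add_mset N K" by (meson mset_add)
    then show ?thesis
      by (auto simp: complete_sym_def var_def mcoeff_monomial_times)
  next
    case False
    then show ?thesis
      by (auto simp: complete_sym_def var_def mcoeff_monomial_times lessThan_Suc)
  qed
qed

lemma complete_sym_neg: "m < 0 \<Longrightarrow> complete_sym N m = 0"
  by (rule mpser_eqI) (simp add: complete_sym_def)

lemma complete_sym_zero_vars: "complete_sym 0 m = (if m = 0 then 1 else 0)"
  by (rule mpser_eqI) (auto simp: complete_sym_def one_mpser_def)

text \<open>This is \<open>complete_sym_Suc\<close> unrolled \<open>m - d\<close> times. The right
  side is what a row subtraction leaves in the determinant, the left side a sum over the possible
  new row ends \<open>c\<close>.\<close>

lemma complete_sym_telescope: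
  assumes "d \<le> m"
  shows "(\<Sum>c\<in>{d<..m}. var N ^ nat (m - c) * complete_sym N (c - e)) =
    complete_sym (Suc N) (m - e) - var N ^ nat (m - d) * complete_sym (Suc N) (d - e)"
  using assms
proof (induction m rule: int_ge_induct)
  case (step m)
  have "{d<..m + 1} = insert (m + 1) {d<..m}" using step by auto
  then have "(\<Sum>c\<in>{d<..m + 1}. var N ^ nat (m + 1 - c) * complete_sym N (c - e)) =
      complete_sym N (m + 1 - e) +
      (\<Sum>c\<in>{d<..m}. var N ^ nat (m + 1 - c) * complete_sym N (c - e))" by simp
  also have "(\<Sum>c\<in>{d<..m}. var N ^ nat (m + 1 - c) * complete_sym N (c - e)) =
      var N * (\<Sum>c\<in>{d<..m}. var N ^ nat (m - c) * complete_sym N (c - e))"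
    unfolding sum_distrib_left
  proof (rule sum.cong[OF refl])
    fix c assume "c \<in> {d<..m}"
    then have "nat (m + 1 - c) = Suc (nat (m - c))" by auto
    then show "var N ^ nat (m + 1 - c) * complete_sym N (c - e) =
        var N * (var N ^ nat (m - c) * complete_sym N (c - e))" by (simp add: mult_ac)
  qed
  also have "\<dots> = var N * (complete_sym (Suc N) (m - e) -
      var N ^ nat (m - d) * complete_sym (Suc N) (d - e))" using step by simp
  also have "complete_sym N (m + 1 - e) + \<dots> = complete_sym (Suc N) (m + 1 - e) -
      var N ^ Suc (nat (m - d)) * complete_sym (Suc N) (d - e)"
    using complete_sym_Suc[of N "m + 1 - e"] by (simp add: algebra_simps)
  also have "Suc (nat (m - d)) = nat (m + 1 - d)" using step by auto
  finally show ?case .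
qed simp

text \<open>
  A row is recorded by the contents \<open>b i < a i\<close> of the squares just before its first and at its last
  one, so that partitions become strictly decreasing sequences.
\<close>

definition bead_diagram :: "int \<Rightarrow> (int \<Rightarrow> int) \<Rightarrow> (int \<Rightarrow> int) \<Rightarrow> square set" where
  "bead_diagram n a b = {(i, j). 1 \<le> i \<and> i \<le> n \<and> b i < j - i \<and> j - i \<le> a i}"

definition tableaux :: "nat \<Rightarrow> int \<Rightarrow> (int \<Rightarrow> int) \<Rightarrow> (int \<Rightarrow> int) \<Rightarrow> (square \<Rightarrow> nat) set" where
  "tableaux N n a b = {T \<in> extensional (bead_diagram n a b).
     (\<forall>s\<in>bead_diagram n a b. T s < N) \<and>
     (\<forall>i j. (i, j) \<in> bead_diagram n a b \<and> (i, j + 1) \<in> bead_diagram n a b \<longrightarrow>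
        T (i, j) \<le> T (i, j + 1)) \<and>
     (\<forall>i j. (i, j) \<in> bead_diagram n a b \<and> (i + 1, j) \<in> bead_diagram n a b \<longrightarrow>
        T (i, j) < T (i + 1, j))}"

definition tableau_weight :: "int \<Rightarrow> (int \<Rightarrow> int) \<Rightarrow> (int \<Rightarrow> int) \<Rightarrow> (square \<Rightarrow> nat) \<Rightarrow> rat mpser" where
  "tableau_weight n a b T = monomial (image_mset T (mset_set (bead_diagram n a b)))"

definition schur_poly :: "nat \<Rightarrow> int \<Rightarrow> (int \<Rightarrow> int) \<Rightarrow> (int \<Rightarrow> int) \<Rightarrow> rat mpser" where
  "schur_poly N n a b = (\<Sum>T\<in>tableaux N n a b. tableau_weight n a b T)"

lemma bead_diagram_eq_image:
  "bead_diagram n a b = (\<lambda>(i, c). (i, c + i)) ` Sigma {1..n} (\<lambda>i. {b i<..a i})"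
proof -
  have "(i, j) \<in> (\<lambda>(i, c). (i, c + i)) ` Sigma {1..n} (\<lambda>i. {b i<..a i})"
    if "(i, j) \<in> bead_diagram n a b" for i j
    by (rule image_eqI[of _ _ "(i, j - i)"]) (use that in \<open>auto simp: bead_diagram_def\<close>)
  then show ?thesis by (auto simp: bead_diagram_def)
qed

lemma finite_bead_diagram [simp]: "finite (bead_diagram n a b)"
  by (simp add: bead_diagram_eq_image)

lemma card_bead_diagram:
  assumes "\<And>i. i \<in> {1..n} \<Longrightarrow> b i \<le> a i"
  shows "int (card (bead_diagram n a b)) = (\<Sum>i\<in>{1..n}. a i - b i)"
proof -
  have "card (bead_diagram n a b) = card (Sigma {1..n} (\<lambda>i. {b i<..a i}))"
    unfolding bead_diagram_eq_image by (rule card_image) (auto simp: inj_on_def)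
  then show ?thesis using assms by (simp add: nat_diff_distrib int_nat_eq)
qed

lemma finite_tableaux [simp]: "finite (tableaux N n a b)"
proof (rule finite_subset)
  show "tableaux N n a b \<subseteq> bead_diagram n a b \<rightarrow>\<^sub>E {..<N}"
    by (auto simp: tableaux_def PiE_def)
  show "finite (bead_diagram n a b \<rightarrow>\<^sub>E {..<N})" by (intro finite_PiE) auto
qed

section \<open>Removal of the largest entry: the branching rule\<close>

lemma tableau_row_mono:
  assumes T: "T \<in> tableaux N n a b" and le: "c \<le> c'"
    and s: "(i, c + i) \<in> bead_diagram n a b" "(i, c' + i) \<in> bead_diagram n a b"
  shows "T (i, c + i) \<le> T (i, c' + i)"
  using le s(2)
proof (induction c' rule: int_ge_induct)
  case (step d)
  then have d: "(i, d + i) \<in> bead_diagram n a b" using s(1) by (auto simp: bead_diagram_def)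
  moreover have "(i, d + i + 1) \<in> bead_diagram n a b" using step.prems by (simp add: add_ac)
  ultimately have "T (i, d + i) \<le> T (i, d + i + 1)"
    using T unfolding tableaux_def by blast
  then show ?case using step.IH[OF d] by (simp add: add_ac)
qed simp

text \<open>\<open>c i\<close> is the end of row \<open>i\<close> after the squares with the largest
  entry are removed. Column strictness makes these squares a horizontal strip: what remains of a row
  is at least as long as the original next row, which for beads becomes the strict inequality
  \<open>a (i + 1) < c i\<close>.\<close>

definition interlacing :: "int \<Rightarrow> (int \<Rightarrow> int) \<Rightarrow> (int \<Rightarrow> int) \<Rightarrow> (int \<Rightarrow> int) set" where
  "interlacing n a b = {c \<in> extensional {1..n}.
     \<forall>i\<in>{1..n}. b i \<le> c i \<and> c i \<le> a i \<and> (i < n \<longrightarrow> a (i + 1) < c i)}"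

text \<open>Inserting \<open>b i\<close> gives the maximum a value for a row without entries below
  \<open>N\<close>: such a row is cut back to its start.\<close>

definition tableau_cut :: "nat \<Rightarrow> int \<Rightarrow> (int \<Rightarrow> int) \<Rightarrow> (int \<Rightarrow> int) \<Rightarrow> (square \<Rightarrow> nat) \<Rightarrow> int \<Rightarrow> int" where
  "tableau_cut N n a b T = (\<lambda>i\<in>{1..n}. Max (insert (b i) {c \<in> {b i<..a i}. T (i, c + i) < N}))"

text \<open>Rows increase weakly, so the entries below \<open>N\<close> form an initial segment of
  the row.\<close>

lemma cut_less_iff:
  assumes T: "T \<in> tableaux N' n a b" and i: "i \<in> {1..n}" and c: "c \<in> {b i<..a i}"
  shows "T (i, c + i) < N \<longleftrightarrow> c \<le> tableau_cut N n a b T i"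
proof -
  let ?S = "insert (b i) {c \<in> {b i<..a i}. T (i, c + i) < N}"
  have fin: "finite ?S" by (rule finite_subset[of _ "insert (b i) {b i<..a i}"]) auto
  have cut: "tableau_cut N n a b T i = Max ?S" using i by (simp add: tableau_cut_def)
  show ?thesis
  proof
    assume "T (i, c + i) < N"
    then show "c \<le> tableau_cut N n a b T i" unfolding cut using c by (intro Max_ge fin) simp
  next
    assume le: "c \<le> tableau_cut N n a b T i"
    have "Max ?S \<in> ?S" by (intro Max_in fin) simp
    then have *: "tableau_cut N n a b T i \<in> {b i<..a i}" "T (i, tableau_cut N n a b T i + i) < N"
      using le c unfolding cut by auto
    have "T (i, c + i) \<le> T (i, tableau_cut N n a b T i + i)"
      by (rule tableau_row_mono[OF T le]) (use i c * in \<open>auto simp: bead_diagram_def\<close>)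
    then show "T (i, c + i) < N" using * by simp
  qed
qed

lemma cut_bounds:
  assumes i: "i \<in> {1..n}" and le: "b i \<le> a i"
  shows "b i \<le> tableau_cut N n a b T i" "tableau_cut N n a b T i \<le> a i"
proof -
  let ?S = "insert (b i) {c \<in> {b i<..a i}. T (i, c + i) < N}"
  have fin: "finite ?S" by (rule finite_subset[of _ "insert (b i) {b i<..a i}"]) auto
  have cut: "tableau_cut N n a b T i = Max ?S" using i by (simp add: tableau_cut_def)
  show "b i \<le> tableau_cut N n a b T i" unfolding cut by (intro Max_ge fin) simp
  have "Max ?S \<in> ?S" by (intro Max_in fin) simp
  then show "tableau_cut N n a b T i \<le> a i" unfolding cut using le by auto
qed

lemma cut_interlacing:
  assumes T: "T \<in> tableaux (Suc N) n a b"
    and le: "\<And>i. i \<in> {1..n} \<Longrightarrow> b i \<le> a i"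
    and a: "\<And>i. \<lbrakk>1 \<le> i; i < n\<rbrakk> \<Longrightarrow> a (i + 1) < a i"
    and b: "\<And>i. \<lbrakk>1 \<le> i; i < n\<rbrakk> \<Longrightarrow> b (i + 1) < b i"
  shows "tableau_cut N n a b T \<in> interlacing n a b"
proof -
  have "a (i + 1) < tableau_cut N n a b T i" if i: "1 \<le> i" "i < n" for i
  proof (cases "a (i + 1) < b i")
    case True
    then show ?thesis using cut_bounds(1)[of i n b a N T] le[of i] i by simp
  next
    case False
    \<comment> \<open>The square of content \<open>?c\<close> in row \<open>i\<close> lies directly
      above the last square of row \<open>i + 1\<close>, so column strictness leaves it an entry
      below \<open>N\<close>.\<close>
    let ?c = "a (i + 1) + 1"
    have c: "?c \<in> {b i<..a i}" using False a[OF i] by auto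
    have "(i, ?c + i) \<in> bead_diagram n a b" "(i + 1, ?c + i) \<in> bead_diagram n a b"
      using c i False b[OF i] by (auto simp: bead_diagram_def)
    then have "T (i, ?c + i) < T (i + 1, ?c + i)" "T (i + 1, ?c + i) < Suc N"
      using T by (auto simp: tableaux_def)
    then have "T (i, ?c + i) < N" by simp
    then show ?thesis using cut_less_iff[OF T _ c, of N] i by simp
  qed
  then show ?thesis using cut_bounds le by (auto simp: interlacing_def tableau_cut_def)
qed

text \<open>A tableau with entries up to \<open>N\<close> amounts to an interlacing \<open>c\<close>
  and a tableau of the cut shape with entries below \<open>N\<close>: \<open>tableau_cut\<close>
  with restriction goes one way, \<open>ext\<close>, which fills the strip with \<open>N\<close>,
  the other. The strip contributes the power of \<open>var N\<close>.\<close>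

lemma schur_poly_branch:
  assumes le: "\<And>i. i \<in> {1..n} \<Longrightarrow> b i \<le> a i"
    and a: "\<And>i. \<lbrakk>1 \<le> i; i < n\<rbrakk> \<Longrightarrow> a (i + 1) < a i"
    and b: "\<And>i. \<lbrakk>1 \<le> i; i < n\<rbrakk> \<Longrightarrow> b (i + 1) < b i"
  shows "schur_poly (Suc N) n a b =
    (\<Sum>c\<in>interlacing n a b. var N ^ nat (\<Sum>i\<in>{1..n}. a i - c i) * schur_poly N n c b)"
proof -
  let ?D = "bead_diagram n"
  define ext where "ext = (\<lambda>c T s. if s \<in> ?D c b then T s else if s \<in> ?D a b then N else undefined :: nat)"
  have sub: "?D c b \<subseteq> ?D a b" if "c \<in> interlacing n a b" for c
  proof
    fix s assume "s \<in> ?D c b"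
    moreover obtain i j where "s = (i, j)" by (cases s)
    ultimately show "s \<in> ?D a b"
      using that by (force simp: bead_diagram_def interlacing_def dest!: bspec[of _ _ i])
  qed
  have ext_tab: "ext c T \<in> tableaux (Suc N) n a b"
    if c: "c \<in> interlacing n a b" and T: "T \<in> tableaux N n c b" for c T
  proof -
    have T': "\<And>s. s \<in> ?D c b \<Longrightarrow> T s < N"
      "\<And>i j. \<lbrakk>(i, j) \<in> ?D c b; (i, j + 1) \<in> ?D c b\<rbrakk> \<Longrightarrow> T (i, j) \<le> T (i, j + 1)"
      "\<And>i j. \<lbrakk>(i, j) \<in> ?D c b; (i + 1, j) \<in> ?D c b\<rbrakk> \<Longrightarrow> T (i, j) < T (i + 1, j)"
      using T by (auto simp: tableaux_def)
    have "ext c T (i, j) \<le> ext c T (i, j + 1)"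
      if ij: "(i, j) \<in> ?D a b" "(i, j + 1) \<in> ?D a b" for i j
    proof (cases "(i, j + 1) \<in> ?D c b")
      case True
      then have "(i, j) \<in> ?D c b" using ij by (auto simp: bead_diagram_def)
      then show ?thesis using True T'(2) by (simp add: ext_def)
    next
      case False
      then show ?thesis using ij T'(1)[of "(i, j)"] by (auto simp: ext_def)
    qed
    moreover have "ext c T (i, j) < ext c T (i + 1, j)"
      if ij: "(i, j) \<in> ?D a b" "(i + 1, j) \<in> ?D a b" for i j
    proof -
      have i: "1 \<le> i" "i < n" and j: "j - (i + 1) \<le> a (i + 1)" "b i < j - i"
        using ij by (auto simp: bead_diagram_def)
      have "a (i + 1) < c i" using c i by (simp add: interlacing_def)
      then have "(i, j) \<in> ?D c b" using i j by (simp add: bead_diagram_def)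
      then show ?thesis using ij T'(1)[of "(i, j)"] T'(3)[of i j] by (simp add: ext_def)
    qed
    moreover have "ext c T s < Suc N" if "s \<in> ?D a b" for s
      using that T'(1)[of s] by (simp add: ext_def less_Suc_eq)
    moreover have "ext c T \<in> extensional (?D a b)"
      using sub[OF c] by (auto simp: ext_def extensional_def)
    ultimately show ?thesis by (simp add: tableaux_def)
  qed
  have cut_ext: "tableau_cut N n a b (ext c T) = c"
    if c: "c \<in> interlacing n a b" and T: "T \<in> tableaux N n c b" for c T
  proof
    fix i
    show "tableau_cut N n a b (ext c T) i = c i"
    proof (cases "i \<in> {1..n}")
      case True
      have ci: "b i \<le> c i" "c i \<le> a i" using c True by (auto simp: interlacing_def)
      \<comment> \<open>Both \<open>c i\<close> and the cut lie between \<open>b i\<close> and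
        \<open>a i\<close>. If they bound the same \<open>d\<close> in \<open>{b i<..a i}\<close>,
        then testing \<open>d\<close> at the two values themselves forces equality.\<close>
      have iff: "d \<le> c i \<longleftrightarrow> d \<le> tableau_cut N n a b (ext c T) i" if d: "d \<in> {b i<..a i}" for d
      proof -
        have "ext c T (i, d + i) < N \<longleftrightarrow> d \<le> c i"
          using d True T by (auto simp: ext_def bead_diagram_def tableaux_def)
        then show ?thesis using cut_less_iff[OF ext_tab[OF c T] True d] by simp
      qed
      show ?thesis
        using ci cut_bounds[of i n b a N "ext c T", OF True] le[OF True]
          iff[of "c i"] iff[of "tableau_cut N n a b (ext c T) i"] by force
    next
      case False
      then show ?thesis using c extensional_arb[of c "{1..n}" i] by (auto simp: tableau_cut_def interlacing_def)
    qed
  qed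
  have cut_mem: "s \<in> ?D (tableau_cut N n a b T) b \<longleftrightarrow> T s < N"
    if T: "T \<in> tableaux (Suc N) n a b" and s: "s \<in> ?D a b" for T s
  proof -
    obtain i j where ij: "s = (i, j)" by (cases s)
    have "T (i, (j - i) + i) < N \<longleftrightarrow> j - i \<le> tableau_cut N n a b T i"
      by (rule cut_less_iff[OF T]) (use s ij in \<open>auto simp: bead_diagram_def\<close>)
    then show ?thesis using s ij by (simp add: bead_diagram_def)
  qed
  have restrict_tab: "restrict T (?D (tableau_cut N n a b T) b) \<in> tableaux N n (tableau_cut N n a b T) b"
    if T: "T \<in> tableaux (Suc N) n a b" for T
  proof -
    have "?D (tableau_cut N n a b T) b \<subseteq> ?D a b" by (rule sub[OF cut_interlacing[OF T le a b]])
    moreover have "T s < N" if "s \<in> ?D (tableau_cut N n a b T) b" for s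
      using cut_mem[OF T] that calculation by blast
    ultimately show ?thesis using T unfolding tableaux_def by (auto simp: subset_iff)
  qed
  have ext_restrict: "ext (tableau_cut N n a b T) (restrict T (?D (tableau_cut N n a b T) b)) = T"
    if T: "T \<in> tableaux (Suc N) n a b" for T
  proof
    fix s
    show "ext (tableau_cut N n a b T) (restrict T (?D (tableau_cut N n a b T) b)) s = T s"
    proof (cases "s \<in> ?D a b")
      case True
      then have "T s < Suc N" using T by (simp add: tableaux_def)
      then show ?thesis using True cut_mem[OF T True] by (auto simp: ext_def)
    next
      case False
      then have "T s = undefined" using T extensional_arb[of T "?D a b" s] by (simp add: tableaux_def)
      then show ?thesis using False sub[OF cut_interlacing[OF T le a b]] by (auto simp: ext_def)
    qed
  qed
  have weight: "tableau_weight n a b (ext c T) =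
      var N ^ nat (\<Sum>i\<in>{1..n}. a i - c i) * tableau_weight n c b T"
    if c: "c \<in> interlacing n a b" for c T
  proof -
    have ci: "b i \<le> c i" "c i \<le> a i" if "1 \<le> i" "i \<le> n" for i
      using c that by (auto simp: interlacing_def)
    have "(i, j) \<in> ?D a b \<longleftrightarrow> (i, j) \<in> ?D c b \<or> (i, j) \<in> ?D a c" for i j
      unfolding bead_diagram_def using ci[of i] by auto
    then have split: "?D a b = ?D c b \<union> ?D a c" "?D c b \<inter> ?D a c = {}"
      by (auto simp: bead_diagram_def)
    have "image_mset (ext c T) (mset_set (?D a b)) =
        image_mset (ext c T) (mset_set (?D c b)) + image_mset (ext c T) (mset_set (?D a c))"
      unfolding split(1) by (subst mset_set_Union) (use split(2) in auto)
    also have "image_mset (ext c T) (mset_set (?D c b)) = image_mset T (mset_set (?D c b))"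
      by (rule image_mset_cong) (simp add: ext_def)
    also have "image_mset (ext c T) (mset_set (?D a c)) = image_mset (\<lambda>_. N) (mset_set (?D a c))"
      by (rule image_mset_cong) (use split in \<open>auto simp: ext_def\<close>)
    also have "\<dots> = replicate_mset (card (?D a c)) N" by (simp add: image_mset_const_eq)
    also have "card (?D a c) = nat (\<Sum>i\<in>{1..n}. a i - c i)"
      using card_bead_diagram[of n c a] c by (auto simp: interlacing_def)
    finally show ?thesis
      by (simp add: tableau_weight_def var_power monomial_mult add.commute)
  qed
  have fin: "finite (interlacing n a b)"
  proof (rule finite_subset)
    show "interlacing n a b \<subseteq> PiE {1..n} (\<lambda>i. {b i..a i})"
      by (auto simp: interlacing_def PiE_def)
  qed (intro finite_PiE; simp)
  have "schur_poly (Suc N) n a b =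
      (\<Sum>(c, T)\<in>Sigma (interlacing n a b) (\<lambda>c. tableaux N n c b).
        var N ^ nat (\<Sum>i\<in>{1..n}. a i - c i) * tableau_weight n c b T)"
    unfolding schur_poly_def
  proof (rule sum.reindex_bij_witness[of _ "\<lambda>(c, T). ext c T"
        "\<lambda>T. (tableau_cut N n a b T, restrict T (?D (tableau_cut N n a b T) b))"])
    fix s assume s: "s \<in> Sigma (interlacing n a b) (\<lambda>c. tableaux N n c b)"
    then obtain c T where cT: "s = (c, T)" "c \<in> interlacing n a b" "T \<in> tableaux N n c b" by auto
    show "(case s of (c, T) \<Rightarrow> ext c T) \<in> tableaux (Suc N) n a b" using cT ext_tab by simp
    have "restrict (ext c T) (?D c b) = T"
    proof
      fix x
      show "restrict (ext c T) (?D c b) x = T x"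
        using cT(3) extensional_arb[of T "?D c b" x]
        by (cases "x \<in> ?D c b") (auto simp: ext_def tableaux_def)
    qed
    then show "(tableau_cut N n a b (case s of (c, T) \<Rightarrow> ext c T),
        restrict (case s of (c, T) \<Rightarrow> ext c T) (?D (tableau_cut N n a b (case s of (c, T) \<Rightarrow> ext c T)) b)) = s"
      using cT cut_ext by simp
  next
    fix T assume T: "T \<in> tableaux (Suc N) n a b"
    show "(tableau_cut N n a b T, restrict T (?D (tableau_cut N n a b T) b)) \<in>
        Sigma (interlacing n a b) (\<lambda>c. tableaux N n c b)"
      using cut_interlacing[OF T le a b] restrict_tab[OF T] by simp
    show "(case (tableau_cut N n a b T, restrict T (?D (tableau_cut N n a b T) b)) of (c, T) \<Rightarrow> ext c T) = T"
      using ext_restrict[OF T] by simp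
    show "(case (tableau_cut N n a b T, restrict T (?D (tableau_cut N n a b T) b)) of (c, T) \<Rightarrow>
        var N ^ nat (\<Sum>i\<in>{1..n}. a i - c i) * tableau_weight n c b T) = tableau_weight n a b T"
      using weight[OF cut_interlacing[OF T le a b],
          of "restrict T (?D (tableau_cut N n a b T) b)"] ext_restrict[OF T] by simp
  qed
  also have "\<dots> = (\<Sum>c\<in>interlacing n a b. \<Sum>T\<in>tableaux N n c b.
        var N ^ nat (\<Sum>i\<in>{1..n}. a i - c i) * tableau_weight n c b T)"
    using fin by (simp add: sum.Sigma)
  finally show ?thesis by (simp add: schur_poly_def sum_distrib_left)
qed

section \<open>Jacobi-Trudi by induction on the number of variables\<close>

lemma strict_dec_le:
  fixes a :: "int \<Rightarrow> int"
  assumes a: "\<And>i. \<lbrakk>1 \<le> i; i < n\<rbrakk> \<Longrightarrow> a (i + 1) < a i" and "1 \<le> i" "i \<le> j" "j \<le> n"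
  shows "a j \<le> a i - (j - i)"
  using assms(3,4)
proof (induction j rule: int_ge_induct)
  case (step j)
  then show ?case using a[of j] \<open>1 \<le> i\<close> by simp
qed simp

lemma inversions_id [simp]: "inversions n id = {}"
  by (auto simp: inversions_def)

text \<open>Without variables both sides tell whether \<open>a\<close> and \<open>b\<close> agree on
  all rows. In the induction step, subtracting from each row a multiple of the next one turns the
  entries into sums over the new row ends \<open>c i\<close>; expanding by multilinearity gives the
  branching rule, up to sequences violating \<open>b i \<le> c i\<close>, whose determinants
  vanish.\<close>

theorem jacobi_trudi_finite:
  assumes "\<And>i. i \<in> {1..n} \<Longrightarrow> b i \<le> a i"
    and "\<And>i. \<lbrakk>1 \<le> i; i < n\<rbrakk> \<Longrightarrow> a (i + 1) < a i"
    and b: "\<And>i. \<lbrakk>1 \<le> i; i < n\<rbrakk> \<Longrightarrow> b (i + 1) < b i"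
  shows "schur_poly N n a b = perm_det n (\<lambda>i j. complete_sym N (a i - b j))"
  using assms(1,2)
proof (induction N arbitrary: a)
  case 0
  note le = 0(1) and a = 0(2)
  show ?case
  proof (cases "\<forall>i\<in>{1..n}. a i = b i")
    case True
    have D: "bead_diagram n a b = {}" using True by (auto simp: bead_diagram_def)
    then have "tableaux 0 n a b = {\<lambda>_. undefined}" by (auto simp: tableaux_def)
    then have "schur_poly 0 n a b = 1"
      by (simp add: schur_poly_def tableau_weight_def D monomial_empty)
    moreover have "perm_det n (\<lambda>i j. complete_sym 0 (a i - b j)) =
        (\<Sum>p | p permutes {1..n}. if p = id then 1 else 0)"
      unfolding perm_det_def
    proof (rule sum.cong[OF refl])
      fix p assume "p \<in> {p. p permutes {1..n}}"
      then have p: "p permutes {1..n}" by simp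
      show "(- 1) ^ card (inversions n p) * (\<Prod>i\<in>{1..n}. complete_sym 0 (a i - b (p i))) =
          (if p = id then 1 else 0)"
      proof (cases "p = id")
        case True
        then show ?thesis using \<open>\<forall>i\<in>{1..n}. a i = b i\<close>
          by (simp add: inversions_id complete_sym_zero_vars)
      next
        case False
        then obtain i where i: "i \<in> {1..n}" "i < p i"
          using permutes_le_imp_id[OF p] by force
        have "p i \<le> n" using permutes_in_image[OF p, of i] i by auto
        then have "b (p i) < b i" using strict_dec_le[of n b i "p i", OF b] i by auto
        then have "complete_sym 0 (a i - b (p i)) = 0"
          using True i \<open>\<forall>i\<in>{1..n}. a i = b i\<close> by (simp add: complete_sym_zero_vars)
        then have "(\<Prod>i\<in>{1..n}. complete_sym 0 (a i - b (p i))) = 0"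
          using i by (intro prod_zero) auto
        then show ?thesis using False by simp
      qed
    qed
    moreover have "\<dots> = 1"
      by (subst sum.delta) (auto simp: finite_permutations permutes_id)
    ultimately show ?thesis by simp
  next
    case False
    then obtain i where i: "i \<in> {1..n}" "b i < a i" using le by force
    then have "(i, a i + i) \<in> bead_diagram n a b" by (simp add: bead_diagram_def)
    then have "tableaux 0 n a b = {}" by (auto simp: tableaux_def)
    then have "schur_poly 0 n a b = 0" by (simp add: schur_poly_def)
    moreover have "perm_det n (\<lambda>i j. complete_sym 0 (a i - b j)) = 0"
      unfolding perm_det_def
    proof (rule sum.neutral, rule ballI)
      fix p assume "p \<in> {p. p permutes {1..n}}"
      then have p: "p permutes {1..n}" by simp
      have "\<exists>k\<in>{1..n}. a k \<noteq> b (p k)"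
      proof (rule ccontr)
        assume "\<not> ?thesis"
        then have eq: "\<And>k. k \<in> {1..n} \<Longrightarrow> a k = b (p k)" by blast
        \<comment> \<open>If every entry chosen by \<open>p\<close> were 1, then
          \<open>b k \<le> a k = b (p k)\<close>; as \<open>b\<close> decreases strictly,
          \<open>p\<close> never moves an index up, so it is the identity, against
          \<open>b i < a i\<close>.\<close>
        have "p k \<le> k" if k: "k \<in> {1..n}" for k
        proof (rule ccontr)
          assume "\<not> p k \<le> k"
          moreover have "p k \<le> n" using permutes_in_image[OF p, of k] k by auto
          ultimately have "b (p k) < b k" using strict_dec_le[of n b k "p k", OF b] k by auto
          then show False using eq[OF k] le[OF k] by simp
        qed
        then have "p = id" by (rule permutes_le_imp_id[OF p])
        then show False using eq[OF i(1)] i(2) by simp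
      qed
      then obtain k where k: "k \<in> {1..n}" "complete_sym 0 (a k - b (p k)) = 0"
        by (auto simp: complete_sym_zero_vars)
      then have "(\<Prod>i\<in>{1..n}. complete_sym 0 (a i - b (p i))) = 0"
        by (intro prod_zero) auto
      then show "(- 1) ^ card (inversions n p) * (\<Prod>i\<in>{1..n}. complete_sym 0 (a i - b (p i))) = 0"
        by simp
    qed
    ultimately show ?thesis by simp
  qed
next
  case (Suc N)
  note le = Suc.prems(1) and a = Suc.prems(2)
  \<comment> \<open>The last row has no successor. The value \<open>b n - 1\<close> imitates one: it
    encodes \<open>b n \<le> c n\<close>, and \<open>complete_sym (Suc N) (b n - 1 - b j)\<close> is
    0 for every column \<open>j\<close>.\<close>
  define d where "d = (\<lambda>i. if i < n then a (i + 1) else b n - 1)"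
  have d_le: "d i \<le> a i" if "i \<in> {1..n}" for i
    using that a[of i] le[of i] by (auto simp: d_def)
  define C where "C = Pi\<^sub>E {1..n} (\<lambda>i. {d i<..a i})"
  have fin: "finite C" unfolding C_def by (intro finite_PiE) auto
  have "d i < c i" if "c \<in> interlacing n a b" "i \<in> {1..n}" for c i
  proof (cases "i < n")
    case False
    then have "i = n" using that by simp
    moreover have "b i \<le> c i" using that by (simp add: interlacing_def)
    ultimately show ?thesis by (simp add: d_def)
  qed (use that in \<open>auto simp: interlacing_def d_def\<close>)
  then have "interlacing n a b \<subseteq> C"
    unfolding C_def PiE_def Pi_def by (auto simp: interlacing_def)
  moreover have "c \<in> interlacing n a b \<longleftrightarrow> (\<forall>i\<in>{1..n}. b i \<le> c i)" if "c \<in> C" for c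
    using that by (auto simp: interlacing_def C_def d_def PiE_def Pi_def)
  ultimately have IC: "interlacing n a b = {c \<in> C. \<forall>i\<in>{1..n}. b i \<le> c i}" by blast
  have dec: "c (i + 1) < c i" if "c \<in> C" "1 \<le> i" "i < n" for c i
  proof -
    have "c (i + 1) \<le> a (i + 1)" "a (i + 1) < c i"
      using that by (auto simp: C_def d_def PiE_iff Ball_def)
    then show ?thesis by simp
  qed
  \<comment> \<open>\<open>C\<close> imposes all interlacing conditions except
    \<open>b i \<le> c i\<close>. If this fails at row \<open>k\<close>, the indices
    \<open>c i - b j\<close> with \<open>j \<le> k \<le> i\<close> are all negative, which is a zero
    block.\<close>
  have zero: "perm_det n (\<lambda>i j. complete_sym N (c i - b j)) = 0"
    if c: "c \<in> C" "k \<in> {1..n}" "c k < b k" for c k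
  proof (rule perm_det_zero_block[OF c(2)])
    fix i j assume ij: "k \<le> i" "i \<le> n" "1 \<le> j" "j \<le> k"
    have "c i \<le> c k" using strict_dec_le[of n c k i] dec[OF c(1)] ij c(2) by force
    moreover have "b k \<le> b j" using strict_dec_le[of n b j k, OF b] ij c(2) by force
    ultimately show "complete_sym N (c i - b j) = 0" using c(3) by (intro complete_sym_neg) simp
  qed
  have "perm_det n (\<lambda>i j. complete_sym (Suc N) (a i - b j)) =
      perm_det n (\<lambda>i j. if i < n then complete_sym (Suc N) (a i - b j) -
        var N ^ nat (a i - a (i + 1)) * complete_sym (Suc N) (a (i + 1) - b j)
        else complete_sym (Suc N) (a i - b j))"
    using perm_det_subtract_next_rows[of n "\<lambda>i j. complete_sym (Suc N) (a i - b j)"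
        "\<lambda>i. var N ^ nat (a i - a (i + 1))"] by simp
  also have "\<dots> = perm_det n (\<lambda>i j. \<Sum>c\<in>{d i<..a i}.
      var N ^ nat (a i - c) * complete_sym N (c - b j))"
  proof (rule perm_det_cong)
    fix i j assume ij: "i \<in> {1..n}" "j \<in> {1..n}"
    have "complete_sym (Suc N) (b n - 1 - b j) = 0"
      using strict_dec_le[of n b j n, OF b] ij by (intro complete_sym_neg) force
    then show "(if i < n then complete_sym (Suc N) (a i - b j) -
        var N ^ nat (a i - a (i + 1)) * complete_sym (Suc N) (a (i + 1) - b j)
        else complete_sym (Suc N) (a i - b j)) =
        (\<Sum>c\<in>{d i<..a i}. var N ^ nat (a i - c) * complete_sym N (c - b j))"
      using complete_sym_telescope[OF d_le[OF ij(1)], of N "b j"] ij by (auto simp: d_def)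
  qed
  also have "\<dots> = (\<Sum>c\<in>C. perm_det n (\<lambda>i j. var N ^ nat (a i - c i) * complete_sym N (c i - b j)))"
    unfolding C_def by (rule perm_det_sum_rows) simp
  also have "\<dots> = (\<Sum>c\<in>C. var N ^ nat (\<Sum>i\<in>{1..n}. a i - c i) *
      perm_det n (\<lambda>i j. complete_sym N (c i - b j)))"
  proof (rule sum.cong[OF refl])
    fix c assume c: "c \<in> C"
    have "(\<Sum>i\<in>{1..n}. nat (a i - c i)) = nat (\<Sum>i\<in>{1..n}. a i - c i)"
    proof -
      have "(\<Sum>i\<in>{1..n}. int (nat (a i - c i))) = (\<Sum>i\<in>{1..n}. a i - c i)"
        using c by (intro sum.cong refl) (auto simp: C_def PiE_iff)
      then show ?thesis by (metis nat_int of_nat_sum)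
    qed
    then show "perm_det n (\<lambda>i j. var N ^ nat (a i - c i) * complete_sym N (c i - b j)) =
        var N ^ nat (\<Sum>i\<in>{1..n}. a i - c i) * perm_det n (\<lambda>i j. complete_sym N (c i - b j))"
      by (simp add: perm_det_scale_rows power_sum[symmetric])
  qed
  also have "\<dots> = (\<Sum>c\<in>interlacing n a b. var N ^ nat (\<Sum>i\<in>{1..n}. a i - c i) *
      perm_det n (\<lambda>i j. complete_sym N (c i - b j)))"
  proof (rule sum.mono_neutral_right[OF fin])
    show "\<forall>c\<in>C - interlacing n a b. var N ^ nat (\<Sum>i\<in>{1..n}. a i - c i) *
        perm_det n (\<lambda>i j. complete_sym N (c i - b j)) = 0"
    proof
      fix c assume "c \<in> C - interlacing n a b"
      then obtain k where "c \<in> C" "k \<in> {1..n}" "c k < b k" by (auto simp: IC not_le)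
      then show "var N ^ nat (\<Sum>i\<in>{1..n}. a i - c i) *
          perm_det n (\<lambda>i j. complete_sym N (c i - b j)) = 0" using zero by simp
    qed
  qed (auto simp: IC)
  also have "\<dots> = (\<Sum>c\<in>interlacing n a b. var N ^ nat (\<Sum>i\<in>{1..n}. a i - c i) * schur_poly N n c b)"
    using Suc.IH dec by (intro sum.cong refl) (simp add: IC)
  also have "\<dots> = schur_poly (Suc N) n a b"
    by (rule schur_poly_branch[symmetric]) (use le a b in auto)
  finally show ?case by simp
qed


section \<open>The Jacobi--Trudi identity in infinitely many variables\<close>

text \<open>Substitution of 0 for the variables from \<open>N\<close> on; it is a ring homomorphism
  and so passes through \<open>perm_det\<close>.\<close>

definition truncate :: "nat \<Rightarrow> 'a::comm_ring_1 mpser \<Rightarrow> 'a mpser" where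
  "truncate N f = Abs_mpser (\<lambda>M. if set_mset M \<subseteq> {..<N} then mcoeff f M else 0)"

lemma mcoeff_truncate:
  "mcoeff (truncate N f) M = (if set_mset M \<subseteq> {..<N} then mcoeff f M else 0)"
  by (simp add: truncate_def)

lemma truncate_add: "truncate N (f + g) = truncate N f + truncate N g"
  by (rule mpser_eqI) (simp add: mcoeff_truncate)

lemma truncate_zero: "truncate N 0 = 0"
  by (rule mpser_eqI) (simp add: mcoeff_truncate)

lemma truncate_sum: "truncate N (sum f S) = (\<Sum>x\<in>S. truncate N (f x))"
  by (induction S rule: infinite_finite_induct) (simp_all add: truncate_zero truncate_add)

lemma mcoeff_uminus [simp]: "mcoeff (- f) M = - mcoeff f M"
  by (simp add: uminus_mpser_def)

lemma truncate_uminus: "truncate N (- f) = - truncate N f"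
  by (rule mpser_eqI) (simp add: mcoeff_truncate)

lemma truncate_one: "truncate N 1 = 1"
  by (rule mpser_eqI) (simp add: mcoeff_truncate one_mpser_def)

lemma truncate_mult: "truncate N (f * g) = truncate N f * truncate N g"
proof (rule mpser_eqI)
  fix M
  show "mcoeff (truncate N (f * g)) M = mcoeff (truncate N f * truncate N g) M"
  proof (cases "set_mset M \<subseteq> {..<N}")
    case True
    then show ?thesis unfolding mcoeff_times mcoeff_truncate
      by (auto simp: msplits_def intro!: sum.cong)
  next
    case False
    have "(\<Sum>(A, B)\<in>msplits M. mcoeff (truncate N f) A * mcoeff (truncate N g) B) = 0"
      by (rule sum.neutral) (use False in \<open>auto simp: msplits_def mcoeff_truncate\<close>)
    then show ?thesis using False by (simp add: mcoeff_times mcoeff_truncate)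
  qed
qed

lemma truncate_prod: "truncate N (prod f S) = (\<Prod>x\<in>S. truncate N (f x))"
  by (induction S rule: infinite_finite_induct) (simp_all add: truncate_one truncate_mult)

lemma truncate_minus_one_power: "truncate N ((- 1) ^ k * f) = (- 1) ^ k * truncate N f"
  by (induction k) (simp_all add: truncate_uminus mult.assoc)

lemma truncate_perm_det:
  "truncate N (perm_det n f) = perm_det n (\<lambda>i j. truncate N (f i j))"
  by (simp add: perm_det_def truncate_sum truncate_minus_one_power truncate_prod)

lemma mpser_eq_truncateI:
  assumes "\<And>N. truncate N f = truncate N g"
  shows "f = g"
proof (rule mpser_eqI)
  fix M
  \<comment> \<open>Each member of \<open>M\<close> is at most the sum of all members, so all
    variables of the monomial lie below this \<open>N\<close>.\<close>
  define N where "N = Suc (\<Sum>\<^sub># M)"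
  have "i < N" if "i \<in># M" for i
    using that unfolding N_def by (induction M) auto
  then have "set_mset M \<subseteq> {..<N}" by auto
  then show "mcoeff f M = mcoeff g M"
    using arg_cong[OF assms[of N], of "\<lambda>h. mcoeff h M"] by (simp add: mcoeff_truncate)
qed

definition hsym :: "int \<Rightarrow> rat mpser" where
  "hsym m = Abs_mpser (\<lambda>M. if int (size M) = m then 1 else 0)"

lemma truncate_hsym: "truncate N (hsym m) = complete_sym N m"
  by (rule mpser_eqI) (simp add: mcoeff_truncate hsym_def complete_sym_def)

lemma hsym_neg: "m < 0 \<Longrightarrow> hsym m = 0"
  by (rule mpser_eqI) (simp add: hsym_def)

lemma hsym_0: "hsym 0 = 1"
  by (rule mpser_eqI) (simp add: hsym_def one_mpser_def)

definition bead :: "nat list \<Rightarrow> int \<Rightarrow> int" where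
  "bead \<alpha> i = part \<alpha> i - i"

lemma bead_less:
  assumes "is_partition \<alpha>" "1 \<le> i" "i < j"
  shows "bead \<alpha> j < bead \<alpha> i"
  using part_antimono[OF assms(1,2), of j] assms(3) by (simp add: bead_def)

lemma bead_le:
  assumes "part_subset \<mu> \<alpha>"
  shows "bead \<mu> i \<le> bead \<alpha> i"
  using assms by (simp add: bead_def part_subset_def)

lemma skew_eq_bead_diagram:
  "skew \<alpha> \<mu> = bead_diagram (int (length \<alpha>)) (bead \<alpha>) (bead \<mu>)"
proof -
  have "i \<le> int (length \<alpha>)" if "part \<mu> i < j" "j \<le> part \<alpha> i" for i j
    using that part_nonneg[of \<mu> i] by (auto simp: part_def[of \<alpha>] split: if_splits)
  then show ?thesis by (auto simp: skew_def bead_diagram_def bead_def)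
qed

text \<open>Truncation discards exactly the tableaux that use an entry from \<open>N\<close>
  on.\<close>

lemma truncate_skew_schur:
  "truncate N (skew_schur \<alpha> \<mu>) = schur_poly N (int (length \<alpha>)) (bead \<alpha>) (bead \<mu>)"
proof (rule mpser_eqI)
  fix M
  let ?D = "bead_diagram (int (length \<alpha>)) (bead \<alpha>) (bead \<mu>)"
  let ?tab = "tableaux N (int (length \<alpha>)) (bead \<alpha>) (bead \<mu>)"
  have "mcoeff (schur_poly N (int (length \<alpha>)) (bead \<alpha>) (bead \<mu>)) M =
      (\<Sum>T\<in>?tab. if image_mset T (mset_set ?D) = M then 1 else 0)"
    unfolding schur_poly_def tableau_weight_def mcoeff_sum monomial_def
    by (intro sum.cong) auto
  also have "\<dots> = of_nat (card {T \<in> ?tab. image_mset T (mset_set ?D) = M})"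
    by (simp add: sum.If_cases Int_def)
  finally have *: "mcoeff (schur_poly N (int (length \<alpha>)) (bead \<alpha>) (bead \<mu>)) M =
      of_nat (card {T \<in> ?tab. image_mset T (mset_set ?D) = M})" .
  have tab: "T \<in> ?tab \<longleftrightarrow> T \<in> ssyt \<alpha> \<mu> \<and> (\<forall>s\<in>?D. T s < N)" for T
    unfolding tableaux_def ssyt_def skew_eq_bead_diagram mem_Collect_eq by (simp only: conj_ac)
  have set: "set_mset M = T ` ?D" if "image_mset T (mset_set ?D) = M" for T
    using that by auto
  show "mcoeff (truncate N (skew_schur \<alpha> \<mu>)) M =
      mcoeff (schur_poly N (int (length \<alpha>)) (bead \<alpha>) (bead \<mu>)) M"
  proof (cases "set_mset M \<subseteq> {..<N}")
    case True
    have "{T \<in> ?tab. image_mset T (mset_set ?D) = M} =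
        {T \<in> ssyt \<alpha> \<mu>. image_mset T (mset_set ?D) = M}"
      using True set unfolding tab by blast
    then show ?thesis using True
      by (simp add: * mcoeff_truncate skew_schur_def skew_eq_bead_diagram)
  next
    case False
    have "{T \<in> ?tab. image_mset T (mset_set ?D) = M} = {}"
    proof (rule equals0I)
      fix T assume "T \<in> {T \<in> ?tab. image_mset T (mset_set ?D) = M}"
      then have "image_mset T (mset_set ?D) = M" "\<forall>s\<in>?D. T s < N" unfolding tab by blast+
      then show False using set[of T] False by (auto simp: subset_iff)
    qed
    then show ?thesis using False by (simp only: * mcoeff_truncate) simp
  qed
qed

theorem skew_schur_jacobi_trudi:
  assumes "is_partition \<alpha>" "is_partition \<mu>" "part_subset \<mu> \<alpha>"
  shows "skew_schur \<alpha> \<mu> = perm_det (int (length \<alpha>)) (\<lambda>i j. hsym (bead \<alpha> i - bead \<mu> j))"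
proof (rule mpser_eq_truncateI)
  fix N
  show "truncate N (skew_schur \<alpha> \<mu>) =
      truncate N (perm_det (int (length \<alpha>)) (\<lambda>i j. hsym (bead \<alpha> i - bead \<mu> j)))"
    unfolding truncate_skew_schur truncate_perm_det truncate_hsym
    by (rule jacobi_trudi_finite)
      (use bead_le[OF assms(3)] bead_less[OF assms(1)] bead_less[OF assms(2)] in auto)
qed


section \<open>Expansion in power sums\<close>

lemma mcoeff_mconst_times [simp]: "mcoeff (mconst c * f) M = c * mcoeff f M"
proof -
  have "mcoeff (mconst c * f) M = (\<Sum>p\<in>msplits M. if p = ({#}, M) then c * mcoeff f M else 0)"
    unfolding mcoeff_times mconst_def mcoeff_Abs
    by (rule sum.cong) (auto simp: msplits_def split: if_splits)
  also have "\<dots> = c * mcoeff f M" by (simp add: sum.delta[OF finite_msplits]) (simp add: msplits_def)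
  finally show ?thesis .
qed

lemma mconst_add: "mconst (x + y) = mconst x + mconst y"
  by (rule mpser_eqI) (simp add: mconst_def)

lemma mconst_mult: "mconst (x * y) = mconst x * mconst y"
  by (rule mpser_eqI) (simp, simp add: mconst_def)

lemma mconst_0 [simp]: "mconst 0 = 0"
  by (rule mpser_eqI) (simp add: mconst_def)

lemma mconst_1 [simp]: "mconst 1 = 1"
  by (simp add: mconst_def one_mpser_def)

lemma mconst_minus_1: "mconst (- 1) = - 1"
  by (rule mpser_eqI) (simp add: mconst_def one_mpser_def)

lemma mconst_of_nat: "mconst (of_nat k) = of_nat k"
  by (induction k) (simp_all add: mconst_add)

text \<open>The coefficient collects the ways of splitting a \<open>k\<close>-th power of one
  variable off \<open>M\<close>; by \<open>1 \<le> k\<close>, different variables give different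
  splittings.\<close>

lemma mcoeff_power_sum_times:
  assumes "1 \<le> k"
  shows "mcoeff (power_sum k * f) M =
    (\<Sum>i\<in>set_mset M. if k \<le> count M i then mcoeff f (M - replicate_mset k i) else 0)"
proof -
  let ?S = "{i \<in> set_mset M. k \<le> count M i}"
  let ?g = "\<lambda>i. (replicate_mset k i, M - replicate_mset k i)"
  have inj: "inj_on ?g ?S"
    using assms by (auto simp: inj_on_def replicate_mset_eq_iff)
  have sub: "?g ` ?S \<subseteq> msplits M"
    by (auto simp: msplits_def count_le_replicate_mset_subset_eq subset_mset.add_diff_inverse)
  have "mcoeff (power_sum k * f) M = (\<Sum>(A, B)\<in>?g ` ?S. mcoeff (power_sum k) A * mcoeff f B)"
    unfolding mcoeff_times
  proof (rule sum.mono_neutral_right[OF finite_msplits sub], rule ballI)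
    fix p assume p: "p \<in> msplits M - ?g ` ?S"
    obtain A B where AB: "p = (A, B)" by (cases p)
    have "A \<noteq> replicate_mset k i" for i
    proof
      assume A: "A = replicate_mset k i"
      then have M: "M = replicate_mset k i + B" using p AB by (simp add: msplits_def)
      then have "i \<in> ?S" using assms by auto
      moreover have "p = ?g i" using AB A M by simp
      ultimately show False using p by blast
    qed
    then show "(case p of (A, B) \<Rightarrow> mcoeff (power_sum k) A * mcoeff f B) = 0"
      using AB by (simp add: power_sum_def)
  qed
  also have "\<dots> = (\<Sum>i\<in>?S. mcoeff f (M - replicate_mset k i))"
    by (subst sum.reindex[OF inj]) (auto simp: power_sum_def intro!: sum.cong)
  finally show ?thesis by (simp add: sum.inter_filter)
qed

text \<open>For \<open>M\<close> of size \<open>m\<close>, the coefficient on the right counts pairs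
  of a variable \<open>i\<close> and an exponent \<open>k\<close> with
  \<open>1 \<le> k \<le> count M i\<close>; there are \<open>size M\<close> of them.\<close>

theorem newton_identity:
  "of_nat m * hsym (int m) = (\<Sum>k\<in>{1..m}. power_sum k * hsym (int (m - k)))"
proof (rule mpser_eqI)
  fix M
  have "mcoeff (\<Sum>k\<in>{1..m}. power_sum k * hsym (int (m - k))) M =
      (\<Sum>k\<in>{1..m}. \<Sum>i\<in>set_mset M. if k \<le> count M i \<and> size M = m then 1 else 0)"
    unfolding mcoeff_sum
  proof (rule sum.cong[OF refl])
    fix k assume k: "k \<in> {1..m}"
    have "mcoeff (hsym (int (m - k))) (M - replicate_mset k i) = (if size M = m then 1 else 0)"
      if "k \<le> count M i" for i
    proof -
      have "replicate_mset k i \<subseteq># M" using that by (simp add: count_le_replicate_mset_subset_eq)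
      then have "size (M - replicate_mset k i) = size M - k" "k \<le> size M"
        using size_mset_mono[of "replicate_mset k i" M] by (auto simp: size_Diff_submset)
      then show ?thesis using k by (auto simp: hsym_def)
    qed
    then show "mcoeff (power_sum k * hsym (int (m - k))) M =
        (\<Sum>i\<in>set_mset M. if k \<le> count M i \<and> size M = m then 1 else 0)"
      using k by (subst mcoeff_power_sum_times) (auto intro!: sum.cong)
  qed
  also have "\<dots> = (\<Sum>i\<in>set_mset M. \<Sum>k\<in>{1..m}. if k \<le> count M i \<and> size M = m then 1 else 0)"
    by (rule sum.swap)
  also have "\<dots> = (if size M = m then of_nat m else 0)"
  proof (cases "size M = m")
    case True
    have "(\<Sum>k\<in>{1..m}. if k \<le> count M i \<and> size M = m then 1 else 0) = (of_nat (count M i) :: rat)" for i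
    proof -
      have "{1..m} \<inter> {k. k \<le> count M i} = {1..count M i}"
        using count_le_size[of M i] True by auto
      then show ?thesis using True by (simp add: sum.If_cases)
    qed
    then show ?thesis using True by (simp add: size_multiset_overloaded_eq flip: of_nat_sum)
  qed auto
  finally show "mcoeff (of_nat m * hsym (int m)) M =
      mcoeff (\<Sum>k\<in>{1..m}. power_sum k * hsym (int (m - k))) M"
    by (simp add: mconst_of_nat[symmetric]) (simp add: hsym_def)
qed

text \<open>
  The polynomial variable marks the number of power sum factors, so that the part with \<open>r\<close> factors
  can be read off as a coefficient.
\<close>

fun graded_hsym_nat :: "nat \<Rightarrow> rat mpser poly" where
  "graded_hsym_nat 0 = 1"
| "graded_hsym_nat (Suc m) = smult (mconst (1 / of_nat (Suc m)))
     (\<Sum>k\<in>{..m}. monom (power_sum (Suc k)) 1 * graded_hsym_nat (m - k))"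

definition graded_hsym :: "int \<Rightarrow> rat mpser poly" where
  "graded_hsym m = (if m < 0 then 0 else graded_hsym_nat (nat m))"

text \<open>With the marker set to 1, the recursion is \<open>newton_identity\<close> divided by
  \<open>m\<close>.\<close>

lemma poly_graded_hsym_nat: "poly (graded_hsym_nat m) 1 = hsym (int m)"
proof (induction m rule: less_induct)
  case (less m)
  show ?case
  proof (cases m)
    case (Suc n)
    have "poly (graded_hsym_nat m) 1 =
        mconst (1 / of_nat m) * (\<Sum>k\<in>{..n}. power_sum (Suc k) * hsym (int (n - k)))"
      unfolding Suc using less Suc by (simp add: poly_sum poly_monom)
    also have "(\<Sum>k\<in>{..n}. power_sum (Suc k) * hsym (int (n - k))) =
        (\<Sum>k\<in>{1..m}. power_sum k * hsym (int (m - k)))"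
      unfolding Suc by (rule sum.reindex_bij_witness[of _ "\<lambda>k. k - 1" Suc]) auto
    also have "\<dots> = mconst (of_nat m) * hsym (int m)" by (simp add: newton_identity mconst_of_nat)
    also have "mconst (1 / of_nat m) * (mconst (of_nat m) * hsym (int m)) = hsym (int m)"
      using Suc by (simp add: mult.assoc[symmetric] mconst_mult[symmetric] del: of_nat_Suc)
    finally show ?thesis .
  qed (simp add: hsym_0)
qed

lemma poly_graded_hsym: "poly (graded_hsym m) 1 = hsym m"
  by (simp add: graded_hsym_def poly_graded_hsym_nat hsym_neg)

lemma coeff_graded_hsym_nat_0: "coeff (graded_hsym_nat m) 0 = (if m = 0 then 1 else 0)"
  by (cases m) (simp_all add: coeff_sum coeff_mult coeff_monom)

text \<open>Each summand of the recursion already carries one marker, so only the summand whose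
  other factor has a nonzero constant coefficient survives, namely \<open>k = n\<close>.\<close>

lemma coeff_graded_hsym_nat_1:
  assumes "0 < m"
  shows "coeff (graded_hsym_nat m) 1 = power_sum_tilde m"
proof -
  obtain n where m: "m = Suc n" using assms by (cases m) auto
  have "coeff (monom (power_sum (Suc k)) 1 * graded_hsym_nat (n - k)) 1 =
      (if k = n then power_sum m else 0)" if "k \<le> n" for k
    using that m by (simp add: coeff_monom_mult coeff_graded_hsym_nat_0)
  then have "(\<Sum>k\<in>{..n}. coeff (monom (power_sum (Suc k)) 1 * graded_hsym_nat (n - k)) 1) = power_sum m"
    by simp
  then show ?thesis by (simp add: m coeff_sum power_sum_tilde_def)
qed

text \<open>Rational combinations of power sum products of weight \<open>n\<close>, each marked by
  its number of factors. Factors may come in any order, so that products are closed under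
  concatenation; sorting into partitions is postponed to
  \<open>power_sum_span_imp_sum\<close>.\<close>

inductive_set power_sum_span :: "nat \<Rightarrow> rat mpser poly set" for n where
  zero: "0 \<in> power_sum_span n"
| add: "\<lbrakk>0 \<notin> set ks; sum_list ks = n; f \<in> power_sum_span n\<rbrakk> \<Longrightarrow>
    monom (mconst c * power_sum_part ks) (length ks) + f \<in> power_sum_span n"

lemma power_sum_span_add: "f \<in> power_sum_span n \<Longrightarrow> g \<in> power_sum_span n \<Longrightarrow> f + g \<in> power_sum_span n"
  by (induction rule: power_sum_span.induct) (auto simp: add.assoc intro: power_sum_span.add)

lemma power_sum_span_sum:
  "(\<And>x. x \<in> S \<Longrightarrow> f x \<in> power_sum_span n) \<Longrightarrow> sum f S \<in> power_sum_span n"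
  by (induction S rule: infinite_finite_induct)
    (auto intro: power_sum_span.zero power_sum_span_add)

lemma power_sum_span_monom:
  "0 \<notin> set ks \<Longrightarrow> sum_list ks = n \<Longrightarrow> monom (mconst c * power_sum_part ks) (length ks) \<in> power_sum_span n"
  using power_sum_span.add[OF _ _ power_sum_span.zero, of ks n c] by simp

lemma power_sum_span_smult: "f \<in> power_sum_span n \<Longrightarrow> smult (mconst c) f \<in> power_sum_span n"
proof (induction rule: power_sum_span.induct)
  case (add ks f d)
  then show ?case
    using power_sum_span.add[of ks n "smult (mconst c) f" "c * d"]
    by (simp add: smult_add_right smult_monom mconst_mult mult.assoc)
qed (simp add: power_sum_span.zero)

lemma power_sum_span_mult:
  "f \<in> power_sum_span m \<Longrightarrow> g \<in> power_sum_span n \<Longrightarrow> f * g \<in> power_sum_span (m + n)"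
proof (induction rule: power_sum_span.induct)
  case (add ks f c)
  have "monom (mconst c * power_sum_part ks) (length ks) * g \<in> power_sum_span (m + n)"
    using \<open>g \<in> power_sum_span n\<close>
  proof (induction rule: power_sum_span.induct)
    case (add ls g d)
    have "monom (mconst c * power_sum_part ks) (length ks) *
        monom (mconst d * power_sum_part ls) (length ls) =
        monom (mconst (c * d) * power_sum_part (ks @ ls)) (length (ks @ ls))"
      by (simp add: mult_monom mconst_mult power_sum_part_def mult_ac)
    moreover have "monom (mconst (c * d) * power_sum_part (ks @ ls)) (length (ks @ ls)) \<in> power_sum_span (m + n)"
      using add \<open>0 \<notin> set ks\<close> \<open>sum_list ks = m\<close> by (intro power_sum_span_monom) auto
    ultimately show ?case using add by (simp add: distrib_left power_sum_span_add)
  qed (simp add: power_sum_span.zero)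
  then show ?case using add by (simp add: distrib_right power_sum_span_add)
qed (simp add: power_sum_span.zero)

lemma one_in_power_sum_span: "1 \<in> power_sum_span 0"
  using power_sum_span_monom[of "[]" 0 1] by (simp add: power_sum_part_def monom_eq_1)

lemma power_sum_span_prod:
  "finite S \<Longrightarrow> (\<And>x. x \<in> S \<Longrightarrow> f x \<in> power_sum_span (d x)) \<Longrightarrow> prod f S \<in> power_sum_span (sum d S)"
  by (induction S rule: finite_induct) (auto intro: one_in_power_sum_span power_sum_span_mult)

lemma graded_hsym_nat_in_power_sum_span: "graded_hsym_nat m \<in> power_sum_span m"
proof (induction m rule: less_induct)
  case (less m)
  show ?case
  proof (cases m)
    case (Suc n)
    have "monom (power_sum (Suc k)) 1 * graded_hsym_nat (n - k) \<in> power_sum_span m" if "k \<le> n" for k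
    proof -
      have "monom (power_sum (Suc k)) 1 \<in> power_sum_span (Suc k)"
        using power_sum_span_monom[of "[Suc k]" "Suc k" 1] by (simp add: power_sum_part_def)
      moreover have "graded_hsym_nat (n - k) \<in> power_sum_span (n - k)" using less Suc by simp
      ultimately show ?thesis using power_sum_span_mult that Suc by fastforce
    qed
    then show ?thesis unfolding Suc
      by (auto intro!: power_sum_span_smult power_sum_span_sum)
  qed (simp add: one_in_power_sum_span)
qed

lemma power_sum_span_imp_sum:
  assumes "f \<in> power_sum_span n"
  shows "\<exists>c. f = (\<Sum>\<nu>\<in>partitions_of n. monom (mconst (c \<nu>) * power_sum_part \<nu>) (length \<nu>))"
  using assms
proof (induction rule: power_sum_span.induct)
  case zero
  show ?case by (rule exI[of _ "\<lambda>_. 0"]) simp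
next
  case (add ks f d)
  then obtain c where c: "f = (\<Sum>\<nu>\<in>partitions_of n. monom (mconst (c \<nu>) * power_sum_part \<nu>) (length \<nu>))"
    by blast
  let ?ks = "rev (sort ks)"
  have mset: "mset ?ks = mset ks" by simp
  have "sorted_wrt (\<ge>) ?ks" by (simp add: sorted_wrt_rev)
  then have ks: "?ks \<in> partitions_of n"
    using add sum_mset_sum_list[of ?ks] sum_mset_sum_list[of ks] mset
    by (simp add: partitions_of_def is_partition_def)
  have "power_sum_part ?ks = power_sum_part ks"
    by (simp add: power_sum_part_def flip: prod_mset_prod_list)
  then have "monom (mconst d * power_sum_part ks) (length ks) =
      (\<Sum>\<nu>\<in>partitions_of n. if \<nu> = ?ks then monom (mconst d * power_sum_part \<nu>) (length \<nu>) else 0)"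
    using ks by (simp add: sum.delta finite_partitions_of)
  also have "\<dots> = (\<Sum>\<nu>\<in>partitions_of n.
      monom (mconst (if \<nu> = ?ks then d else 0) * power_sum_part \<nu>) (length \<nu>))"
    by (rule sum.cong) auto
  finally have "monom (mconst d * power_sum_part ks) (length ks) + f =
      (\<Sum>\<nu>\<in>partitions_of n.
        monom (mconst ((if \<nu> = ?ks then d else 0) + c \<nu>) * power_sum_part \<nu>) (length \<nu>))"
    by (simp only: c sum.distrib[symmetric] mconst_add distrib_right add_monom)
  then show ?case by (rule exI[of _ "\<lambda>\<nu>. (if \<nu> = ?ks then d else 0) + c \<nu>"])
qed

section \<open>Linear independence of the power sum products\<close>

lemma mcoeff_power_sum_part_nonneg: "0 \<le> mcoeff (power_sum_part ks) M"
proof (induction ks arbitrary: M)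
  case Nil
  show ?case by (simp add: power_sum_part_def one_mpser_def)
next
  case (Cons k ks)
  have "mcoeff (power_sum_part (k # ks)) M =
      (\<Sum>(A, B)\<in>msplits M. mcoeff (power_sum k) A * mcoeff (power_sum_part ks) B)"
    by (simp add: power_sum_part_def mcoeff_times)
  also have "\<dots> \<ge> 0"
    by (rule sum_nonneg) (auto simp: Cons power_sum_def)
  finally show ?case .
qed

text \<open>Coefficients are nonnegative, so nothing cancels and a single choice of one variable per
  factor suffices.\<close>

lemma mcoeff_power_sum_part_pos:
  assumes "length xs = length ks" "M = (\<Sum>i<length ks. replicate_mset (ks ! i) (xs ! i))"
  shows "0 < mcoeff (power_sum_part ks) M"
  using assms
proof (induction ks arbitrary: xs M)
  case Nil
  then show ?case by (simp add: power_sum_part_def one_mpser_def)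
next
  case (Cons k ks)
  then obtain y ys where xs: "xs = y # ys" "length ys = length ks" by (cases xs) auto
  let ?B = "\<Sum>i<length ks. replicate_mset (ks ! i) (ys ! i)"
  have M: "M = replicate_mset k y + ?B"
    unfolding Cons.prems(2) xs by (simp add: sum.lessThan_Suc_shift del: sum.lessThan_Suc)
  have "0 < mcoeff (power_sum k) (replicate_mset k y) * mcoeff (power_sum_part ks) ?B"
    using Cons.IH[OF xs(2) refl] by (auto simp: power_sum_def)
  moreover have "mcoeff (power_sum_part (k # ks)) M =
      (\<Sum>(A, B)\<in>msplits M. mcoeff (power_sum k) A * mcoeff (power_sum_part ks) B)"
    by (simp add: power_sum_part_def mcoeff_times)
  moreover have "(case (replicate_mset k y, ?B) of (A, B) \<Rightarrow>
      mcoeff (power_sum k) A * mcoeff (power_sum_part ks) B) \<le>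
      (\<Sum>(A, B)\<in>msplits M. mcoeff (power_sum k) A * mcoeff (power_sum_part ks) B)"
  proof (rule member_le_sum)
    show "(replicate_mset k y, ?B) \<in> msplits M" by (simp add: M msplits_def)
  qed (auto simp: power_sum_def mcoeff_power_sum_part_nonneg)
  ultimately show ?case by simp
qed

lemma mcoeff_power_sum_part_nonzeroE:
  assumes "mcoeff (power_sum_part ks) M \<noteq> 0"
  shows "\<exists>xs. length xs = length ks \<and> M = (\<Sum>i<length ks. replicate_mset (ks ! i) (xs ! i))"
  using assms
proof (induction ks arbitrary: M)
  case Nil
  then show ?case by (auto simp: power_sum_part_def one_mpser_def split: if_splits)
next
  case (Cons k ks)
  have "(\<Sum>(A, B)\<in>msplits M. mcoeff (power_sum k) A * mcoeff (power_sum_part ks) B) \<noteq> 0"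
    using Cons.prems by (simp add: power_sum_part_def mcoeff_times)
  then obtain p where "p \<in> msplits M" "(case p of (A, B) \<Rightarrow> mcoeff (power_sum k) A * mcoeff (power_sum_part ks) B) \<noteq> 0"
    by (rule sum.not_neutral_contains_not_neutral)
  then obtain A B where AB: "M = A + B" "mcoeff (power_sum k) A \<noteq> 0" "mcoeff (power_sum_part ks) B \<noteq> 0"
    by (auto simp: msplits_def)
  obtain y where y: "A = replicate_mset k y" using AB(2) by (auto simp: power_sum_def split: if_splits)
  obtain ys where ys: "length ys = length ks" "B = (\<Sum>i<length ks. replicate_mset (ks ! i) (ys ! i))"
    using Cons.IH[OF AB(3)] by blast
  have "M = (\<Sum>i<length (k # ks). replicate_mset ((k # ks) ! i) ((y # ys) ! i))"
    by (simp add: AB(1) y ys(2) sum.lessThan_Suc_shift del: sum.lessThan_Suc)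
  then show ?case using ys(1) by (intro exI[of _ "y # ys"]) simp
qed

definition exponent_multiset :: "nat list \<Rightarrow> nat multiset" where
  "exponent_multiset \<nu> = (\<Sum>i<length \<nu>. replicate_mset (\<nu> ! i) i)"

lemma count_sum_replicate:
  assumes "distinct xs" "length xs = length ks" "i < length ks"
  shows "count (\<Sum>i<length ks. replicate_mset (ks ! i) (xs ! i)) (xs ! i) = ks ! i"
proof -
  have "count (\<Sum>i<length ks. replicate_mset (ks ! i) (xs ! i)) (xs ! i) =
      (\<Sum>j<length ks. if j = i then ks ! i else 0)"
    unfolding count_sum using assms by (intro sum.cong) (auto simp: nth_eq_iff_index_eq)
  then show ?thesis using assms by simp
qed

lemma set_mset_sum_replicate:
  assumes "0 \<notin> set ks" "length xs = length ks"
  shows "set_mset (\<Sum>i<length ks. replicate_mset (ks ! i) (xs ! i)) = set xs"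
proof -
  have "ks ! i \<noteq> 0" if "i < length ks" for i using assms(1) nth_mem[OF that] by metis
  then have "set_mset (\<Sum>i<length ks. replicate_mset (ks ! i) (xs ! i)) = (\<Union>i<length ks. {xs ! i})"
    unfolding set_mset_sum[OF finite_lessThan] by (intro SUP_cong) auto
  also have "\<dots> = set xs" using assms(2) by (auto simp: set_conv_nth)
  finally show ?thesis .
qed

lemma counts_sum_replicate:
  assumes "0 \<notin> set ks" "distinct xs" "length xs = length ks"
    and M: "M = (\<Sum>i<length ks. replicate_mset (ks ! i) (xs ! i))"
  shows "image_mset (count M) (mset_set (set_mset M)) = mset ks"
proof -
  have "mset_set (set_mset M) = mset xs"
    unfolding M using assms by (simp add: set_mset_sum_replicate mset_set_set)
  moreover have "map (count M) xs = ks"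
    unfolding M using assms count_sum_replicate by (intro nth_equalityI) auto
  ultimately show ?thesis by (metis mset_map)
qed

text \<open>
  The monomial \<open>\<Prod> x\<^sub>i ^ \<nu>\<^sub>i\<close> with \<open>\<ell>(\<nu>)\<close> variables cannot occur in a product of fewer power sums.
\<close>

lemma mcoeff_power_sum_part_exponent_multiset:
  assumes \<nu>: "is_partition \<nu>" and \<kappa>: "is_partition \<kappa>" and le: "length \<kappa> \<le> length \<nu>" and ne: "\<kappa> \<noteq> \<nu>"
  shows "mcoeff (power_sum_part \<kappa>) (exponent_multiset \<nu>) = 0"
proof (rule ccontr)
  let ?M = "exponent_multiset \<nu>"
  assume "mcoeff (power_sum_part \<kappa>) ?M \<noteq> 0"
  then obtain xs where xs: "length xs = length \<kappa>"
      "?M = (\<Sum>i<length \<kappa>. replicate_mset (\<kappa> ! i) (xs ! i))"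
    using mcoeff_power_sum_part_nonzeroE by blast
  have z: "0 \<notin> set \<nu>" "0 \<notin> set \<kappa>" using \<nu> \<kappa> by (auto simp: is_partition_def)
  have M: "?M = (\<Sum>i<length \<nu>. replicate_mset (\<nu> ! i) ([0..<length \<nu>] ! i))"
    by (simp add: exponent_multiset_def)
  have "set xs = set_mset ?M" using set_mset_sum_replicate[OF z(2) xs(1)] xs(2) by simp
  also have "\<dots> = {..<length \<nu>}" using set_mset_sum_replicate[OF z(1), of "[0..<length \<nu>]"] M
    by (auto simp: atLeast0LessThan)
  finally have "card (set xs) = length \<nu>" by simp
  \<comment> \<open>All \<open>length \<nu>\<close> variables occur although \<open>\<kappa>\<close>
    has at most that many factors. Hence each factor has its own variable, and the exponents of the
    monomial are the parts of \<open>\<kappa>\<close>.\<close>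
  then have "distinct xs" using le xs(1) card_length[of xs] by (intro card_distinct) simp
  then have "mset \<kappa> = mset \<nu>"
    using counts_sum_replicate[OF z(2) _ xs] counts_sum_replicate[OF z(1) _ _ M] by simp
  then have "mset (rev \<kappa>) = mset (rev \<nu>)" by simp
  moreover have "sorted (rev \<kappa>)" "sorted (rev \<nu>)"
    using \<nu> \<kappa> by (simp_all add: is_partition_def sorted_wrt_rev)
  ultimately have "rev \<kappa> = rev \<nu>" by (metis sorted_sort_id properties_for_sort)
  then show False using ne by simp
qed

text \<open>Triangularity by length: among the partitions with nonzero coefficient take a longest
  one, \<open>\<eta>\<close>. Its exponent monomial occurs in \<open>power_sum_part \<eta>\<close>
  and in no other product of the relation.\<close>

lemma power_sum_part_independent:
  assumes sum: "(\<Sum>\<nu>\<in>partitions_of n. mconst (c \<nu>) * power_sum_part \<nu>) = 0" and \<nu>: "\<nu> \<in> partitions_of n"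
  shows "c \<nu> = 0"
proof (rule ccontr)
  assume "c \<nu> \<noteq> 0"
  let ?S = "{\<nu> \<in> partitions_of n. c \<nu> \<noteq> 0}"
  have fin: "finite ?S" using finite_partitions_of by simp
  have "?S \<noteq> {}" using \<nu> \<open>c \<nu> \<noteq> 0\<close> by blast
  then have "Max (length ` ?S) \<in> length ` ?S" using fin by (intro Max_in) auto
  then obtain \<eta> where \<eta>: "\<eta> \<in> ?S" "length \<eta> = Max (length ` ?S)" by auto
  have max: "length \<kappa> \<le> length \<eta>" if "\<kappa> \<in> ?S" for \<kappa>
    unfolding \<eta>(2) using that fin by (intro Max_ge) auto
  let ?M = "exponent_multiset \<eta>"
  have "0 = (\<Sum>\<kappa>\<in>partitions_of n. c \<kappa> * mcoeff (power_sum_part \<kappa>) ?M)"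
    using arg_cong[OF sum, of "\<lambda>f. mcoeff f ?M"] by (simp add: mcoeff_sum)
  also have "\<dots> = (\<Sum>\<kappa>\<in>partitions_of n. if \<kappa> = \<eta> then c \<eta> * mcoeff (power_sum_part \<eta>) ?M else 0)"
  proof (rule sum.cong[OF refl])
    fix \<kappa> assume \<kappa>: "\<kappa> \<in> partitions_of n"
    show "c \<kappa> * mcoeff (power_sum_part \<kappa>) ?M = (if \<kappa> = \<eta> then c \<eta> * mcoeff (power_sum_part \<eta>) ?M else 0)"
      using mcoeff_power_sum_part_exponent_multiset[of \<eta> \<kappa>] \<kappa> \<eta>(1) max[of \<kappa>]
      by (cases "c \<kappa> = 0") (auto simp: partitions_of_def)
  qed
  also have "\<dots> = c \<eta> * mcoeff (power_sum_part \<eta>) ?M"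
    using \<eta>(1) by (simp add: sum.delta finite_partitions_of)
  finally have "mcoeff (power_sum_part \<eta>) ?M = 0" using \<eta>(1) by simp
  moreover have "0 < mcoeff (power_sum_part \<eta>) ?M"
    by (rule mcoeff_power_sum_part_pos[of "[0..<length \<eta>]"]) (simp_all add: exponent_multiset_def)
  ultimately show False by simp
qed

section \<open>Identification of the skew characters\<close>

lemma zee_pos: "0 \<notin> set \<nu> \<Longrightarrow> 0 < zee \<nu>"
  unfolding zee_def by (rule prod_pos) (auto simp: zero_less_power intro!: Nat.gr0I)

text \<open>The definite description needs both existence and uniqueness: the given expansion
  supplies the former, independence of the power sum products the latter.\<close>

lemma skew_char_eqI:
  assumes "skew_schur \<alpha> \<mu> = (\<Sum>\<nu>\<in>partitions_of (card (skew \<alpha> \<mu>)). mconst (c \<nu>) * power_sum_part \<nu>)"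
    and \<nu>: "\<nu> \<in> partitions_of (card (skew \<alpha> \<mu>))"
  shows "skew_char \<alpha> \<mu> \<nu> / of_nat (zee \<nu>) = c \<nu>"
proof -
  let ?P = "partitions_of (card (skew \<alpha> \<mu>))"
  let ?\<chi> = "\<lambda>\<nu>. if \<nu> \<in> ?P then c \<nu> * of_nat (zee \<nu>) else 0"
  have zee: "of_nat (zee \<nu>) \<noteq> (0 :: rat)" if "\<nu> \<in> ?P" for \<nu>
    using zee_pos[of \<nu>] that by (simp add: partitions_of_def is_partition_def)
  have "skew_char \<alpha> \<mu> = ?\<chi>"
    unfolding skew_char_def
  proof (rule the_equality)
    have "(\<Sum>\<nu>\<in>?P. mconst (?\<chi> \<nu> / of_nat (zee \<nu>)) * power_sum_part \<nu>) =
        (\<Sum>\<nu>\<in>?P. mconst (c \<nu>) * power_sum_part \<nu>)"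
      by (rule sum.cong) (use zee in auto)
    then show "skew_schur \<alpha> \<mu> = (\<Sum>\<nu>\<in>?P. mconst (?\<chi> \<nu> / of_nat (zee \<nu>)) * power_sum_part \<nu>) \<and>
        (\<forall>\<nu>. \<nu> \<notin> ?P \<longrightarrow> ?\<chi> \<nu> = 0)" using assms(1) by simp
  next
    fix \<chi>
    assume \<chi>: "skew_schur \<alpha> \<mu> = (\<Sum>\<nu>\<in>?P. mconst (\<chi> \<nu> / of_nat (zee \<nu>)) * power_sum_part \<nu>) \<and>
        (\<forall>\<nu>. \<nu> \<notin> ?P \<longrightarrow> \<chi> \<nu> = 0)"
    have "mconst (x - y) = mconst x - (mconst y :: rat mpser)" for x y
      by (rule mpser_eqI) (simp add: mconst_def)
    then have "(\<Sum>\<nu>\<in>?P. mconst (\<chi> \<nu> / of_nat (zee \<nu>) - c \<nu>) * power_sum_part \<nu>) = 0"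
      using \<chi> assms(1) by (simp add: left_diff_distrib sum_subtractf)
    then have "\<chi> \<nu> / of_nat (zee \<nu>) - c \<nu> = 0" if "\<nu> \<in> ?P" for \<nu>
      using power_sum_part_independent that by fast
    then have "\<chi> \<nu> / of_nat (zee \<nu>) * of_nat (zee \<nu>) = c \<nu> * of_nat (zee \<nu>)" if "\<nu> \<in> ?P" for \<nu>
      using that by simp
    from this zee have "\<chi> \<nu> = c \<nu> * of_nat (zee \<nu>)" if "\<nu> \<in> ?P" for \<nu>
      using that by (metis nonzero_eq_divide_eq times_divide_eq_left)
    then have "\<chi> \<nu> = ?\<chi> \<nu>" for \<nu> using \<chi> by simp
    then show "\<chi> = ?\<chi>" by (rule ext)
  qed
  then show ?thesis using \<nu> zee[OF \<nu>] by simp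
qed

text \<open>The total weight of the factors \<open>a i - b (p i)\<close> is the same for all
  \<open>p\<close>, because \<open>p\<close> only rearranges the \<open>b i\<close>; a product with
  a factor of negative index is 0.\<close>

lemma perm_det_graded_hsym_in_power_sum_span:
  "perm_det n (\<lambda>i j. graded_hsym (a i - b j)) \<in> power_sum_span (nat (\<Sum>i\<in>{1..n}. a i - b i))"
  unfolding perm_det_def
proof (rule power_sum_span_sum)
  let ?m = "nat (\<Sum>i\<in>{1..n}. a i - b i)"
  fix p assume "p \<in> {p. p permutes {1..n}}"
  then have p: "p permutes {1..n}" by simp
  have "(\<Prod>i\<in>{1..n}. graded_hsym (a i - b (p i))) \<in> power_sum_span ?m"
  proof (cases "\<exists>i\<in>{1..n}. a i < b (p i)")
    case True
    then have "(\<Prod>i\<in>{1..n}. graded_hsym (a i - b (p i))) = 0"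
      by (intro prod_zero) (auto simp: graded_hsym_def)
    then show ?thesis by (simp add: power_sum_span.zero)
  next
    case False
    have "(\<Sum>i\<in>{1..n}. int (nat (a i - b (p i)))) = (\<Sum>i\<in>{1..n}. a i - b (p i))"
      using False by (intro sum.cong) (auto simp: not_less)
    also have "\<dots> = (\<Sum>i\<in>{1..n}. a i - b i)"
      using sum.permute[OF p, of b] by (simp add: sum_subtractf comp_def)
    finally have "(\<Sum>i\<in>{1..n}. nat (a i - b (p i))) = ?m" by (metis nat_int of_nat_sum)
    moreover have "(\<Prod>i\<in>{1..n}. graded_hsym (a i - b (p i))) \<in>
        power_sum_span (\<Sum>i\<in>{1..n}. nat (a i - b (p i)))"
      using False by (intro power_sum_span_prod)
        (auto simp: graded_hsym_def graded_hsym_nat_in_power_sum_span)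
    ultimately show ?thesis by simp
  qed
  moreover have "(- 1) ^ k * f \<in> power_sum_span ?m" if "f \<in> power_sum_span ?m" for k f
  proof (induction k)
    case (Suc k)
    then show ?case using power_sum_span_smult[of "(- 1) ^ k * f" _ "- 1"]
      by (simp add: mconst_minus_1)
  qed (simp add: that)
  ultimately show "(- 1) ^ card (inversions n p) * (\<Prod>i\<in>{1..n}. graded_hsym (a i - b (p i))) \<in>
      power_sum_span ?m" by blast
qed

lemma poly_perm_det: "poly (perm_det n f) x = perm_det n (\<lambda>i j. poly (f i j) x)"
  by (simp add: perm_det_def poly_sum poly_prod)

text \<open>Setting the marker to 1 gives an expansion of \<open>skew_schur\<close>, whose
  coefficients must be the character values. The marker degree of each term is the length of its
  partition, so the coefficient of degree \<open>r\<close> selects the required terms.\<close>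

theorem skew_schur_hat_eq_coeff:
  assumes "is_partition \<alpha>" "is_partition \<mu>" "part_subset \<mu> \<alpha>"
  shows "skew_schur_hat \<alpha> \<mu> r =
    coeff (perm_det (int (length \<alpha>)) (\<lambda>i j. graded_hsym (bead \<alpha> i - bead \<mu> j))) r"
proof -
  let ?n = "int (length \<alpha>)"
  let ?P = "partitions_of (card (skew \<alpha> \<mu>))"
  let ?f = "perm_det ?n (\<lambda>i j. graded_hsym (bead \<alpha> i - bead \<mu> j))"
  have "int (card (skew \<alpha> \<mu>)) = (\<Sum>i\<in>{1..?n}. bead \<alpha> i - bead \<mu> i)"
    unfolding skew_eq_bead_diagram by (rule card_bead_diagram) (rule bead_le[OF assms(3)])
  then have "card (skew \<alpha> \<mu>) = nat (\<Sum>i\<in>{1..?n}. bead \<alpha> i - bead \<mu> i)" by (metis nat_int)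
  then obtain c where c: "?f = (\<Sum>\<nu>\<in>?P. monom (mconst (c \<nu>) * power_sum_part \<nu>) (length \<nu>))"
    using power_sum_span_imp_sum[OF perm_det_graded_hsym_in_power_sum_span[of ?n "bead \<alpha>" "bead \<mu>"]] by auto
  have "skew_schur \<alpha> \<mu> = poly ?f 1"
    by (simp add: skew_schur_jacobi_trudi[OF assms] poly_perm_det poly_graded_hsym)
  also have "\<dots> = (\<Sum>\<nu>\<in>?P. mconst (c \<nu>) * power_sum_part \<nu>)"
    unfolding c by (simp add: poly_sum poly_monom)
  finally have char: "skew_char \<alpha> \<mu> \<nu> / of_nat (zee \<nu>) = c \<nu>" if "\<nu> \<in> ?P" for \<nu>
    using skew_char_eqI that by blast
  have "coeff ?f r = (\<Sum>\<nu>\<in>?P. if length \<nu> = r then mconst (c \<nu>) * power_sum_part \<nu> else 0)"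
    unfolding c by (simp add: coeff_sum)
  also have "\<dots> = (\<Sum>\<nu> | \<nu> \<in> ?P \<and> length \<nu> = r. mconst (c \<nu>) * power_sum_part \<nu>)"
    by (simp add: sum.inter_filter finite_partitions_of)
  also have "\<dots> = skew_schur_hat \<alpha> \<mu> r"
    unfolding skew_schur_hat_def using char by (intro sum.cong) auto
  finally show ?thesis by simp
qed


section \<open>Snakes and rank in terms of beads\<close>

definition bead_set :: "nat list \<Rightarrow> int set" where
  "bead_set \<alpha> = bead \<alpha> ` {1..}"

lemma path_step_cases [consumes 1, case_names vertical horizontal]:
  assumes "is_partition \<alpha>"
  obtains (vertical) i where "1 \<le> i" "path_step \<alpha> k = right_edge (i, part \<alpha> i)" "k = bead \<alpha> i"
    "k \<in> bead_set \<alpha>"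
  | (horizontal) j where "1 \<le> j" "path_step \<alpha> k = lower_edge (conj_part \<alpha> j, j)"
    "k = j - 1 - conj_part \<alpha> j" "k \<notin> bead_set \<alpha>"
proof -
  have "path_step \<alpha> k \<in> boundary_path \<alpha>" "step_index (path_step \<alpha> k) = k"
    using path_step[OF assms] by auto
  then consider i where "1 \<le> i" "path_step \<alpha> k = right_edge (i, part \<alpha> i)" "k = bead \<alpha> i"
    | j where "1 \<le> j" "path_step \<alpha> k = lower_edge (conj_part \<alpha> j, j)" "k = j - 1 - conj_part \<alpha> j"
    unfolding boundary_path_def bead_def by fastforce
  then show ?thesis
  proof cases
    case (1 i)
    then show ?thesis using vertical[of i] by (auto simp: bead_set_def)
  next
    case (2 j)
    \<comment> \<open>If row \<open>i\<close> ended at the same index, then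
      \<open>part \<alpha> i - j = i - conj_part \<alpha> j - 1\<close>, which contradicts
      \<open>conj_part_iff\<close> on either side of the equivalence.\<close>
    have "bead \<alpha> i \<noteq> k" if "1 \<le> i" for i
      using conj_part_iff[OF assms that 2(1)] 2(3) by (auto simp: bead_def)
    then have "k \<notin> bead_set \<alpha>" by (auto simp: bead_set_def)
    then show ?thesis using horizontal[of j] 2 by blast
  qed
qed

lemma horizontal_path_step_iff:
  assumes "is_partition \<alpha>"
  shows "horizontal (path_step \<alpha> k) \<longleftrightarrow> k \<notin> bead_set \<alpha>"
  using assms by (cases rule: path_step_cases[of \<alpha> k]) auto

lemma code_eq_0_iff:
  assumes "is_partition \<alpha>"
  shows "code \<alpha> k = 0 \<longleftrightarrow> k \<in> bead_set \<alpha>"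
  using horizontal_path_step_iff[OF assms] by (simp add: code_def)

text \<open>The common unit for snakes and rank: a snake is a union of two such diagonals, and the
  corner diagonals of the rank are whole ones.\<close>

definition content_diagonal :: "nat list \<Rightarrow> nat list \<Rightarrow> int \<Rightarrow> square set" where
  "content_diagonal \<alpha> \<mu> k = {s \<in> skew \<alpha> \<mu>. snd s - fst s = k}"

lemma finite_content_diagonal [simp]: "finite (content_diagonal \<alpha> \<mu> k)"
  by (simp add: content_diagonal_def finite_skew)

section \<open>The two bead sets and their common tail\<close>

locale skew_shape =
  fixes \<alpha> \<mu> :: "nat list"
  assumes partitions: "is_partition \<alpha>" "is_partition \<mu>" and subset: "part_subset \<mu> \<alpha>"
begin

abbreviation n :: int where "n \<equiv> int (length \<alpha>)"

abbreviation "a \<equiv> bead \<alpha>"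
abbreviation "b \<equiv> bead \<mu>"

text \<open>Beyond row \<open>n\<close> both partitions are empty, so both bead sequences continue
  with \<open>- i\<close>. Cutting off this common tail below \<open>- n\<close> leaves finite sets
  of equal size.\<close>

definition A :: "int set" where "A = a ` {1..n}"
definition B :: "int set" where "B = b ` {1..n}"

lemma finite_A [simp]: "finite A" and finite_B [simp]: "finite B"
  by (simp_all add: A_def B_def)

lemma inj_a: "inj_on a {1..}" and inj_b: "inj_on b {1..}"
  using bead_less[OF partitions(1)] bead_less[OF partitions(2)]
  by (metis (no_types, opaque_lifting) atLeast_iff inj_onI less_irrefl linorder_neqE)+

lemma in_skew_iff: "(i, j) \<in> skew \<alpha> \<mu> \<longleftrightarrow> 1 \<le> i \<and> b i < j - i \<and> j - i \<le> a i"
  by (auto simp: skew_def bead_def)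

lemma in_skew_imp_le: "(i, j) \<in> skew \<alpha> \<mu> \<Longrightarrow> i \<le> n"
  unfolding skew_eq_bead_diagram by (simp add: bead_diagram_def)

lemma a_tail: "n < i \<Longrightarrow> a i = - i"
  by (simp add: bead_def part_def)

lemma b_tail: "n < i \<Longrightarrow> b i = - i"
  using a_tail[of i] bead_le[OF subset, of i] part_nonneg[of \<mu> i] by (simp add: bead_def)

lemma a_ge: "i \<le> n \<Longrightarrow> - n \<le> a i" and b_ge: "i \<le> n \<Longrightarrow> - n \<le> b i"
  using part_nonneg[of \<alpha> i] part_nonneg[of \<mu> i] by (simp_all add: bead_def)

lemma bead_set_\<alpha>: "bead_set \<alpha> = A \<union> {..<- n}"
proof -
  have "a ` {n + 1..} = {..<- n}"
  proof (intro equalityI subsetI)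
    fix k assume "k \<in> {..<- n}"
    then show "k \<in> a ` {n + 1..}" using a_tail[of "- k"] by (intro image_eqI[of _ _ "- k"]) auto
  qed (auto simp: a_tail)
  moreover have "{1..} = {1..n} \<union> {n + 1..}" by auto
  ultimately show ?thesis by (simp add: bead_set_def A_def image_Un)
qed

lemma bead_set_\<mu>: "bead_set \<mu> = B \<union> {..<- n}"
proof -
  have "b ` {n + 1..} = {..<- n}"
  proof (intro equalityI subsetI)
    fix k assume "k \<in> {..<- n}"
    then show "k \<in> b ` {n + 1..}" using b_tail[of "- k"] by (intro image_eqI[of _ _ "- k"]) auto
  qed (auto simp: b_tail)
  moreover have "{1..} = {1..n} \<union> {n + 1..}" by auto
  ultimately show ?thesis by (simp add: bead_set_def B_def image_Un)
qed

lemma B_ge: "k \<in> B \<Longrightarrow> - n \<le> k"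
  using b_ge by (auto simp: B_def)

lemma finite_rows [simp]: "finite {i. 1 \<le> i \<and> i \<le> n \<and> P i}"
  by (rule finite_subset[of _ "{1..n}"]) auto

text \<open>Row \<open>i\<close> meets the diagonal of content \<open>k\<close> exactly when
  \<open>b i < k \<le> a i\<close>, and the rows with \<open>k \<le> b i\<close> are among those
  with \<open>k \<le> a i\<close>.\<close>

lemma int_card_content_diagonal:
  "int (card (content_diagonal \<alpha> \<mu> k)) =
    int (card {i \<in> {1..n}. k \<le> a i}) - int (card {i \<in> {1..n}. k \<le> b i})"
proof -
  have eq: "content_diagonal \<alpha> \<mu> k = (\<lambda>i. (i, i + k)) ` ({i \<in> {1..n}. k \<le> a i} - {i \<in> {1..n}. k \<le> b i})"
  proof -
    have "(i, j) \<in> content_diagonal \<alpha> \<mu> k \<longleftrightarrow> j = i + k \<and> i \<in> {1..n} \<and> k \<le> a i \<and> \<not> k \<le> b i" for i j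
      using in_skew_imp_le[of i j] by (auto simp: content_diagonal_def in_skew_iff)
    then show ?thesis by auto
  qed
  have sub: "{i \<in> {1..n}. k \<le> b i} \<subseteq> {i \<in> {1..n}. k \<le> a i}"
    using bead_le[OF subset] order_trans by blast
  have "card (content_diagonal \<alpha> \<mu> k) = card ({i \<in> {1..n}. k \<le> a i} - {i \<in> {1..n}. k \<le> b i})"
    unfolding eq by (rule card_image) (auto simp: inj_on_def)
  also have "\<dots> = card {i \<in> {1..n}. k \<le> a i} - card {i \<in> {1..n}. k \<le> b i}"
    by (rule card_Diff_subset) (use sub in auto)
  finally show ?thesis using card_mono[OF _ sub] by simp
qed

lemma card_ge_diff:
  fixes c :: "int \<Rightarrow> int"
  assumes "inj_on c {1..n}"
  shows "int (card {i \<in> {1..n}. k \<le> c i}) =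
    int (card {i \<in> {1..n}. k + 1 \<le> c i}) + of_bool (k \<in> c ` {1..n})"
proof -
  have eq: "{i \<in> {1..n}. k \<le> c i} = {i \<in> {1..n}. k + 1 \<le> c i} \<union> {i \<in> {1..n}. c i = k}" by auto
  have "card {i \<in> {1..n}. k \<le> c i} = card {i \<in> {1..n}. k + 1 \<le> c i} + card {i \<in> {1..n}. c i = k}"
    unfolding eq by (rule card_Un_disjoint) auto
  moreover have "card {i \<in> {1..n}. c i = k} = of_bool (k \<in> c ` {1..n})"
  proof (cases "k \<in> c ` {1..n}")
    case True
    then obtain i where "i \<in> {1..n}" "c i = k" by auto
    then have "{i \<in> {1..n}. c i = k} = {i}" using assms by (auto dest: inj_onD)
    then show ?thesis using True by simp
  next
    case False
    then have "{i \<in> {1..n}. c i = k} = {}" by auto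
    then show ?thesis using False by simp
  qed
  ultimately show ?thesis by simp
qed

lemma card_content_diagonal_diff:
  "int (card (content_diagonal \<alpha> \<mu> k)) - int (card (content_diagonal \<alpha> \<mu> (k + 1))) =
    of_bool (k \<in> A) - of_bool (k \<in> B)"
  using card_ge_diff[of a k] card_ge_diff[of b k] inj_on_subset[OF inj_a, of "{1..n}"]
    inj_on_subset[OF inj_b, of "{1..n}"]
  by (simp add: int_card_content_diagonal A_def B_def)

text \<open>All squares of content \<open>k\<close> or \<open>k + 1\<close> lie up and left of step
  \<open>k\<close>, so the zigzag takes in both diagonals completely. If step \<open>k\<close> is
  shared with the path of \<open>\<mu>\<close>, both diagonals are empty, in agreement with the
  separate clause of the definition.\<close>

lemma snake_eq: "snake \<alpha> \<mu> k = content_diagonal \<alpha> \<mu> k \<union> content_diagonal \<alpha> \<mu> (k + 1)"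
  using partitions(1)
proof (cases rule: path_step_cases[where k = k])
  case (vertical i)
  show ?thesis
  proof (cases "path_step \<alpha> k \<in> boundary_path \<mu>")
    case True
    then have "b i = k" using vertical(2,3) by (auto simp: boundary_path_def bead_def)
    have False if s: "(i', j') \<in> skew \<alpha> \<mu>" "j' - i' = k \<or> j' - i' = k + 1" for i' j'
    proof (cases "i' \<le> i")
      case True
      then have "b i \<le> b i'" using s(1) bead_less[OF partitions(2), of i' i]
        by (cases "i' = i") (auto simp: in_skew_iff)
      then have "j' - i' = k + 1" using s \<open>b i = k\<close> by (auto simp: in_skew_iff)
      then have "i' \<noteq> i \<and> b i' < k + 1" using s vertical(3) by (auto simp: in_skew_iff)
      then show False using bead_less[OF partitions(2), of i' i] s True \<open>b i = k\<close>
        by (auto simp: in_skew_iff)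
    next
      case False
      then have "a i' < a i" using bead_less[OF partitions(1), of i i'] vertical(1) by simp
      then show False using s vertical(3) by (auto simp: in_skew_iff)
    qed
    then show ?thesis using True by (auto simp: snake_def content_diagonal_def)
  next
    case False
    have snake: "snake \<alpha> \<mu> k = {s \<in> skew \<alpha> \<mu>. \<exists>p\<ge>0. s = (i - p, part \<alpha> i - p) \<or> s = (i - p - 1, part \<alpha> i - p)}"
      using False by (auto simp: snake_def vertical(2))
    have "\<exists>p\<ge>0. (i', j') = (i - p, part \<alpha> i - p) \<or> (i', j') = (i - p - 1, part \<alpha> i - p)"
      if s: "(i', j') \<in> skew \<alpha> \<mu>" "j' - i' = k \<or> j' - i' = k + 1" for i' j'
    proof -
      have le: "i' \<le> i"
        using bead_less[OF partitions(1), of i i'] vertical(1,3) s by (force simp: in_skew_iff)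
      show ?thesis
      proof (cases "j' - i' = k")
        case True
        then show ?thesis using le vertical(3) by (intro exI[of _ "i - i'"]) (auto simp: bead_def)
      next
        case False
        then have "j' - i' = k + 1" "i' \<noteq> i" using s vertical(3) by (auto simp: in_skew_iff)
        then show ?thesis using le vertical(3) by (intro exI[of _ "i - i' - 1"]) (auto simp: bead_def)
      qed
    qed
    then show ?thesis unfolding snake using vertical(3)
      by (auto simp: content_diagonal_def bead_def)
  qed
next
  case (horizontal j)
  let ?i = "conj_part \<alpha> j"
  have \<alpha>_small: "j' < j" if "(i', j') \<in> skew \<alpha> \<mu>" "?i < i'" for i' j'
  proof -
    have "\<not> j \<le> part \<alpha> i'" using conj_part_iff[OF partitions(1) _ horizontal(1), of i'] that
      by (auto simp: skew_def)
    then show ?thesis using that by (auto simp: skew_def)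
  qed
  show ?thesis
  proof (cases "path_step \<alpha> k \<in> boundary_path \<mu>")
    case True
    then have conj: "conj_part \<mu> j = ?i" using horizontal(2) by (auto simp: boundary_path_def)
    have False if s: "(i', j') \<in> skew \<alpha> \<mu>" "j' - i' = k \<or> j' - i' = k + 1" for i' j'
    proof (cases "i' \<le> ?i")
      case True
      then have "j \<le> part \<mu> i'" using conj_part_iff[OF partitions(2) _ horizontal(1), of i'] conj s
        by (auto simp: skew_def)
      then show False using s True horizontal(3) by (auto simp: skew_def)
    next
      case False
      then show False using \<alpha>_small[OF s(1)] s(2) horizontal(3) by auto
    qed
    then show ?thesis using True by (auto simp: snake_def content_diagonal_def)
  next
    case False
    have snake: "snake \<alpha> \<mu> k = {s \<in> skew \<alpha> \<mu>. \<exists>p\<ge>0. s = (?i - p, j - p) \<or> s = (?i - p, j - p - 1)}"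
      using False by (auto simp: snake_def horizontal(2))
    have "\<exists>p\<ge>0. (i', j') = (?i - p, j - p) \<or> (i', j') = (?i - p, j - p - 1)"
      if s: "(i', j') \<in> skew \<alpha> \<mu>" "j' - i' = k \<or> j' - i' = k + 1" for i' j'
    proof -
      have "i' \<le> ?i" using \<alpha>_small[OF s(1)] s(2) horizontal(3) by linarith
      then show ?thesis using s(2) horizontal(3) by (intro exI[of _ "?i - i'"]) auto
    qed
    then show ?thesis unfolding snake using horizontal(3)
      by (auto simp: content_diagonal_def)
  qed
qed

text \<open>The sizes of the two diagonals differ by
  \<open>of_bool (k \<in> A) - of_bool (k \<in> B)\<close>, and a sum has the parity of the
  difference.\<close>

lemma odd_card_snake_iff: "odd (card (snake \<alpha> \<mu> k)) \<longleftrightarrow> (k \<in> A) \<noteq> (k \<in> B)"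
proof -
  have "card (snake \<alpha> \<mu> k) = card (content_diagonal \<alpha> \<mu> k) + card (content_diagonal \<alpha> \<mu> (k + 1))"
    unfolding snake_eq by (rule card_Un_disjoint) (auto simp: content_diagonal_def[of _ _ "_ :: int"] finite_skew)
  then have "odd (card (snake \<alpha> \<mu> k)) \<longleftrightarrow>
      odd (int (card (content_diagonal \<alpha> \<mu> k)) - int (card (content_diagonal \<alpha> \<mu> (k + 1))))"
    by (simp add: even_of_nat_iff)
  then show ?thesis by (auto simp: card_content_diagonal_diff)
qed

lemma snake_length_iff:
  "0 \<le> snake_length \<alpha> \<mu> k \<and> even (snake_length \<alpha> \<mu> k) \<longleftrightarrow> (k \<in> A) \<noteq> (k \<in> B)"
proof -
  have "0 \<le> snake_length \<alpha> \<mu> k \<and> even (snake_length \<alpha> \<mu> k) \<longleftrightarrow> odd (card (snake \<alpha> \<mu> k))"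
    unfolding snake_length_def by (cases "card (snake \<alpha> \<mu> k)") auto
  then show ?thesis using odd_card_snake_iff by simp
qed

lemma left_snake_iff: "left_snake \<alpha> \<mu> k \<longleftrightarrow> k \<in> B - A"
  using snake_length_iff[of k] horizontal_path_step_iff[OF partitions(1), of k] B_ge[of k]
  by (auto simp: left_snake_def bead_set_\<alpha>)

lemma right_snake_iff: "right_snake \<alpha> \<mu> k \<longleftrightarrow> k \<in> A - B"
  using snake_length_iff[of k] horizontal_path_step_iff[OF partitions(1), of k] B_ge[of k]
  by (auto simp: right_snake_def bead_set_\<alpha>)

section \<open>The rank as a number of beads\<close>

lemma in_bead_setI: "1 \<le> i \<Longrightarrow> b i = k \<Longrightarrow> k \<in> bead_set \<mu>"
  by (auto simp: bead_set_def)

lemma b_mono: "1 \<le> i \<Longrightarrow> i \<le> i' \<Longrightarrow> b i' \<le> b i"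
  using bead_less[OF partitions(2), of i i'] by (cases "i = i'") auto

text \<open>Corners have no diagonal predecessor, so the corner belonging to a square is sought at
  the top of its content diagonal.\<close>

lemma top_square:
  assumes "(i, j) \<in> skew \<alpha> \<mu>"
  obtains i' p where "0 \<le> p" "i = i' + p" "(i', i' + (j - i)) \<in> skew \<alpha> \<mu>"
    "(i' - 1, i' + (j - i) - 1) \<notin> skew \<alpha> \<mu>"
proof -
  let ?S = "{i'. (i', i' + (j - i)) \<in> skew \<alpha> \<mu>}"
  have fin: "finite ?S"
  proof (rule finite_subset)
    show "?S \<subseteq> {1..n}"
    proof
      fix x assume "x \<in> ?S"
      then have "(x, x + (j - i)) \<in> skew \<alpha> \<mu>" by simp
      then show "x \<in> {1..n}" using in_skew_imp_le[of x "x + (j - i)"] by (simp add: in_skew_iff)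
    qed
  qed simp
  have i: "i \<in> ?S" using assms by simp
  have "Min ?S \<in> ?S" by (rule Min_in[OF fin]) (use i in blast)
  moreover have "Min ?S \<le> i" using fin i by (rule Min_le)
  moreover have "Min ?S - 1 \<notin> ?S" using Min_le[OF fin, of "Min ?S - 1"] by linarith
  moreover have "Min ?S - 1 + (j - i) = Min ?S + (j - i) - 1" by simp
  ultimately show ?thesis using that[of "i - Min ?S" "Min ?S"] unfolding mem_Collect_eq by simp
qed

text \<open>On the path of \<open>\<mu>\<close>, an outside corner of content \<open>k\<close> is a
  vertical step \<open>k - 1\<close>, its left edge, followed by a horizontal step \<open>k\<close>,
  its top edge; vertical steps are the members of \<open>bead_set \<mu>\<close>.\<close>

lemma outside_diagonals:
  "(\<Union>s\<in>outside_top_corners \<alpha> \<mu>. diagonal \<alpha> \<mu> s) =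
    {s \<in> skew \<alpha> \<mu>. snd s - fst s - 1 \<in> bead_set \<mu> \<and> snd s - fst s \<notin> bead_set \<mu>}"
proof (intro equalityI subsetI)
  fix s assume "s \<in> (\<Union>s\<in>outside_top_corners \<alpha> \<mu>. diagonal \<alpha> \<mu> s)"
  then obtain i j p where ij: "(i, j) \<in> skew \<alpha> \<mu>" "(i - 1, j) \<notin> skew \<alpha> \<mu>" "(i, j - 1) \<notin> skew \<alpha> \<mu>"
    and s: "s = (i + p, j + p)" "s \<in> skew \<alpha> \<mu>"
    by (auto simp: outside_top_corners_def)
  have "b i = j - i - 1" using ij(1,3) by (auto simp: in_skew_iff)
  moreover have "b i' \<noteq> j - i" if "1 \<le> i'" for i'
  proof (cases "i' < i")
    case True
    have "a i < a (i - 1)" using bead_less[OF partitions(1), of "i - 1" i] True that by simp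
    then have "j - (i - 1) \<le> b (i - 1)" using ij(1,2) True that by (auto simp: in_skew_iff)
    then show ?thesis using b_mono[of i' "i - 1"] True that by simp
  next
    case False
    then show ?thesis using b_mono[of i i'] ij(1) by (auto simp: in_skew_iff)
  qed
  then have "j - i \<notin> bead_set \<mu>" unfolding bead_set_def by (metis atLeast_iff imageE)
  ultimately show "s \<in> {s \<in> skew \<alpha> \<mu>. snd s - fst s - 1 \<in> bead_set \<mu> \<and> snd s - fst s \<notin> bead_set \<mu>}"
    using s ij(1) in_bead_setI[of i "j - i - 1"] by (simp add: in_skew_iff)
next
  fix s assume s: "s \<in> {s \<in> skew \<alpha> \<mu>. snd s - fst s - 1 \<in> bead_set \<mu> \<and> snd s - fst s \<notin> bead_set \<mu>}"
  obtain i0 j0 where s0: "s = (i0, j0)" by (cases s)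
  define k where "k = j0 - i0"
  have k: "(i0, j0) \<in> skew \<alpha> \<mu>" "k - 1 \<in> bead_set \<mu>" "k \<notin> bead_set \<mu>" using s s0 by (auto simp: k_def)
  obtain i p where i: "0 \<le> p" "i0 = i + p" "(i, i + k) \<in> skew \<alpha> \<mu>" "(i - 1, i + k - 1) \<notin> skew \<alpha> \<mu>"
    using top_square[OF k(1)] unfolding k_def by blast
  have i1: "1 \<le> i" "b i < k" "k \<le> a i" using i(3) by (auto simp: in_skew_iff)
  \<comment> \<open>The diagonal predecessor can only be missing on the side of
    \<open>\<mu>\<close>, because row \<open>i - 1\<close> of \<open>\<alpha>\<close> reaches past
    content \<open>k\<close>; equality is excluded since \<open>k\<close> is not a bead of
    \<open>\<mu>\<close>.\<close>
  have up: "k < b (i - 1)" if "i \<noteq> 1"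
  proof -
    have "a i < a (i - 1)" using bead_less[OF partitions(1), of "i - 1" i] i1 that by simp
    then have "k \<le> b (i - 1)" using i(4) i1 that by (auto simp: in_skew_iff)
    then show ?thesis using in_bead_setI[of "i - 1" k] k(3) i1 that by fastforce
  qed
  obtain i' where i': "1 \<le> i'" "b i' = k - 1" using k(2) by (auto simp: bead_set_def)
  have "b i = k - 1"
  proof (cases "i' < i")
    case True
    then show ?thesis using up b_mono[of i' "i - 1"] i' by auto
  next
    case False
    then show ?thesis using b_mono[of i i'] i1 i' by auto
  qed
  then have "(i, i + k) \<in> outside_top_corners \<alpha> \<mu>"
    using i up by (auto simp: outside_top_corners_def in_skew_iff)
  moreover have "s \<in> diagonal \<alpha> \<mu> (i, i + k)" using i k(1) s0 by (auto simp: k_def)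
  ultimately show "s \<in> (\<Union>s\<in>outside_top_corners \<alpha> \<mu>. diagonal \<alpha> \<mu> s)" by blast
qed

text \<open>Here step \<open>k - 1\<close> is horizontal and step \<open>k\<close> vertical: these
  are the lower and the right edge of the square \<open>(i - 1, j - 1)\<close>, a corner of
  \<open>\<mu>\<close>.\<close>

lemma inside_diagonals:
  "(\<Union>s\<in>inside_top_corners \<alpha> \<mu>. diagonal \<alpha> \<mu> s) =
    {s \<in> skew \<alpha> \<mu>. snd s - fst s - 1 \<notin> bead_set \<mu> \<and> snd s - fst s \<in> bead_set \<mu>}"
proof (intro equalityI subsetI)
  fix s assume "s \<in> (\<Union>s\<in>inside_top_corners \<alpha> \<mu>. diagonal \<alpha> \<mu> s)"
  then obtain i j p where ij: "(i, j) \<in> skew \<alpha> \<mu>" "(i - 1, j) \<in> skew \<alpha> \<mu>" "(i, j - 1) \<in> skew \<alpha> \<mu>"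
      "(i - 1, j - 1) \<notin> skew \<alpha> \<mu>"
    and s: "s = (i + p, j + p)" "s \<in> skew \<alpha> \<mu>"
    by (auto simp: inside_top_corners_def)
  have up: "b (i - 1) = j - i" using ij(2,4) by (auto simp: in_skew_iff)
  moreover have "b i' \<noteq> j - i - 1" if "1 \<le> i'" for i'
  proof (cases "i' < i")
    case True
    then show ?thesis using b_mono[of i' "i - 1"] up that by simp
  next
    case False
    then show ?thesis using b_mono[of i i'] ij(1,3) by (auto simp: in_skew_iff)
  qed
  then have "j - i - 1 \<notin> bead_set \<mu>" unfolding bead_set_def by (metis atLeast_iff imageE)
  ultimately show "s \<in> {s \<in> skew \<alpha> \<mu>. snd s - fst s - 1 \<notin> bead_set \<mu> \<and> snd s - fst s \<in> bead_set \<mu>}"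
    using s ij(2) in_bead_setI[of "i - 1" "j - i"] by (simp add: in_skew_iff)
next
  fix s assume s: "s \<in> {s \<in> skew \<alpha> \<mu>. snd s - fst s - 1 \<notin> bead_set \<mu> \<and> snd s - fst s \<in> bead_set \<mu>}"
  obtain i0 j0 where s0: "s = (i0, j0)" by (cases s)
  define k where "k = j0 - i0"
  have k: "(i0, j0) \<in> skew \<alpha> \<mu>" "k - 1 \<notin> bead_set \<mu>" "k \<in> bead_set \<mu>" using s s0 by (auto simp: k_def)
  obtain i p where i: "0 \<le> p" "i0 = i + p" "(i, i + k) \<in> skew \<alpha> \<mu>" "(i - 1, i + k - 1) \<notin> skew \<alpha> \<mu>"
    using top_square[OF k(1)] unfolding k_def by blast
  have i1: "1 \<le> i" "b i < k" "k \<le> a i" using i(3) by (auto simp: in_skew_iff)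
  have "b i < k - 1" using in_bead_setI[OF i1(1), of "k - 1"] k(2) i1 by fastforce
  obtain i' where i': "1 \<le> i'" "b i' = k" using k(3) by (auto simp: bead_set_def)
  have lt: "i' < i" using b_mono[of i i'] i1 i' by force
  have a_up: "a i < a (i - 1)" using bead_less[OF partitions(1), of "i - 1" i] i' lt by simp
  then have "k \<le> b (i - 1)" using i(4) i1 i' lt by (auto simp: in_skew_iff)
  then have "b (i - 1) = k" using b_mono[of i' "i - 1"] i' lt by simp
  then have "(i, i + k) \<in> inside_top_corners \<alpha> \<mu>"
    using i i1 i' lt a_up \<open>b i < k - 1\<close> by (auto simp: inside_top_corners_def in_skew_iff)
  moreover have "s \<in> diagonal \<alpha> \<mu> (i, i + k)" using i k(1) s0 by (auto simp: k_def)
  ultimately show "s \<in> (\<Union>s\<in>inside_top_corners \<alpha> \<mu>. diagonal \<alpha> \<mu> s)" by blast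
qed

text \<open>A square of content \<open>k\<close> counts as the difference of the bead indicators of
  \<open>\<mu>\<close> at \<open>k - 1\<close> and at \<open>k\<close>. Along row \<open>i\<close>
  this telescopes to the indicator at \<open>b i\<close>, which is 1, minus that at
  \<open>a i\<close>.\<close>

theorem skew_rank_eq: "skew_rank \<alpha> \<mu> = int (card (A - B))"
proof -
  let ?\<beta> = "\<lambda>k. of_bool (k \<in> bead_set \<mu>) :: int"
  have card_eq: "int (card {s \<in> skew \<alpha> \<mu>. P s}) = (\<Sum>s\<in>skew \<alpha> \<mu>. of_bool (P s))" for P
    by (simp add: finite_skew sum.If_cases of_bool_def Int_def)
  have "skew_rank \<alpha> \<mu> = (\<Sum>s\<in>skew \<alpha> \<mu>. ?\<beta> (snd s - fst s - 1) - ?\<beta> (snd s - fst s))"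
    unfolding skew_rank_def outside_diagonals inside_diagonals card_eq sum_subtractf[symmetric]
    by (rule sum.cong) auto
  also have "\<dots> = (\<Sum>(i, k)\<in>Sigma {1..n} (\<lambda>i. {b i<..a i}). ?\<beta> (k - 1) - ?\<beta> k)"
    unfolding skew_eq_bead_diagram bead_diagram_eq_image
    by (subst sum.reindex) (auto simp: inj_on_def case_prod_beta)
  also have "\<dots> = (\<Sum>i\<in>{1..n}. \<Sum>k\<in>{b i<..a i}. ?\<beta> (k - 1) - ?\<beta> k)"
    by (simp add: sum.Sigma)
  also have "\<dots> = (\<Sum>i\<in>{1..n}. of_bool (a i \<notin> B))"
  proof (rule sum.cong[OF refl])
    fix i assume i: "i \<in> {1..n}"
    have tele: "(\<Sum>k\<in>{l<..m}. ?\<beta> (k - 1) - ?\<beta> k) = ?\<beta> l - ?\<beta> m" if "l \<le> m" for l m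
      using that
    proof (induction m rule: int_ge_induct)
      case (step m)
      then have "{l<..m + 1} = insert (m + 1) {l<..m}" by auto
      then show ?case using step by simp
    qed simp
    have "b i \<in> bead_set \<mu>" using in_bead_setI[of i "b i"] i by simp
    moreover have "a i \<in> bead_set \<mu> \<longleftrightarrow> a i \<in> B" using a_ge[of i] i by (auto simp: bead_set_\<mu>)
    ultimately show "(\<Sum>k\<in>{b i<..a i}. ?\<beta> (k - 1) - ?\<beta> k) = of_bool (a i \<notin> B)"
      using tele[OF bead_le[OF subset, of i]] by simp
  qed
  also have "\<dots> = int (card {i \<in> {1..n}. a i \<notin> B})"
    by (simp add: sum.If_cases of_bool_def Int_def)
  also have "card {i \<in> {1..n}. a i \<notin> B} = card (a ` {i \<in> {1..n}. a i \<notin> B})"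
    by (rule card_image[symmetric]) (rule inj_on_subset[OF inj_a], auto)
  also have "a ` {i \<in> {1..n}. a i \<notin> B} = A - B" by (auto simp: A_def)
  finally show ?thesis .
qed

lemma card_A: "card A = length \<alpha>" and card_B: "card B = length \<alpha>"
  using card_image[OF inj_on_subset[OF inj_a, of "{1..n}"]]
    card_image[OF inj_on_subset[OF inj_b, of "{1..n}"]] by (simp_all add: A_def B_def)

text \<open>Containment puts each bead of \<open>\<mu>\<close> weakly below the bead of
  \<open>\<alpha>\<close> in the same row. Counted below a threshold, this is the ballot condition
  under which right endpoints can be matched to smaller left ones.\<close>

lemma card_A_less_le: "card (A \<inter> {..<k}) \<le> card (B \<inter> {..<k})"
proof -
  have eq: "card (c ` {1..n} \<inter> {..<k}) = card {i \<in> {1..n}. c i < k}" if "inj_on c {1..n}" for c :: "int \<Rightarrow> int"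
  proof -
    have "c ` {1..n} \<inter> {..<k} = c ` {i \<in> {1..n}. c i < k}" by auto
    then show ?thesis by (simp only:) (intro card_image inj_on_subset[OF that], auto)
  qed
  have "{i \<in> {1..n}. a i < k} \<subseteq> {i \<in> {1..n}. b i < k}"
    using bead_le[OF subset] le_less_trans by blast
  then have "card {i \<in> {1..n}. a i < k} \<le> card {i \<in> {1..n}. b i < k}"
    by (intro card_mono) auto
  then show ?thesis using eq[OF inj_on_subset[OF inj_a]] eq[OF inj_on_subset[OF inj_b]]
    by (simp add: A_def B_def)
qed

lemma card_diff_eq: "card (B - A) = card (A - B)"
  using card_A card_B by (simp add: card_Diff_subset_Int Int_commute)

lemma card_diff_less_le: "card ((A - B) \<inter> {..<k}) \<le> card ((B - A) \<inter> {..<k})"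
proof -
  have "card (X \<inter> {..<k}) = card ((X - Y) \<inter> {..<k}) + card (X \<inter> Y \<inter> {..<k})" if "finite X" for X Y
  proof -
    have eq: "X \<inter> {..<k} = ((X - Y) \<inter> {..<k}) \<union> (X \<inter> Y \<inter> {..<k})" by auto
    show ?thesis by (subst eq, rule card_Un_disjoint) (use that in auto)
  qed
  from this[of A B] this[of B A] show ?thesis using card_A_less_le[of k] by (simp add: Int_commute)
qed

end


section \<open>Noncrossing matchings\<close>

definition matchings :: "int set \<Rightarrow> int set \<Rightarrow> (int \<times> int) set set" where
  "matchings U V = {I. inj_on fst I \<and> inj_on snd I \<and> fst ` I = U \<and> snd ` I = V \<and>
     (\<forall>(u, v)\<in>I. u < v)}"

lemma finite_matching: "finite U \<Longrightarrow> I \<in> matchings U V \<Longrightarrow> finite I"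
  by (auto simp: matchings_def intro: finite_imageD)

lemma matchingD:
  assumes "I \<in> matchings U V" "(u, v) \<in> I"
  shows "u \<in> U" "v \<in> V" "u < v"
  using assms imageI[OF assms(2), of fst] imageI[OF assms(2), of snd] by (auto simp: matchings_def)

lemma crossing_number_eq_0_iff:
  assumes "finite I"
  shows "crossing_number I = 0 \<longleftrightarrow>
    (\<forall>u v u' v'. (u, v) \<in> I \<and> (u', v') \<in> I \<longrightarrow> \<not> (u < u' \<and> u' < v \<and> v < v'))"
proof -
  have "finite {((u, v), (u', v')). (u, v) \<in> I \<and> (u', v') \<in> I \<and> u < u' \<and> u' < v \<and> v < v'}"
    by (rule finite_subset[of _ "I \<times> I"]) (use assms in auto)
  then show ?thesis unfolding crossing_number_def by (simp only: card_0_eq Collect_empty_eq split_paired_All prod.case) blast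
qed

text \<open>The smallest right endpoint has to be matched with the largest left endpoint below it.\<close>

lemma noncrossing_matching_exists:
  assumes "finite U" "finite V" "U \<inter> V = {}" "card U = card V"
    and "\<And>k. card (V \<inter> {..<k}) \<le> card (U \<inter> {..<k})"
  shows "\<exists>I\<in>matchings U V. crossing_number I = 0"
  using assms
proof (induction "card V" arbitrary: U V)
  case 0
  then have "U = {}" "V = {}" by auto
  then have "{} \<in> matchings U V" by (simp add: matchings_def)
  moreover have "crossing_number {} = 0" by (simp add: crossing_number_eq_0_iff)
  ultimately show ?case by blast
next
  case (Suc m)
  note fin = Suc.prems(1,2) and disj = Suc.prems(3) and ballot = Suc.prems(5)
  define v where "v = Min V"
  have V: "V \<noteq> {}" using Suc.hyps(2) by auto
  have v: "v \<in> V" "\<And>x. x \<in> V \<Longrightarrow> v \<le> x" using fin V by (auto simp: v_def)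
  have "V \<inter> {..<v + 1} = {v}" using v by force
  then have "card (U \<inter> {..<v + 1}) \<noteq> 0" using ballot[of "v + 1"] by simp
  then obtain x where x: "x \<in> U" "x < v + 1" by (auto simp: card_eq_0_iff)
  then have "x < v" using disj v(1) by (cases "x = v") auto
  then have ne: "U \<inter> {..<v} \<noteq> {}" using x by blast
  define u where "u = Max (U \<inter> {..<v})"
  have "u \<in> U \<inter> {..<v}" using ne fin unfolding u_def by (intro Max_in) auto
  then have u: "u \<in> U" "u < v" by auto
  have u_max: "y \<le> u" if "y \<in> U" "y < v" for y
    using that fin unfolding u_def by (intro Max_ge) auto
  \<comment> \<open>The ballot condition survives the removal: up to \<open>v\<close> no other right
    endpoint exists, and beyond \<open>v\<close> both counts drop by one.\<close>
  have "card ((V - {v}) \<inter> {..<k}) \<le> card ((U - {u}) \<inter> {..<k})" for k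
  proof (cases "k \<le> v")
    case True
    then have "(V - {v}) \<inter> {..<k} = {}" using v by force
    then show ?thesis by simp
  next
    case False
    have "(V - {v}) \<inter> {..<k} = V \<inter> {..<k} - {v}" "(U - {u}) \<inter> {..<k} = U \<inter> {..<k} - {u}" by auto
    then show ?thesis using ballot[of k] False u v(1) by (simp add: card_Diff_singleton diff_le_mono)
  qed
  then have "\<exists>I\<in>matchings (U - {u}) (V - {v}). crossing_number I = 0"
    using Suc.hyps(2) Suc.prems u v by (intro Suc.hyps(1)) auto
  then obtain I where I: "I \<in> matchings (U - {u}) (V - {v})" "crossing_number I = 0" by blast
  have finI: "finite I" using finite_matching[OF _ I(1)] fin by simp
  have mem: "x \<in> U - {u} \<and> y \<in> V - {v}" if "(x, y) \<in> I" for x y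
    using matchingD[OF I(1) that] by simp
  have I': "inj_on fst I" "inj_on snd I" "fst ` I = U - {u}" "snd ` I = V - {v}"
    "\<forall>(x, y)\<in>I. x < y" using I(1) by (simp_all add: matchings_def)
  have "u \<notin> fst ` (I - {(u, v)})" "v \<notin> snd ` (I - {(u, v)})" using I'(3,4) by blast+
  then have "inj_on fst (insert (u, v) I)" "inj_on snd (insert (u, v) I)"
    using I'(1,2) by (simp_all only: inj_on_insert fst_conv snd_conv simp_thms)
  moreover have "fst ` insert (u, v) I = U"
    by (simp only: image_insert I'(3) fst_conv insert_Diff[OF u(1)])
  moreover have "snd ` insert (u, v) I = V"
    by (simp only: image_insert I'(4) snd_conv insert_Diff[OF v(1)])
  moreover have "\<forall>(x, y)\<in>insert (u, v) I. x < y" using I'(5) u(2) by simp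
  ultimately have "insert (u, v) I \<in> matchings U V"
    unfolding matchings_def by blast
  moreover have "crossing_number (insert (u, v) I) = 0"
  proof -
    have nc: "\<not> (x < x' \<and> x' < y \<and> y < y')" if "(x, y) \<in> I" "(x', y') \<in> I" for x y x' y'
      using I(2)[unfolded crossing_number_eq_0_iff[OF finI]] that by blast
    have right: "\<not> (u < x \<and> x < v)" if "(x, y) \<in> I" for x y
      using u_max[of x] mem[OF that] by auto
    have left: "\<not> y < v" if "(x, y) \<in> I" for x y
      using v(2)[of y] mem[OF that] by auto
    have "\<not> (x < x' \<and> x' < y \<and> y < y')"
      if xy: "(x, y) \<in> insert (u, v) I" "(x', y') \<in> insert (u, v) I" for x y x' y'
    proof (cases "(x, y) = (u, v)")
      case True
      then show ?thesis using right[of x' y'] xy(2) by auto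
    next
      case False
      then have "(x, y) \<in> I" using xy(1) by blast
      then show ?thesis using left[of x y] nc[of x y x' y'] xy(2) by auto
    qed
    then show ?thesis using finI by (subst crossing_number_eq_0_iff) auto
  qed
  ultimately show ?case by blast
qed

text \<open>No pair has just one endpoint strictly inside \<open>(u, v)\<close>, hence the balance.
  To the right of an inner left endpoint \<open>x\<close>, every left endpoint still brings its
  partner, and the partner of \<open>x\<close> itself is a surplus. Both counts involve only
  \<open>U\<close> and \<open>V\<close>, not the matching.\<close>

lemma noncrossing_inside:
  assumes I: "I \<in> matchings U V" "crossing_number I = 0" and fin: "finite U" "finite V"
    and uv: "(u, v) \<in> I"
  shows "card (U \<inter> {u<..<v}) = card (V \<inter> {u<..<v})"
    and "\<And>x. \<lbrakk>x \<in> U; u < x; x < v\<rbrakk> \<Longrightarrow> card (U \<inter> {x<..<v}) < card (V \<inter> {x<..<v})"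
proof -
  have finI: "finite I" by (rule finite_matching[OF fin(1) I(1)])
  have nc: "\<not> (x < x' \<and> x' < y \<and> y < y')" if "(x, y) \<in> I" "(x', y') \<in> I" for x y x' y'
    using I(2)[unfolded crossing_number_eq_0_iff[OF finI]] that by blast
  have inj: "inj_on fst I" "inj_on snd I" and im: "fst ` I = U" "snd ` I = V"
    and lt: "\<And>x y. (x, y) \<in> I \<Longrightarrow> x < y" using I(1) by (auto simp: matchings_def)
  have inj': "(x, y) \<in> I \<Longrightarrow> (x', y') \<in> I \<Longrightarrow> x = x' \<longleftrightarrow> y = y'" for x y x' y'
    using inj_onD[OF inj(1), of "(x, y)" "(x', y')"] inj_onD[OF inj(2), of "(x, y)" "(x', y')"] by auto
  have below: "y < v" if "(x, y) \<in> I" "u < x" "x < v" for x y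
    using nc[OF uv that(1)] inj'[OF uv that(1)] that by auto
  have left: "fst ` {s \<in> I. z < fst s \<and> fst s < v} = U \<inter> {z<..<v}" for z
    using im by force
  have right: "snd ` {s \<in> I. z < fst s \<and> fst s < v} \<subseteq> V \<inter> {z<..<v}" if "u \<le> z" for z
  proof
    fix y assume "y \<in> snd ` {s \<in> I. z < fst s \<and> fst s < v}"
    then obtain x where "(x, y) \<in> I" "z < x" "x < v" by auto
    then show "y \<in> V \<inter> {z<..<v}" using below[of x y] lt[of x y] that im by force
  qed
  have card_eq: "card (snd ` {s \<in> I. z < fst s \<and> fst s < v}) = card (U \<inter> {z<..<v})" for z
  proof -
    have "card (snd ` {s \<in> I. z < fst s \<and> fst s < v}) = card {s \<in> I. z < fst s \<and> fst s < v}"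
      by (rule card_image[OF inj_on_subset[OF inj(2)]]) auto
    also have "\<dots> = card (fst ` {s \<in> I. z < fst s \<and> fst s < v})"
      by (rule card_image[OF inj_on_subset[OF inj(1)], symmetric]) auto
    finally show ?thesis by (simp only: left)
  qed
  have "V \<inter> {u<..<v} \<subseteq> snd ` {s \<in> I. u < fst s \<and> fst s < v}"
  proof
    fix y assume y: "y \<in> V \<inter> {u<..<v}"
    then obtain x where x: "(x, y) \<in> I" using im by force
    then have "u < x" using nc[OF x uv] inj'[OF x uv] y by auto
    moreover have "x < v" using lt[OF x] y by auto
    ultimately show "y \<in> snd ` {s \<in> I. u < fst s \<and> fst s < v}" using x by force
  qed
  then have "snd ` {s \<in> I. u < fst s \<and> fst s < v} = V \<inter> {u<..<v}" using right[of u] by blast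
  then show "card (U \<inter> {u<..<v}) = card (V \<inter> {u<..<v})" using card_eq[of u] by simp
  fix x assume x: "x \<in> U" "u < x" "x < v"
  then obtain y where y: "(x, y) \<in> I" using im by force
  have "y \<notin> snd ` {s \<in> I. x < fst s \<and> fst s < v}" using inj'[OF y] by force
  moreover have "y \<in> V \<inter> {x<..<v}" using y below[of x y] lt[of x y] x im by force
  ultimately have "snd ` {s \<in> I. x < fst s \<and> fst s < v} \<subset> V \<inter> {x<..<v}" using right[of x] x by auto
  then have "card (snd ` {s \<in> I. x < fst s \<and> fst s < v}) < card (V \<inter> {x<..<v})"
    using fin by (intro psubset_card_mono) auto
  then show "card (U \<inter> {x<..<v}) < card (V \<inter> {x<..<v})" by (simp only: card_eq)
qed

text \<open>If \<open>v\<close> had partners \<open>u < u'\<close> in two noncrossing matchings, the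
  endpoints between \<open>u'\<close> and \<open>v\<close> would be balanced according to one and
  have a surplus of right endpoints according to the other.\<close>

lemma noncrossing_matching_unique:
  assumes "finite U" "finite V" and I: "I \<in> matchings U V" "crossing_number I = 0"
    and J: "J \<in> matchings U V" "crossing_number J = 0"
  shows "I = J"
proof -
  have sub: "I \<subseteq> J" if I: "I \<in> matchings U V" "crossing_number I = 0"
    and J: "J \<in> matchings U V" "crossing_number J = 0" for I J
  proof
    fix s assume "s \<in> I"
    moreover obtain u v where s: "s = (u, v)" by (cases s)
    ultimately have uv: "(u, v) \<in> I" by simp
    note u = matchingD[OF I(1) uv]
    then have "v \<in> snd ` J" using J(1) by (simp add: matchings_def)
    then obtain u' where u': "(u', v) \<in> J" by auto
    note u'_props = matchingD[OF J(1) u']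
    have "\<not> u < u'"
      using noncrossing_inside(2)[OF I assms(1,2) uv u'_props(1) _ u'_props(3)]
        noncrossing_inside(1)[OF J assms(1,2) u'] by auto
    moreover have "\<not> u' < u"
      using noncrossing_inside(2)[OF J assms(1,2) u' u(1) _ u(3)]
        noncrossing_inside(1)[OF I assms(1,2) uv] by auto
    ultimately have "u = u'" by simp
    then show "s \<in> J" using u' s by simp
  qed
  show ?thesis using sub[OF I J] sub[OF J I] by blast
qed

text \<open>Every factor is divisible by the polynomial variable; the lowest possible term of the
  product is the product of the linear terms.\<close>

lemma coeff_prod_no_constant:
  assumes "finite E" "\<And>i. i \<in> E \<Longrightarrow> coeff (f i) 0 = 0"
  shows "(\<forall>k<card E. coeff (prod f E) k = 0) \<and> coeff (prod f E) (card E) = (\<Prod>i\<in>E. coeff (f i) 1)"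
  using assms
proof (induction E rule: finite_induct)
  case (insert x E)
  obtain c g where "f x = pCons c g" by (cases "f x")
  then have g: "f x = pCons 0 g" using insert.prems[of x] by simp
  let ?P = "prod f E"
  have P: "\<forall>k<card E. coeff ?P k = 0" "coeff ?P (card E) = (\<Prod>i\<in>E. coeff (f i) 1)"
    using insert by auto
  have prod: "prod f (insert x E) = pCons 0 (g * ?P)" using insert g by simp
  have "coeff (prod f (insert x E)) k = 0" if "k < card (insert x E)" for k
  proof (cases k)
    case (Suc l)
    then have "coeff (g * ?P) l = 0" using P(1) that insert by (simp add: coeff_mult)
    then show ?thesis unfolding prod Suc by simp
  qed (simp add: prod)
  moreover have "coeff (g * ?P) (card E) = coeff g 0 * coeff ?P (card E)"
  proof -
    have "coeff (g * ?P) (card E) = (\<Sum>i\<le>card E. if i = 0 then coeff g 0 * coeff ?P (card E) else 0)"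
      unfolding coeff_mult using P(1) by (intro sum.cong) auto
    then show ?thesis by simp
  qed
  then have "coeff (prod f (insert x E)) (card (insert x E)) = (\<Prod>i\<in>insert x E. coeff (f i) 1)"
    unfolding prod using insert g P(2) by simp
  ultimately show ?case by blast
qed simp

section \<open>Interval sets as matchings of beads\<close>

context skew_shape
begin

text \<open>There are exactly as many left snakes and as many right snakes as the rank, so distinct
  endpoints of that number use up all of them.\<close>

lemma interval_sets_eq: "interval_sets \<alpha> \<mu> = matchings (B - A) (A - B)"
proof (intro equalityI subsetI)
  fix I assume "I \<in> interval_sets \<alpha> \<mu>"
  then have I: "finite I" "card I = card (A - B)" "inj_on fst I" "inj_on snd I"
    "\<forall>(u, v)\<in>I. u < v \<and> u \<in> B - A \<and> v \<in> A - B"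
    unfolding interval_sets_def left_snake_iff right_snake_iff skew_rank_eq by simp_all
  have "fst ` I = B - A"
    by (rule card_subset_eq) (use I card_diff_eq card_image[OF I(3)] in auto)
  moreover have "snd ` I = A - B"
    by (rule card_subset_eq) (use I card_image[OF I(4)] in auto)
  ultimately show "I \<in> matchings (B - A) (A - B)" using I by (auto simp: matchings_def)
next
  fix I assume I: "I \<in> matchings (B - A) (A - B)"
  then have "finite I" by (intro finite_matching[of "B - A"]) auto
  moreover have "card I = card (A - B)"
    using I card_image[of snd I] by (simp add: matchings_def)
  moreover have "u \<in> B - A" "v \<in> A - B" "u < v" if "(u, v) \<in> I" for u v
    using I that by (force simp: matchings_def)+
  ultimately show "I \<in> interval_sets \<alpha> \<mu>" using I
    unfolding interval_sets_def left_snake_iff right_snake_iff skew_rank_eq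
    by (auto simp: matchings_def)
qed

lemma noncrossing_interval_set: "noncrossing_interval_set \<alpha> \<mu> \<in> matchings (B - A) (A - B)"
proof -
  have "\<exists>I\<in>matchings (B - A) (A - B). crossing_number I = 0"
    by (rule noncrossing_matching_exists) (use card_diff_eq card_diff_less_le in auto)
  then have "\<exists>!I. I \<in> matchings (B - A) (A - B) \<and> crossing_number I = 0"
    using noncrossing_matching_unique[of "B - A" "A - B"] by auto
  from theI'[OF this] show ?thesis
    unfolding noncrossing_interval_set_def interval_sets_eq by simp
qed

text \<open>
  Adding the number of beads below an endpoint over all right endpoints and subtracting the same for
  the left ones shows that this sum does not depend on the matching.
\<close>

lemma sum_beads_inside_eq:
  assumes I: "I \<in> matchings (B - A) (A - B)"
  shows "int (\<Sum>(u, v)\<in>I. card (A \<inter> {u<..<v})) =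
    (\<Sum>v\<in>A - B. int (card (A \<inter> {..<v}))) - (\<Sum>u\<in>B - A. int (card (A \<inter> {..<u})))"
proof -
  have I': "inj_on fst I" "inj_on snd I" "fst ` I = B - A" "snd ` I = A - B"
    "\<And>u v. (u, v) \<in> I \<Longrightarrow> u < v" using I by (auto simp: matchings_def)
  have "int (card (A \<inter> {u<..<v})) = int (card (A \<inter> {..<v})) - int (card (A \<inter> {..<u}))"
    if uv: "(u, v) \<in> I" for u v
  proof -
    have "u \<notin> A" using I'(3) uv by force
    then have eq: "A \<inter> {..<v} = (A \<inter> {..<u}) \<union> (A \<inter> {u<..<v})"
      using I'(5)[OF uv] by (auto simp: not_less order.order_iff_strict)
    have "card (A \<inter> {..<v}) = card (A \<inter> {..<u}) + card (A \<inter> {u<..<v})"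
      by (subst eq, rule card_Un_disjoint) auto
    then show ?thesis by simp
  qed
  then have "int (\<Sum>(u, v)\<in>I. card (A \<inter> {u<..<v})) =
      (\<Sum>s\<in>I. int (card (A \<inter> {..<snd s})) - int (card (A \<inter> {..<fst s})))"
    unfolding of_nat_sum by (intro sum.cong) auto
  also have "\<dots> = (\<Sum>v\<in>snd ` I. int (card (A \<inter> {..<v}))) - (\<Sum>u\<in>fst ` I. int (card (A \<inter> {..<u})))"
    using I'(1,2) by (simp add: sum_subtractf sum.reindex)
  finally show ?thesis by (simp only: I')
qed

text \<open>Steps with code 0 are beads of \<open>\<alpha>\<close>, and the number of beads inside
  the intervals is the same for every matching, so the noncrossing one may be exchanged for
  \<open>I\<close>.\<close>

lemma skew_z_eq:
  assumes I: "I \<in> matchings (B - A) (A - B)"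
  shows "skew_z \<alpha> \<mu> = (\<Sum>(u, v)\<in>I. card (A \<inter> {u<..<v}))"
proof -
  let ?P = "noncrossing_interval_set \<alpha> \<mu>"
  have "{j. u < j \<and> j < v \<and> code \<alpha> j = 0} = A \<inter> {u<..<v}" if "(u, v) \<in> ?P" for u v
  proof -
    \<comment> \<open>Members of \<open>B\<close> are at least \<open>- n\<close>, so the infinite
      tail of beads stays outside every interval.\<close>
    have "u \<in> B" using noncrossing_interval_set that by (force simp: matchings_def)
    then show ?thesis using B_ge[of u]
      by (auto simp: code_eq_0_iff[OF partitions(1)] bead_set_\<alpha>)
  qed
  then have "skew_z \<alpha> \<mu> = (\<Sum>(u, v)\<in>?P. card (A \<inter> {u<..<v}))"
    unfolding skew_z_def by (intro sum.cong) auto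
  then have "int (skew_z \<alpha> \<mu>) = int (\<Sum>(u, v)\<in>I. card (A \<inter> {u<..<v}))"
    using sum_beads_inside_eq[OF I] sum_beads_inside_eq[OF noncrossing_interval_set] by simp
  then show ?thesis by (simp only: of_nat_eq_iff)
qed

section \<open>Permutations of lowest degree and their matchings\<close>

definition matching_perms :: "(int \<Rightarrow> int) set" where
  "matching_perms = {p. p permutes {1..n} \<and>
     (\<forall>i\<in>{1..n}. if a i \<in> B then b (p i) = a i else b (p i) < a i)}"

text \<open>A permutation stands for the bijection from \<open>A\<close> to \<open>B\<close> taking
  \<open>a i\<close> to \<open>b (p i)\<close>; a moved bead is the right endpoint of its interval
  and its image the left endpoint.\<close>

definition perm_matching :: "(int \<Rightarrow> int) \<Rightarrow> (int \<times> int) set" where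
  "perm_matching p = (\<lambda>i. (b (p i), a i)) ` {i \<in> {1..n}. a i \<notin> B}"

lemma a_less_iff: "i \<in> {1..n} \<Longrightarrow> j \<in> {1..n} \<Longrightarrow> a i < a j \<longleftrightarrow> j < i"
  using bead_less[OF partitions(1), of i j] bead_less[OF partitions(1), of j i]
  by (cases i j rule: linorder_cases) auto

lemma b_less_iff: "i \<in> {1..n} \<Longrightarrow> j \<in> {1..n} \<Longrightarrow> b i < b j \<longleftrightarrow> j < i"
  using bead_less[OF partitions(2), of i j] bead_less[OF partitions(2), of j i]
  by (cases i j rule: linorder_cases) auto

lemma a_eq_iff: "i \<in> {1..n} \<Longrightarrow> j \<in> {1..n} \<Longrightarrow> a i = a j \<longleftrightarrow> i = j"
  using inj_a by (auto dest: inj_onD)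

lemma b_eq_iff: "i \<in> {1..n} \<Longrightarrow> j \<in> {1..n} \<Longrightarrow> b i = b j \<longleftrightarrow> i = j"
  using inj_b by (auto dest: inj_onD)

lemma matching_permsD:
  assumes "p \<in> matching_perms"
  shows "p permutes {1..n}" "\<And>i. i \<in> {1..n} \<Longrightarrow> p i \<in> {1..n}"
    "\<And>i. i \<in> {1..n} \<Longrightarrow> a i \<in> B \<Longrightarrow> b (p i) = a i"
    "\<And>i. i \<in> {1..n} \<Longrightarrow> a i \<notin> B \<Longrightarrow> b (p i) < a i"
    "\<And>i. i \<in> {1..n} \<Longrightarrow> b (p i) \<le> a i"
    "\<And>i j. i \<in> {1..n} \<Longrightarrow> j \<in> {1..n} \<Longrightarrow> p i = p j \<longleftrightarrow> i = j"
proof -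
  show p: "p permutes {1..n}" using assms by (simp add: matching_perms_def)
  show *: "\<And>i. i \<in> {1..n} \<Longrightarrow> a i \<in> B \<Longrightarrow> b (p i) = a i"
    "\<And>i. i \<in> {1..n} \<Longrightarrow> a i \<notin> B \<Longrightarrow> b (p i) < a i"
    using assms unfolding matching_perms_def by (metis (mono_tags, lifting) mem_Collect_eq)+
  show "\<And>i. i \<in> {1..n} \<Longrightarrow> b (p i) \<le> a i" using * by (metis less_imp_le order_refl)
  show "\<And>i. i \<in> {1..n} \<Longrightarrow> p i \<in> {1..n}" using permutes_in_image[OF p] by blast
  show "\<And>i j. i \<in> {1..n} \<Longrightarrow> j \<in> {1..n} \<Longrightarrow> p i = p j \<longleftrightarrow> i = j"
    using permutes_inj[OF p] by (simp add: inj_eq)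
qed

lemma perm_matching_in_matchings:
  assumes "p \<in> matching_perms"
  shows "perm_matching p \<in> matchings (B - A) (A - B)"
proof -
  note p = matching_permsD[OF assms]
  have snd: "snd ` perm_matching p = A - B" by (auto simp: perm_matching_def A_def image_image)
  have fst: "fst ` perm_matching p = B - A"
  proof (intro equalityI subsetI)
    fix x assume "x \<in> fst ` perm_matching p"
    then obtain i where i: "i \<in> {1..n}" "a i \<notin> B" "x = b (p i)" by (auto simp: perm_matching_def)
    \<comment> \<open>A left endpoint in \<open>A\<close> would be a common bead, hence also the
      image of itself, and injectivity would identify it with \<open>a i\<close>, which is not in
      \<open>B\<close>.\<close>
    have "x \<notin> A"
    proof
      assume "x \<in> A"
      then obtain j where j: "j \<in> {1..n}" "x = a j" by (auto simp: A_def)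
      have "x \<in> B" using i p(2) by (auto simp: B_def)
      then have "b (p j) = b (p i)" using p(3)[of j] i j by simp
      then have "i = j" using p(2,6) i j b_eq_iff by metis
      then show False using i j \<open>x \<in> B\<close> by simp
    qed
    then show "x \<in> B - A" using i p(2) by (auto simp: B_def)
  next
    fix x assume x: "x \<in> B - A"
    then obtain j where j: "j \<in> {1..n}" "x = b j" by (auto simp: B_def)
    obtain i where i: "i \<in> {1..n}" "j = p i"
      using permutes_image[OF p(1)] j(1) by (metis imageE)
    have "a i \<notin> B" using p(3)[OF i(1)] x i j by (auto simp: A_def)
    then show "x \<in> fst ` perm_matching p" using i j by (force simp: perm_matching_def)
  qed
  have "inj_on fst (perm_matching p)" "inj_on snd (perm_matching p)"
    using p(2,6) a_eq_iff b_eq_iff by (auto simp: perm_matching_def inj_on_def)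
  then show ?thesis using fst snd p(4) by (auto simp: matchings_def perm_matching_def)
qed

lemma inj_on_perm_matching: "inj_on perm_matching matching_perms"
proof (rule inj_onI)
  fix p q assume p: "p \<in> matching_perms" and q: "q \<in> matching_perms"
    and eq: "perm_matching p = perm_matching q"
  note P = matching_permsD[OF p] and Q = matching_permsD[OF q]
  show "p = q"
  proof
    fix i
    show "p i = q i"
    proof (cases "i \<in> {1..n}")
      case True
      have "b (p i) = b (q i)"
      proof (cases "a i \<in> B")
        case False
        then have "(b (p i), a i) \<in> perm_matching p"
          using True unfolding perm_matching_def by blast
        then have "(b (p i), a i) \<in> perm_matching q" by (simp only: eq)
        then obtain j where "j \<in> {1..n}" "b (p i) = b (q j)" "a i = a j"
          by (auto simp: perm_matching_def)
        then show ?thesis using a_eq_iff[OF True] by simp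
      qed (use P(3) Q(3) True in simp)
      then show ?thesis using b_eq_iff P(2) Q(2) True by blast
    qed (use P(1) Q(1) permutes_not_in in metis)
  qed
qed

lemma perm_matching_surj:
  assumes I: "I \<in> matchings (B - A) (A - B)"
  shows "I \<in> perm_matching ` matching_perms"
proof -
  have I': "bij_betw fst I (B - A)" "bij_betw snd I (A - B)"
    and lt: "\<And>u v. (u, v) \<in> I \<Longrightarrow> u < v" using I by (auto simp: matchings_def bij_betw_def)
  define h where "h = fst \<circ> inv_into I snd"
  have h: "bij_betw h (A - B) (B - A)"
    unfolding h_def using bij_betw_inv_into[OF I'(2)] I'(1) by (rule bij_betw_trans)
  have hI: "(h v, v) \<in> I" if "v \<in> A - B" for v
  proof -
    have "v \<in> snd ` I" using that I'(2) by (simp add: bij_betw_def)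
    then have "inv_into I snd v \<in> I" "snd (inv_into I snd v) = v"
      by (simp_all add: inv_into_into f_inv_into_f)
    then show ?thesis by (metis comp_apply h_def prod.collapse)
  qed
  \<comment> \<open>The matching, read from right to left endpoints and completed by the identity on
    common beads, is a bijection of \<open>A\<close> onto \<open>B\<close>; the enumerations
    \<open>a\<close> and \<open>b\<close> turn it into \<open>p\<close>.\<close>
  define g where "g = (\<lambda>x. if x \<in> B then x else h x)"
  have "bij_betw g (A \<inter> B) (A \<inter> B)" by (auto simp: g_def bij_betw_def inj_on_def)
  moreover have "bij_betw g (A - B) (B - A)"
    using h by (subst bij_betw_cong[of _ _ h]) (auto simp: g_def)
  ultimately have "bij_betw g ((A \<inter> B) \<union> (A - B)) ((A \<inter> B) \<union> (B - A))"
    by (rule bij_betw_combine) auto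
  moreover have "(A \<inter> B) \<union> (A - B) = A" "(A \<inter> B) \<union> (B - A) = B" by auto
  ultimately have g: "bij_betw g A B" by simp
  have a: "bij_betw a {1..n} A" and b: "bij_betw b {1..n} B"
    using inj_on_subset[OF inj_a, of "{1..n}"] inj_on_subset[OF inj_b, of "{1..n}"]
    by (auto simp: A_def B_def bij_betw_def)
  define p where "p = (\<lambda>i. if i \<in> {1..n} then inv_into {1..n} b (g (a i)) else i)"
  have "bij_betw (inv_into {1..n} b \<circ> (g \<circ> a)) {1..n} {1..n}"
    using bij_betw_trans[OF bij_betw_trans[OF a g] bij_betw_inv_into[OF b]] .
  then have "bij_betw p {1..n} {1..n}" by (subst bij_betw_cong) (auto simp: p_def)
  then have perm: "p permutes {1..n}" by (rule bij_imp_permutes) (auto simp: p_def)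
  have bp: "b (p i) = g (a i)" if i: "i \<in> {1..n}" for i
  proof -
    have "g (a i) \<in> b ` {1..n}" using bij_betw_apply[OF g] bij_betw_apply[OF a i] by (simp add: B_def)
    then show ?thesis using i by (simp add: p_def f_inv_into_f)
  qed
  have "p \<in> matching_perms"
    unfolding matching_perms_def using perm bp lt hI by (auto simp: g_def A_def)
  moreover have "perm_matching p = I"
  proof -
    have sub: "perm_matching p \<subseteq> I"
      using bp hI by (auto simp: perm_matching_def g_def A_def)
    have snd: "snd ` perm_matching p = snd ` I"
      using I'(2) by (auto simp: perm_matching_def A_def image_image bij_betw_def)
    have "s \<in> perm_matching p" if s: "s \<in> I" for s
    proof -
      obtain t where t: "t \<in> perm_matching p" "snd t = snd s" using snd s by (metis imageE imageI)
      then have "t = s" using sub s I'(2) by (auto simp: bij_betw_def dest: inj_onD)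
      then show ?thesis using t by simp
    qed
    then show ?thesis using sub by blast
  qed
  ultimately show ?thesis by blast
qed

text \<open>
  Pairs \<open>(i, j)\<close> for which \<open>a j\<close> lies inside the interval ending at \<open>a i\<close> are the inversions if
  the interval or bead at \<open>a j\<close> starts inside too, and the crossings otherwise.
\<close>

lemma inversions_plus_crossings:
  assumes "p \<in> matching_perms"
  shows "card (inversions n p) + crossing_number (perm_matching p) =
    (\<Sum>(u, v)\<in>perm_matching p. card (A \<inter> {u<..<v}))"
proof -
  note p = matching_permsD[OF assms]
  let ?R = "{i \<in> {1..n}. a i \<notin> B}"
  let ?T = "Sigma ?R (\<lambda>i. {j \<in> {1..n}. b (p i) < a j \<and> a j < a i})"
  let ?X = "{(i, j) \<in> ?T. b (p j) < b (p i)}"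
  have ord: "i < j \<longleftrightarrow> a j < a i" "p j < p i \<longleftrightarrow> b (p i) < b (p j)"
    if "i \<in> {1..n}" "j \<in> {1..n}" for i j
    using that a_less_iff b_less_iff p(2) by auto
  have inv: "inversions n p = {(i, j) \<in> ?T. b (p i) < b (p j)}"
  proof -
    have "(i, j) \<in> inversions n p \<longleftrightarrow> (i, j) \<in> ?T \<and> b (p i) < b (p j)" for i j
    proof -
      have "(i, j) \<in> inversions n p \<longleftrightarrow>
          i \<in> {1..n} \<and> j \<in> {1..n} \<and> a j < a i \<and> b (p i) < b (p j)"
      proof (cases "i \<in> {1..n} \<and> j \<in> {1..n}")
        case True
        then show ?thesis using ord[of i j] by (auto simp: inversions_def)
      next
        case False
        then show ?thesis by (auto simp: inversions_def)
      qed
      \<comment> \<open>An inversion belongs to \<open>?T\<close> automatically: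
        \<open>b (p i) < b (p j) \<le> a j < a i\<close> shows that bead \<open>a i\<close> moves
        and that \<open>a j\<close> lies inside its interval.\<close>
      moreover have "a i \<notin> B \<and> b (p i) < a j"
        if "i \<in> {1..n}" "j \<in> {1..n}" "a j < a i" "b (p i) < b (p j)"
        using p(3)[of i] p(5)[of j] that by fastforce
      ultimately show ?thesis by auto
    qed
    then show ?thesis by auto
  qed
  have cross: "crossing_number (perm_matching p) = card ?X"
  proof -
    let ?f = "\<lambda>(i, j). ((b (p j), a j), (b (p i), a i))"
    have "{((u, v), (u', v')). (u, v) \<in> perm_matching p \<and> (u', v') \<in> perm_matching p \<and>
        u < u' \<and> u' < v \<and> v < v'} = ?f ` ?X"
    proof (intro equalityI subsetI)
      fix s assume "s \<in> {((u, v), (u', v')). (u, v) \<in> perm_matching p \<and> (u', v') \<in> perm_matching p \<and>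
        u < u' \<and> u' < v \<and> v < v'}"
      then obtain i j where "i \<in> ?R" "j \<in> ?R" "s = ?f (i, j)" "b (p j) < b (p i)" "b (p i) < a j" "a j < a i"
        by (auto simp: perm_matching_def)
      then show "s \<in> ?f ` ?X" by (intro image_eqI[of _ _ "(i, j)"]) auto
    next
      fix s assume "s \<in> ?f ` ?X"
      then obtain i j where ij: "i \<in> ?R" "j \<in> {1..n}" "b (p j) < b (p i)" "b (p i) < a j" "a j < a i"
        "s = ?f (i, j)" by auto
      \<comment> \<open>A common bead \<open>a j\<close> would have \<open>b (p j) = a j\<close>,
        which exceeds \<open>b (p i)\<close>; so \<open>j\<close> really gives an interval and the
        pair a crossing.\<close>
      then have "a j \<notin> B" using p(3)[of j] by force
      then show "s \<in> {((u, v), (u', v')). (u, v) \<in> perm_matching p \<and> (u', v') \<in> perm_matching p \<and>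
        u < u' \<and> u' < v \<and> v < v'}" using ij by (auto simp: perm_matching_def)
    qed
    moreover have "inj_on ?f ?X" using a_eq_iff by (auto simp: inj_on_def)
    ultimately show ?thesis unfolding crossing_number_def by (simp only: card_image)
  qed
  have fin: "finite ?T" by simp
  have ne: "b (p i) \<noteq> b (p j)" if "(i, j) \<in> ?T" for i j
    using that p(2)[of i] p(2)[of j] p(6)[of i j] b_eq_iff[of "p i" "p j"] by auto
  have T: "?T = {(i, j) \<in> ?T. b (p i) < b (p j)} \<union> ?X"
    using ne by (auto simp: neq_iff)
  have "card (inversions n p) + card ?X = card ?T"
    unfolding inv by (subst (3) T, rule card_Un_disjoint[symmetric]) (use fin in \<open>auto intro: finite_subset[OF _ fin]\<close>)
  also have "\<dots> = (\<Sum>i\<in>?R. card {j \<in> {1..n}. b (p i) < a j \<and> a j < a i})" by simp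
  also have "\<dots> = (\<Sum>i\<in>?R. card (A \<inter> {b (p i)<..<a i}))"
  proof (rule sum.cong[OF refl])
    fix i
    have "A \<inter> {b (p i)<..<a i} = a ` {j \<in> {1..n}. b (p i) < a j \<and> a j < a i}" by (auto simp: A_def)
    then show "card {j \<in> {1..n}. b (p i) < a j \<and> a j < a i} = card (A \<inter> {b (p i)<..<a i})"
      by (simp only:) (intro card_image[symmetric] inj_on_subset[OF inj_a], auto)
  qed
  also have "\<dots> = (\<Sum>(u, v)\<in>perm_matching p. card (A \<inter> {u<..<v}))"
    unfolding perm_matching_def using a_eq_iff by (subst sum.reindex) (auto simp: inj_on_def)
  finally show ?thesis using cross by simp
qed

section \<open>The coefficient in degree equal to the rank\<close>

lemma coeff_prod_graded_hsym:
  assumes p: "p permutes {1..n}"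
  shows "coeff (\<Prod>i\<in>{1..n}. graded_hsym (a i - b (p i))) (card (A - B)) =
    (if p \<in> matching_perms then \<Prod>(u, v)\<in>perm_matching p. power_sum_tilde (nat (v - u)) else 0)"
proof (cases "\<exists>i\<in>{1..n}. a i < b (p i)")
  case True
  then obtain i where i: "i \<in> {1..n}" "a i < b (p i)" by blast
  then have "(\<Prod>i\<in>{1..n}. graded_hsym (a i - b (p i))) = 0"
    by (intro prod_zero) (auto simp: graded_hsym_def)
  moreover have "p \<notin> matching_perms" using matching_permsD(5)[of p i] i by auto
  ultimately show ?thesis by simp
next
  case False
  then have ge: "b (p i) \<le> a i" if "i \<in> {1..n}" for i using that by (auto simp: not_less)
  let ?f = "\<lambda>i. graded_hsym (a i - b (p i))"
  \<comment> \<open>\<open>?R\<close> collects the rows whose bead must move, \<open>?E\<close>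
    those whose bead does move. The product starts in degree \<open>card ?E\<close>, which equals
    the rank \<open>card ?R\<close> exactly for the matching permutations.\<close>
  let ?R = "{i \<in> {1..n}. a i \<notin> B}"
  let ?E = "{i \<in> {1..n}. b (p i) < a i}"
  have R: "card ?R = card (A - B)"
  proof -
    have "A - B = a ` ?R" by (auto simp: A_def)
    then show ?thesis by (simp only:) (intro card_image[symmetric] inj_on_subset[OF inj_a], auto)
  qed
  have "b (p i) \<noteq> a i" if "i \<in> ?R" for i
  proof -
    have "p i \<in> {1..n}" using permutes_in_image[OF p, of i] that by auto
    then have "b (p i) \<in> B" by (auto simp: B_def)
    then show ?thesis using that by auto
  qed
  then have RE: "?R \<subseteq> ?E" using ge by (auto simp: order.order_iff_strict)
  have prod: "(\<Prod>i\<in>{1..n}. ?f i) = (\<Prod>i\<in>?E. ?f i)"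
  proof (rule prod.mono_neutral_right)
    show "\<forall>i\<in>{1..n} - ?E. ?f i = 1"
    proof
      fix i assume "i \<in> {1..n} - ?E"
      then have "a i - b (p i) = 0" using ge[of i] by auto
      then show "?f i = 1" by (simp add: graded_hsym_def)
    qed
  qed auto
  have "coeff (?f i) 0 = 0" if "i \<in> ?E" for i
    using that by (simp add: graded_hsym_def coeff_graded_hsym_nat_0)
  then have coeff: "\<forall>k<card ?E. coeff (prod ?f ?E) k = 0"
    "coeff (prod ?f ?E) (card ?E) = (\<Prod>i\<in>?E. coeff (?f i) 1)"
    using coeff_prod_no_constant[of ?E ?f] by auto
  show ?thesis
  proof (cases "p \<in> matching_perms")
    case True
    have "?E = ?R" using RE matching_permsD(3)[OF True] by fastforce
    then have "coeff (prod ?f {1..n}) (card (A - B)) = (\<Prod>i\<in>?R. coeff (?f i) 1)"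
      using coeff(2) R prod by simp
    also have "\<dots> = (\<Prod>i\<in>?R. power_sum_tilde (nat (a i - b (p i))))"
    proof (rule prod.cong[OF refl])
      fix i assume "i \<in> ?R"
      then have "b (p i) < a i" using RE by blast
      then show "coeff (?f i) 1 = power_sum_tilde (nat (a i - b (p i)))"
        by (simp add: graded_hsym_def coeff_graded_hsym_nat_1[unfolded One_nat_def])
    qed
    also have "\<dots> = (\<Prod>(u, v)\<in>perm_matching p. power_sum_tilde (nat (v - u)))"
      unfolding perm_matching_def using a_eq_iff by (subst prod.reindex) (auto simp: inj_on_def)
    finally show ?thesis using True by simp
  next
    case False
    then obtain i where i: "i \<in> {1..n}" "\<not> (if a i \<in> B then b (p i) = a i else b (p i) < a i)"
      using p unfolding matching_perms_def by blast
    have "a i \<in> B"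
    proof (rule ccontr)
      assume "a i \<notin> B"
      then have "i \<in> ?E" using RE i(1) by blast
      then show False using i(2) \<open>a i \<notin> B\<close> by simp
    qed
    then have "i \<in> ?E - ?R" using ge[OF i(1)] i by simp
    then have "?R \<subset> ?E" using RE by blast
    then have "card ?R < card ?E" by (intro psubset_card_mono) auto
    then show ?thesis using False coeff(1) R prod by simp
  qed
qed

theorem skew_schur_hat_expansion:
  "skew_schur_hat \<alpha> \<mu> (card (A - B)) =
    (- 1) ^ skew_z \<alpha> \<mu> *
      (\<Sum>I\<in>interval_sets \<alpha> \<mu>.
         (- 1) ^ crossing_number I * (\<Prod>(u, v)\<in>I. power_sum_tilde (nat (v - u))))"
proof -
  let ?w = "\<lambda>I. \<Prod>(u, v)\<in>I. power_sum_tilde (nat (v - u))"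
  have fin: "finite {p. p permutes {1..n}}" by (simp add: finite_permutations)
  have coeff_sign: "coeff ((- 1) ^ k * f) m = (- 1) ^ k * coeff f m" for k m and f :: "rat mpser poly"
    by (induction k) simp_all
  have "skew_schur_hat \<alpha> \<mu> (card (A - B)) =
      (\<Sum>p | p permutes {1..n}. (- 1) ^ card (inversions n p) *
        (if p \<in> matching_perms then ?w (perm_matching p) else 0))"
    unfolding skew_schur_hat_eq_coeff[OF partitions subset] perm_det_def coeff_sum coeff_sign
    by (intro sum.cong refl) (simp add: coeff_prod_graded_hsym)
  also have "\<dots> = (\<Sum>p\<in>matching_perms. (- 1) ^ card (inversions n p) * ?w (perm_matching p))"
    by (rule sum.mono_neutral_cong_right[OF fin]) (auto simp: matching_perms_def)
  also have "\<dots> = (\<Sum>p\<in>matching_perms.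
      (- 1) ^ skew_z \<alpha> \<mu> * ((- 1) ^ crossing_number (perm_matching p) * ?w (perm_matching p)))"
  proof (rule sum.cong[OF refl])
    fix p assume p: "p \<in> matching_perms"
    \<comment> \<open>Since inversions and crossings add up to \<open>skew_z\<close>, the inversion
      sign is the sign of \<open>skew_z\<close> times the crossing sign: the crossing sign then
      appears twice and squares to 1.\<close>
    have z: "skew_z \<alpha> \<mu> = card (inversions n p) + crossing_number (perm_matching p)"
      using inversions_plus_crossings[OF p] skew_z_eq[OF perm_matching_in_matchings[OF p]] by simp
    have "(- 1) ^ c * (- 1) ^ c = (1 :: rat mpser)" for c
      by (metis power_mult_distrib mult_minus1_right minus_minus power_one)
    then show "(- 1) ^ card (inversions n p) * ?w (perm_matching p) =
        (- 1) ^ skew_z \<alpha> \<mu> * ((- 1) ^ crossing_number (perm_matching p) * ?w (perm_matching p))"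
      unfolding z power_add by (metis (no_types, lifting) mult.assoc mult_1)
  qed
  also have "\<dots> = (- 1) ^ skew_z \<alpha> \<mu> * (\<Sum>I\<in>perm_matching ` matching_perms. (- 1) ^ crossing_number I * ?w I)"
    by (simp add: sum_distrib_left sum.reindex[OF inj_on_perm_matching])
  also have "perm_matching ` matching_perms = interval_sets \<alpha> \<mu>"
    using perm_matching_in_matchings perm_matching_surj by (auto simp: interval_sets_eq)
  finally show ?thesis .
qed

end

theorem theorem5p2:
  fixes \<alpha> \<mu> :: "nat list" and r :: nat
  assumes "is_partition \<alpha>" and "is_partition \<mu>" and "part_subset \<mu> \<alpha>"
    and "skew_rank \<alpha> \<mu> = int r"
  shows "skew_schur_hat \<alpha> \<mu> r =
    (- 1) ^ skew_z \<alpha> \<mu> *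
      (\<Sum>I\<in>interval_sets \<alpha> \<mu>.
         (- 1) ^ crossing_number I * (\<Prod>(u, v)\<in>I. power_sum_tilde (nat (v - u))))"
proof -
  interpret skew_shape \<alpha> \<mu> by unfold_locales (use assms in auto)
  have "r = card (A - B)" using skew_rank_eq assms(4) by simp
  then show ?thesis using skew_schur_hat_expansion by simp
qed

end
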